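(* Let $n\in\mathbb{N}$, let $R$ be a field of characteristic $p\ge0$ and let $\delta\in R$. The Brauer algebra of type $C_n$, $B(C_n,R,\delta)$, is quasi-hereditary if and only if $\delta\ne0$ and $p>n$ (where characteristic $0$ is counted as satisfying $p>n$, i.e. the second condition reads: $p=0$ or $p>n$).
   Context: A Brauer diagram on $2n$ strands is a perfect matching of $4n$ nodes arranged in a top row and a bottom row, each labelled $1,\dots,2n$ from left to right. The product $d_1d_2$ is formed by placing $d_1$ above $d_2$, identifying the bottom row of $d_1$ with the top row of $d_2$, removing closed loops, and multiplying by $\delta$ for each closed loop removed. Let $\sigma$ be the reflection in the vertical axis, $j\mapsto 2n+1-j$ on both rows. $B(C_n,R,\delta)$ is the $R$-algebra with $R$-basis the $\sigma$-invariant Brauer diagrams on $2n$ strands, with this product. Quasi-hereditary is meant in the usual sense of Cline–Parshall–Scott (existence of a heredity chain of two-sided ideals).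
   Formalization: The case n=1 with R of characteristic 2 is excluded, since for δ≠0 the algebra is then commutative, not semisimple and hence not quasi-hereditary although p=2>n; also n≥1 is assumed, since for n=0 the algebra is R, which is quasi-hereditary even when δ=0. *)

theory Defs
  imports
    Complex_Main
    "HOL-Library.Disjoint_Sets"
    "HOL-Algebra.Module"
    "HOL-Algebra.QuotRing"
    "HOL-Algebra.Ideal_Product"
begin

section \<open>Symmetric Brauer diagrams\<close>

text \<open>
  A node is a pair (row, position). A diagram uses row 0 (top) and row 1 (bottom) and is the set of
  its edges, each edge being the set of its two end nodes.
\<close>

type_synonym node = "nat \<times> nat"
type_synonym diagram = "node set set"

definition node_row :: "nat \<Rightarrow> nat \<Rightarrow> node set" where
  "node_row n r = {r} \<times> {1..2 * n}"

definition brauer_diagrams :: "nat \<Rightarrow> diagram set" where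
  "brauer_diagrams n =
     {d. partition_on (node_row n 0 \<union> node_row n 1) d \<and> (\<forall>e\<in>d. card e = 2)}"

definition reflect_node :: "nat \<Rightarrow> node \<Rightarrow> node" where
  "reflect_node n = (\<lambda>(r, j). (r, 2 * n + 1 - j))"

definition symmetric_diagrams :: "nat \<Rightarrow> diagram set" where
  "symmetric_diagrams n = {d \<in> brauer_diagrams n. (\<lambda>e. reflect_node n ` e) ` d = d}"

definition identity_diagram :: "nat \<Rightarrow> diagram" where
  "identity_diagram n = {{(0, j), (1, j)} | j. j \<in> {1..2 * n}}"

text \<open>
  Placing \<open>d1\<close> above \<open>d2\<close> gives a graph on rows 0, 1, 2, with row 1 the identified middle row.
  An edge occurring both in \<open>d1\<close> and in the shifted \<open>d2\<close> is kept only once; this does not change the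
  connected components, and it is a component inside the middle row, i.e. a closed loop.
\<close>

definition stack_edges :: "diagram \<Rightarrow> diagram \<Rightarrow> node set set" where
  "stack_edges d1 d2 = d1 \<union> (\<lambda>e. map_prod Suc id ` e) ` d2"

definition stack_components :: "nat \<Rightarrow> diagram \<Rightarrow> diagram \<Rightarrow> node set set" where
  "stack_components n d1 d2 =
     (node_row n 0 \<union> node_row n 1 \<union> node_row n 2) //
       {(x, y). \<exists>e\<in>stack_edges d1 d2. x \<in> e \<and> y \<in> e}\<^sup>*"

definition closed_loops :: "nat \<Rightarrow> diagram \<Rightarrow> diagram \<Rightarrow> nat" where
  "closed_loops n d1 d2 = card {C \<in> stack_components n d1 d2. C \<subseteq> node_row n 1}"

text \<open>
  Every other component is a path with both end points in the outer rows; it becomes an edge of the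
  composite. Division by 2 renumbers the outer rows 0, 2 as 0, 1.
\<close>

definition compose_diagrams :: "nat \<Rightarrow> diagram \<Rightarrow> diagram \<Rightarrow> diagram" where
  "compose_diagrams n d1 d2 =
     {(\<lambda>(r, j). (r div 2, j)) ` (C - node_row n 1) | C.
        C \<in> stack_components n d1 d2 \<and> \<not> C \<subseteq> node_row n 1}"


section \<open>The Brauer algebra of type C\<close>

text \<open>
  An element is its coefficient function with respect to the basis of symmetric diagrams. The
  multiplication is the bilinear extension of
  \<open>d1 d2 = \<delta> ^ closed_loops n d1 d2 \<cdot> compose_diagrams n d1 d2\<close>.
\<close>

definition brauer_algebra_C :: "nat \<Rightarrow> 'r::comm_ring_1 \<Rightarrow> ('r, diagram \<Rightarrow> 'r) module" where
  "brauer_algebra_C n \<delta> =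
     \<lparr> carrier = {f. \<forall>d. d \<notin> symmetric_diagrams n \<longrightarrow> f d = 0},
       mult = (\<lambda>f g d. \<Sum>(d1, d2) \<in> {(d1, d2). d1 \<in> symmetric_diagrams n \<and>
                  d2 \<in> symmetric_diagrams n \<and> compose_diagrams n d1 d2 = d}.
                f d1 * g d2 * \<delta> ^ closed_loops n d1 d2),
       one = (\<lambda>d. if d = identity_diagram n then 1 else 0),
       zero = (\<lambda>d. 0),
       add = (\<lambda>f g d. f d + g d),
       smult = (\<lambda>c f d. c * f d) \<rparr>"


section \<open>Projective left modules over a not necessarily commutative ring\<close>

text \<open>
  The record type \<open>('a, 'b) module\<close> is used for left modules; its multiplicative components
  \<open>mult\<close> and \<open>one\<close> play no role. The library locale \<open>module\<close> does not apply because it requires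
  a commutative ring of scalars.
\<close>

definition left_module_hom ::
  "('a, 'm) ring_scheme \<Rightarrow> ('a, 'b) module \<Rightarrow> ('a, 'c) module \<Rightarrow> ('b \<Rightarrow> 'c) set" where
  "left_module_hom A M N =
     {h \<in> carrier M \<rightarrow> carrier N.
        (\<forall>x\<in>carrier M. \<forall>y\<in>carrier M. h (x \<oplus>\<^bsub>M\<^esub> y) = h x \<oplus>\<^bsub>N\<^esub> h y) \<and>
        (\<forall>a\<in>carrier A. \<forall>x\<in>carrier M. h (a \<odot>\<^bsub>M\<^esub> x) = a \<odot>\<^bsub>N\<^esub> h x)}"

definition free_left_module :: "('a, 'm) ring_scheme \<Rightarrow> 'x set \<Rightarrow> ('a, 'x \<Rightarrow> 'a) module" where
  "free_left_module A X =
     \<lparr> carrier = {f. f \<in> X \<rightarrow> carrier A \<and> (\<forall>x. x \<notin> X \<longrightarrow> f x = \<zero>\<^bsub>A\<^esub>) \<and>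
                    finite {x. f x \<noteq> \<zero>\<^bsub>A\<^esub>}},
       mult = undefined,
       one = undefined,
       zero = (\<lambda>x. \<zero>\<^bsub>A\<^esub>),
       add = (\<lambda>f g x. f x \<oplus>\<^bsub>A\<^esub> g x),
       smult = (\<lambda>a f x. a \<otimes>\<^bsub>A\<^esub> f x) \<rparr>"

text \<open>
  Projective means being a direct summand of a free module. Restricting the basis \<open>X\<close> to the type
  of the elements of \<open>P\<close> loses nothing, since \<open>P\<close> is a quotient of the free module on its own
  elements and a projective \<open>P\<close> splits off from it.
\<close>

definition projective_left_module :: "('a, 'm) ring_scheme \<Rightarrow> ('a, 'b) module \<Rightarrow> bool" where
  "projective_left_module A P \<longleftrightarrow>
     (\<exists>(X :: 'b set) i q.
        i \<in> left_module_hom A P (free_left_module A X) \<and>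
        q \<in> left_module_hom A (free_left_module A X) P \<and>
        (\<forall>x\<in>carrier P. q (i x) = x))"

definition ideal_as_left_module :: "('a, 'm) ring_scheme \<Rightarrow> 'a set \<Rightarrow> ('a, 'a) module" where
  "ideal_as_left_module A J =
     \<lparr> carrier = J, mult = undefined, one = undefined, zero = \<zero>\<^bsub>A\<^esub>,
       add = (\<lambda>x y. x \<oplus>\<^bsub>A\<^esub> y), smult = (\<lambda>a x. a \<otimes>\<^bsub>A\<^esub> x) \<rparr>"


section \<open>Quasi-hereditary algebras\<close>

definition left_ideal :: "('a, 'm) ring_scheme \<Rightarrow> 'a set \<Rightarrow> bool" where
  "left_ideal A I \<longleftrightarrow>
     additive_subgroup I A \<and> (\<forall>a\<in>carrier A. \<forall>x\<in>I. a \<otimes>\<^bsub>A\<^esub> x \<in> I)"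

definition maximal_left_ideal :: "('a, 'm) ring_scheme \<Rightarrow> 'a set \<Rightarrow> bool" where
  "maximal_left_ideal A I \<longleftrightarrow>
     left_ideal A I \<and> I \<noteq> carrier A \<and>
     (\<forall>K. left_ideal A K \<and> I \<subseteq> K \<longrightarrow> K = I \<or> K = carrier A)"

definition jacobson_radical :: "('a, 'm) ring_scheme \<Rightarrow> 'a set" where
  "jacobson_radical A = carrier A \<inter> \<Inter> {I. maximal_left_ideal A I}"

text \<open>
  Projectivity is required of \<open>J\<close> as a left module. For a finite-dimensional algebra, an ideal
  with the other properties is projective on the left if and only if it is so on the right.
\<close>

definition heredity_ideal :: "('a, 'm) ring_scheme \<Rightarrow> 'a set \<Rightarrow> bool" where
  "heredity_ideal A J \<longleftrightarrow>
     ideal J A \<and>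
     ideal_prod A J J = J \<and>
     ideal_prod A (ideal_prod A J (jacobson_radical A)) J = {\<zero>\<^bsub>A\<^esub>} \<and>
     projective_left_module A (ideal_as_left_module A J)"

text \<open>
  The notion depends only on the ring structure: two-sided ideals of a unital algebra are
  automatically subspaces. The \<open>ideal\<close> hypotheses include that \<open>A\<close> is a ring. The image of \<open>J (Suc i)\<close> in the
  quotient by \<open>J i\<close> is the set of cosets of its elements.
\<close>

definition quasi_hereditary :: "('a, 'm) ring_scheme \<Rightarrow> bool" where
  "quasi_hereditary A \<longleftrightarrow>
     (\<exists>(m :: nat) J.
        J 0 = {\<zero>\<^bsub>A\<^esub>} \<and> J m = carrier A \<and>
        (\<forall>i\<le>m. ideal (J i) A) \<and>
        (\<forall>i<m. J i \<subset> J (Suc i) \<and>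
               heredity_ideal (A Quot (J i)) ((\<lambda>a. J i +>\<^bsub>A\<^esub> a) ` J (Suc i))))"

end

theory Submission
  imports
    Defs
    "HOL-Library.Function_Algebras"
    "HOL-Computational_Algebra.Primes"
    "HOL-Algebra.Sylow"
begin

text \<open>Filter the algebra by the number of through strands. A symmetric diagram with \<open>k\<close> arcs in each row
  has \<open>n - k\<close> mirror pairs of through strands, and composition never creates through strands, so the
  diagrams with fewer than \<open>i\<close> such pairs span an ideal \<open>rank_ideal i\<close>. The layer with exactly \<open>i\<close>
  pairs is an inflation of the group algebra of the hyperoctahedral group, of order \<open>2 ^ i * fact i\<close>:
  the diagrams whose arcs are prescribed, and equal in both rows, form such a group (\<open>arc_group\<close>).

  Suppose \<open>\<delta> \<noteq> 0\<close> and the characteristic \<open>p\<close> is \<open>0\<close> or exceeds \<open>n\<close>. Then \<open>p\<close> divides none of the orders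
  \<open>2 ^ i * fact i\<close> with \<open>i \<le> n\<close>; here \<open>p = 2\<close> would force \<open>n = 1\<close>, the excluded case. Multiplying the
  projection diagrams with arcs \<open>b\<close> by \<open>\<delta>\<close> to the power \<open>- card b\<close> gives idempotents \<open>e b\<close>. Modulo the
  lower layers, an element is the sum over \<open>b\<close> of its parts with bottom arcs \<open>b\<close>, and \<open>e b\<close> fixes the part
  belonging to \<open>b\<close> under right multiplication. This is a dual basis, so the layer \<open>J\<close> is projective,
  and \<open>J = J\<^sup>2\<close>. By Maschke's theorem the group algebras are von Neumann regular
  (\<open>group_algebra_regular\<close>), so a product \<open>e b r e c\<close> is a multiple of an idempotent multiple of \<open>r\<close>. If \<open>r\<close>
  is in the radical, that idempotent is zero, whence \<open>J rad J = 0\<close> (\<open>heredity_ideal_criterion\<close>).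

  The converse rests on a theorem of Lenzing type, \<open>quasi_hereditary_trace_nilpotent\<close>: on a
  quasi-hereditary ring of finite length every trace functional \<open>\<tau>\<close>, that is, every additive map with
  \<open>\<tau> (x y) = \<tau> (y x)\<close>, vanishes at nilpotent elements. For a heredity ideal \<open>J\<close> the Hattori-Stallings trace of
  right multiplication on the projective left module \<open>J\<close> is again a trace functional; it agrees with \<open>\<tau>\<close>
  on \<open>J\<close>, and it kills nilpotent elements because the endomorphism ring of \<open>J\<close> is von Neumann regular.
  Subtracting it and passing to the quotient by \<open>J\<close> gives the theorem by induction along the heredity
  chain.

  If \<open>0 < p \<le> n\<close>, the sum \<open>x\<close> of a subgroup of order \<open>p\<close> of permutation diagrams satisfies
  \<open>x\<^sup>2 = p x = 0\<close>, but the coefficient of the identity diagram is a trace functional with value 1 at \<open>x\<close>. If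
  \<open>\<delta> = 0\<close>, consider the functional whose value at a diagram is 1 or 0 according to whether its closure
  on an annulus is connected. As \<open>\<delta> = 0\<close>, its value at a product \<open>d1 d2\<close> says whether the graph obtained by
  gluing both diagrams into the annulus is connected, which is symmetric in \<open>d1\<close> and \<open>d2\<close>. The functional is
  1 at the diagram \<open>zigzag n\<close>, whose square contains a closed loop and therefore vanishes.

  That the diagrams multiply associatively is a statement on contracting rows of a stack: if a
  graph \<open>D\<close> records how a graph \<open>E\<close> connects the nodes outside a row, then \<open>E\<close> may be replaced by \<open>D\<close> after
  counting the components inside that row (\<open>contracts_conn\<close>, \<open>card_closed_classes_contract\<close>). That a
  composite is again a perfect matching follows by counting edges of a component
  (\<open>card_class_le_edges\<close>).\<close>

section \<open>Left ideals in rings of finite length\<close>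

text \<open>A bound on the length of chains of left ideals, given by any strictly monotone function into the
  naturals. In this form it passes to quotients by pulling back, is provided by the dimension for a
  finite-dimensional algebra, and gives left ideals of least or greatest length with a given property at once.\<close>

definition finite_left_length :: "('a, 'm) ring_scheme \<Rightarrow> bool" where
  "finite_left_length A \<longleftrightarrow>
     (\<exists>len :: 'a set \<Rightarrow> nat. \<forall>I K. left_ideal A I \<longrightarrow> left_ideal A K \<longrightarrow> I \<subset> K \<longrightarrow> len I < len K)"

definition trace_functional :: "('a, 'm) ring_scheme \<Rightarrow> ('a \<Rightarrow> 'k::ab_group_add) \<Rightarrow> bool" where
  "trace_functional A \<tau> \<longleftrightarrow>
     (\<forall>x\<in>carrier A. \<forall>y\<in>carrier A.
        \<tau> (x \<oplus>\<^bsub>A\<^esub> y) = \<tau> x + \<tau> y \<and> \<tau> (x \<otimes>\<^bsub>A\<^esub> y) = \<tau> (y \<otimes>\<^bsub>A\<^esub> x))"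

context ring
begin

lemma left_idealI:
  assumes sub: "I \<subseteq> carrier R" and zero: "\<zero> \<in> I"
    and add: "\<And>x y. x \<in> I \<Longrightarrow> y \<in> I \<Longrightarrow> x \<oplus> y \<in> I"
    and mult: "\<And>a x. a \<in> carrier R \<Longrightarrow> x \<in> I \<Longrightarrow> a \<otimes> x \<in> I"
  shows "left_ideal R I"
proof -
  have neg: "\<ominus> x \<in> I" if "x \<in> I" for x
  proof -
    have x: "x \<in> carrier R" using sub that by auto
    have "\<ominus> \<one> \<otimes> x = \<ominus> x" using x by (simp add: l_minus)
    then show ?thesis using mult[of "\<ominus> \<one>" x] that by simp
  qed
  have "subgroup I (add_monoid R)"
    by (rule subgroup.intro) (use sub zero add neg in \<open>auto simp: a_inv_def\<close>)
  then show ?thesis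
    unfolding left_ideal_def using mult by (auto intro: additive_subgroupI)
qed

lemma minus_plus_cancel: "a \<in> carrier R \<Longrightarrow> b \<in> carrier R \<Longrightarrow> a \<ominus> b \<oplus> b = a"
  by (simp add: a_minus_def a_assoc l_neg)

lemma minus_eq_if_eq_plus:
  "y = d \<oplus> e \<Longrightarrow> d \<in> carrier R \<Longrightarrow> e \<in> carrier R \<Longrightarrow> y \<ominus> e = d"
  by (simp add: a_minus_def a_assoc r_neg)

lemma eq_if_minus_eq_zero:
  assumes "a \<ominus> b = \<zero>" "a \<in> carrier R" "b \<in> carrier R"
  shows "a = b"
  using minus_plus_cancel[OF assms(2,3)] assms(1,3) by simp

lemma left_ideal_mem:
  assumes "left_ideal R I"
  shows "I \<subseteq> carrier R" "\<zero> \<in> I" "\<And>x y. x \<in> I \<Longrightarrow> y \<in> I \<Longrightarrow> x \<oplus> y \<in> I"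
    "\<And>a x. a \<in> carrier R \<Longrightarrow> x \<in> I \<Longrightarrow> a \<otimes> x \<in> I" "\<And>x y. x \<in> I \<Longrightarrow> y \<in> I \<Longrightarrow> x \<ominus> y \<in> I"
  using assms unfolding left_ideal_def a_minus_def
  by (auto simp: additive_subgroup.a_subset additive_subgroup.zero_closed
      additive_subgroup.a_closed additive_subgroup.a_inv_closed additive_subgroup.a_Hcarr)

lemma left_ideal_if_ideal:
  assumes "ideal I R"
  shows "left_ideal R I"
  using assms unfolding left_ideal_def by (simp add: ideal.axioms(1) ideal.I_l_closed)

lemma left_ideal_finsum:
  assumes "left_ideal R I" and "\<And>k. k \<in> X \<Longrightarrow> f k \<in> I"
  shows "(\<Oplus>k\<in>X. f k) \<in> I"
proof (cases "finite X")
  case True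
  then show ?thesis using assms(2)
  proof (induction X)
    case empty
    then show ?case using left_ideal_mem[OF assms(1)] by simp
  next
    case (insert k X)
    have "f \<in> insert k X \<rightarrow> carrier R"
      using insert.prems left_ideal_mem(1)[OF assms(1)] by blast
    then have "(\<Oplus>j\<in>insert k X. f j) = f k \<oplus> (\<Oplus>j\<in>X. f j)"
      using insert.hyps by (intro finsum_insert) auto
    then show ?case using insert left_ideal_mem(3)[OF assms(1)] by simp
  qed
next
  case False
  then show ?thesis using left_ideal_mem[OF assms(1)] by (simp add: finsum_infinite)
qed

lemma left_ideal_proper_iff:
  assumes "left_ideal R I"
  shows "I \<noteq> carrier R \<longleftrightarrow> \<one> \<notin> I"
proof
  show "\<one> \<notin> I \<Longrightarrow> I \<noteq> carrier R" by auto
  show "\<one> \<notin> I" if "I \<noteq> carrier R"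
  proof
    assume "\<one> \<in> I"
    then have "a \<in> I" if "a \<in> carrier R" for a
      using left_ideal_mem(4)[OF assms that, of \<one>] that by simp
    then show False using that left_ideal_mem(1)[OF assms] by auto
  qed
qed

lemma left_ideal_principal_sum:
  assumes "left_ideal R M" "y \<in> carrier R"
  shows "left_ideal R {m \<oplus> a \<otimes> y | m a. m \<in> M \<and> a \<in> carrier R}" (is "left_ideal R ?S")
proof (rule left_idealI)
  note M = left_ideal_mem[OF assms(1)]
  show "?S \<subseteq> carrier R" using M(1) assms(2) by auto
  have "\<zero> = \<zero> \<oplus> \<zero> \<otimes> y" using assms(2) by simp
  then show "\<zero> \<in> ?S" using M(2) by blast
  show "x \<oplus> z \<in> ?S" if xz: "x \<in> ?S" "z \<in> ?S" for x z
  proof -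
    obtain m a m' a' where 1: "x = m \<oplus> a \<otimes> y" "z = m' \<oplus> a' \<otimes> y" "m \<in> M" "m' \<in> M"
      "a \<in> carrier R" "a' \<in> carrier R" using xz by auto
    have c: "m \<in> carrier R" "m' \<in> carrier R" using 1 M(1) by auto
    have "x \<oplus> z = (m \<oplus> m') \<oplus> (a \<oplus> a') \<otimes> y"
      using 1 c assms(2) by (simp add: l_distr) algebra
    then show ?thesis using 1 M(3) by blast
  qed
  show "b \<otimes> x \<in> ?S" if b: "b \<in> carrier R" "x \<in> ?S" for b x
  proof -
    obtain m a where 1: "x = m \<oplus> a \<otimes> y" "m \<in> M" "a \<in> carrier R" using b by auto
    have "m \<in> carrier R" using 1 M(1) by auto
    then have "b \<otimes> x = b \<otimes> m \<oplus> (b \<otimes> a) \<otimes> y"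
      unfolding 1(1) using 1(3) b(1) assms(2) by (simp add: r_distr m_assoc)
    then show ?thesis using 1 b M(4) by blast
  qed
qed

lemma maximal_left_ideal_exists:
  assumes "finite_left_length R" "left_ideal R I" "\<one> \<notin> I"
  obtains M where "maximal_left_ideal R M" "I \<subseteq> M"
proof -
  obtain len :: "'a set \<Rightarrow> nat" where
    len: "\<And>I K. left_ideal R I \<Longrightarrow> left_ideal R K \<Longrightarrow> I \<subset> K \<Longrightarrow> len I < len K"
    using assms(1) unfolding finite_left_length_def by blast
  have top: "left_ideal R (carrier R)" by (rule left_idealI) auto
  let ?P = "\<lambda>K. left_ideal R K \<and> I \<subseteq> K \<and> \<one> \<notin> K"
  have "\<forall>K. ?P K \<longrightarrow> len K < len (carrier R)"
    using len top left_ideal_mem(1) by (metis one_closed psubsetI)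
  then obtain M where M: "?P M" "\<forall>K. ?P K \<longrightarrow> len K \<le> len M"
    using ex_has_greatest_nat[of ?P I len "len (carrier R)"] assms(2,3) by blast
  have "maximal_left_ideal R M"
    unfolding maximal_left_ideal_def
  proof (intro conjI allI impI)
    show "left_ideal R M" "M \<noteq> carrier R" using M by auto
    fix K assume K: "left_ideal R K \<and> M \<subseteq> K"
    show "K = M \<or> K = carrier R"
    proof (rule ccontr)
      assume n: "\<not> (K = M \<or> K = carrier R)"
      then have "\<one> \<notin> K" using K left_ideal_proper_iff by blast
      then have "len K \<le> len M" using M K by blast
      moreover have "len M < len K" using len M K n by blast
      ultimately show False by simp
    qed
  qed
  then show ?thesis using that M by blast
qed

lemma maximal_left_idealD:
  assumes "maximal_left_ideal R M"
  shows "left_ideal R M" "\<one> \<notin> M"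
  using assms left_ideal_proper_iff unfolding maximal_left_ideal_def by blast+

text \<open>The left ideal \<open>M + R y\<close> is strictly larger than \<open>M\<close>, hence contains \<open>c\<close>.\<close>

lemma maximal_left_ideal_decompose:
  assumes "maximal_left_ideal R M" "y \<in> carrier R" "y \<notin> M" "c \<in> carrier R"
  obtains a where "a \<in> carrier R" "c \<ominus> a \<otimes> y \<in> M"
proof -
  note M = left_ideal_mem[OF maximal_left_idealD(1)[OF assms(1)]]
  let ?S = "{m \<oplus> a \<otimes> y | m a. m \<in> M \<and> a \<in> carrier R}"
  have S: "left_ideal R ?S"
    using left_ideal_principal_sum maximal_left_idealD(1)[OF assms(1)] assms(2) by blast
  have "M \<subseteq> ?S"
  proof
    fix m assume "m \<in> M"
    moreover from this have "m = m \<oplus> \<zero> \<otimes> y" using M(1) assms(2) by auto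
    ultimately show "m \<in> ?S" by blast
  qed
  moreover have "y \<in> ?S"
  proof -
    have "y = \<zero> \<oplus> \<one> \<otimes> y" using assms(2) by simp
    then show ?thesis using M(2) by blast
  qed
  ultimately have "?S = carrier R"
    using assms(1,3) S unfolding maximal_left_ideal_def by blast
  then obtain m a where ma: "c = m \<oplus> a \<otimes> y" "m \<in> M" "a \<in> carrier R" using assms(4) by blast
  have mc: "m \<in> carrier R" using ma M(1) by auto
  have "c \<ominus> a \<otimes> y = m"
    using ma mc assms(2) by (simp add: a_minus_def a_assoc r_neg)
  then show ?thesis using that ma by simp
qed

lemma radical_mem:
  assumes "r \<in> jacobson_radical R" "maximal_left_ideal R M"
  shows "r \<in> M"
  using assms unfolding jacobson_radical_def by blast

lemma radical_carrier: "r \<in> jacobson_radical R \<Longrightarrow> r \<in> carrier R"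
  unfolding jacobson_radical_def by blast

end

section \<open>Endomorphisms of a heredity ideal\<close>

text \<open>Projectivity of the left module \<open>J\<close> enters through a finite dual basis: elements \<open>u k\<close> and coordinate
  functionals \<open>\<phi> k\<close> that recover every element of \<open>J\<close>.\<close>

locale heredity_basis = ring R for R (structure) +
  fixes J :: "'a set" and X :: "'x set" and u :: "'x \<Rightarrow> 'a" and \<phi> :: "'x \<Rightarrow> 'a \<Rightarrow> 'a"
  assumes ideal: "ideal J R"
    and finite_basis: "finite X"
    and u_mem: "\<And>k. k \<in> X \<Longrightarrow> u k \<in> J"
    and coord_carrier: "\<And>k y. k \<in> X \<Longrightarrow> y \<in> J \<Longrightarrow> \<phi> k y \<in> carrier R"
    and coord_add: "\<And>k x y. k \<in> X \<Longrightarrow> x \<in> J \<Longrightarrow> y \<in> J \<Longrightarrow> \<phi> k (x \<oplus> y) = \<phi> k x \<oplus> \<phi> k y"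
    and coord_mult: "\<And>k a y. k \<in> X \<Longrightarrow> a \<in> carrier R \<Longrightarrow> y \<in> J \<Longrightarrow> \<phi> k (a \<otimes> y) = a \<otimes> \<phi> k y"
    and expand: "\<And>y. y \<in> J \<Longrightarrow> y = (\<Oplus>k\<in>X. \<phi> k y \<otimes> u k)"
    and idempotent: "ideal_prod R J J = J"
    and radical_zero: "ideal_prod R (ideal_prod R J (jacobson_radical R)) J = {\<zero>}"
    and finite_length: "finite_left_length R"
begin

lemma J_left: "left_ideal R J"
  using ideal by (rule left_ideal_if_ideal)

lemmas J_mem = left_ideal_mem[OF J_left]

lemma J_carr [simp]: "y \<in> J \<Longrightarrow> y \<in> carrier R" using J_mem(1) by auto

lemma J_r_closed: "y \<in> J \<Longrightarrow> a \<in> carrier R \<Longrightarrow> y \<otimes> a \<in> J"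
  using ideal by (rule ideal.I_r_closed)

lemma J_induct [consumes 1, case_names prod sum]:
  assumes "y \<in> J"
    and "\<And>i j. i \<in> J \<Longrightarrow> j \<in> J \<Longrightarrow> P (i \<otimes> j)"
    and "\<And>x y. x \<in> J \<Longrightarrow> y \<in> J \<Longrightarrow> P x \<Longrightarrow> P y \<Longrightarrow> P (x \<oplus> y)"
  shows "P y"
proof -
  have "y \<in> ideal_prod R J J" using assms(1) idempotent by simp
  then show ?thesis
  proof (induction rule: ideal_prod.induct)
    case (prod i j)
    then show ?case using assms(2) by simp
  next
    case (sum x y)
    then show ?case using assms(3) idempotent by simp
  qed
qed

definition left_hom :: "('a \<Rightarrow> 'a) \<Rightarrow> bool" where
  "left_hom f \<longleftrightarrow> (\<forall>y\<in>J. f y \<in> carrier R) \<and> (\<forall>x\<in>J. \<forall>y\<in>J. f (x \<oplus> y) = f x \<oplus> f y) \<and>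
     (\<forall>a\<in>carrier R. \<forall>y\<in>J. f (a \<otimes> y) = a \<otimes> f y)"

lemma left_homD:
  assumes "left_hom f"
  shows "y \<in> J \<Longrightarrow> f y \<in> carrier R" "x \<in> J \<Longrightarrow> y \<in> J \<Longrightarrow> f (x \<oplus> y) = f x \<oplus> f y"
    "a \<in> carrier R \<Longrightarrow> y \<in> J \<Longrightarrow> f (a \<otimes> y) = a \<otimes> f y"
  using assms unfolding left_hom_def by auto

lemma left_hom_coord: "k \<in> X \<Longrightarrow> left_hom (\<phi> k)"
  unfolding left_hom_def using coord_carrier coord_add coord_mult by blast

text \<open>As \<open>J = J\<^sup>2\<close>, a homomorphism cannot leave \<open>J\<close>: it maps \<open>j \<otimes> j'\<close> to \<open>j \<otimes> f j'\<close>.\<close>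

lemma left_hom_mem:
  assumes "left_hom f" "y \<in> J"
  shows "f y \<in> J"
  using assms(2)
proof (induction rule: J_induct)
  case (prod i j)
  then have "f (i \<otimes> j) = i \<otimes> f j" using left_homD(3)[OF assms(1)] by simp
  then show ?case using prod left_homD(1)[OF assms(1)] J_r_closed by simp
next
  case (sum x y)
  then show ?case using left_homD(2)[OF assms(1)] J_mem(3) by simp
qed

lemma left_hom_eq_zero_if_annihilated:
  assumes "left_hom f" and ann: "\<And>i y. i \<in> J \<Longrightarrow> y \<in> J \<Longrightarrow> i \<otimes> f y = \<zero>" and "y \<in> J"
  shows "f y = \<zero>"
  using assms(3)
proof (induction rule: J_induct)
  case (prod i j)
  then show ?case using left_homD(3)[OF assms(1)] ann by simp
next
  case (sum x y)
  then show ?case using left_homD(2)[OF assms(1)] by simp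
qed

lemma left_hom_finsum:
  assumes "left_hom f" "finite Y" "\<And>k. k \<in> Y \<Longrightarrow> g k \<in> J"
  shows "f (\<Oplus>k\<in>Y. g k) = (\<Oplus>k\<in>Y. f (g k))"
  using assms(2,3)
proof (induction Y)
  case empty
  have "f \<zero> = f (\<zero> \<otimes> \<zero>)" by simp
  also have "\<dots> = \<zero> \<otimes> f \<zero>" by (rule left_homD(3)[OF assms(1)]) (auto simp: J_mem)
  also have "\<dots> = \<zero>" using left_homD(1)[OF assms(1), of \<zero>] J_mem(2) by simp
  finally show ?case by simp
next
  case (insert k Y)
  have J: "(\<Oplus>k\<in>Y. g k) \<in> J"
    using left_ideal_finsum[OF J_left, of Y g] insert.prems by blast
  have gc: "g \<in> Y \<rightarrow> carrier R" "g k \<in> carrier R" using insert by auto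
  have "f (\<Oplus>k\<in>insert k Y. g k) = f (g k \<oplus> (\<Oplus>k\<in>Y. g k))" using insert gc by simp
  also have "\<dots> = f (g k) \<oplus> f (\<Oplus>k\<in>Y. g k)" using left_homD(2)[OF assms(1)] J insert by simp
  also have "\<dots> = f (g k) \<oplus> (\<Oplus>k\<in>Y. f (g k))" using insert by simp
  also have "\<dots> = (\<Oplus>k\<in>insert k Y. f (g k))"
    using insert left_homD(1)[OF assms(1)] by (intro finsum_insert[symmetric]) auto
  finally show ?case .
qed

lemma left_hom_compose: "left_hom f \<Longrightarrow> left_hom g \<Longrightarrow> left_hom (\<lambda>y. f (g y))"
  using left_hom_mem unfolding left_hom_def by auto

lemma left_hom_minus:
  assumes "left_hom f" "left_hom g"
  shows "left_hom (\<lambda>y. f y \<ominus> g y)"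
proof -
  have 1: "(a \<oplus> b) \<ominus> (c \<oplus> d) = (a \<ominus> c) \<oplus> (b \<ominus> d)"
    if "a \<in> carrier R" "b \<in> carrier R" "c \<in> carrier R" "d \<in> carrier R" for a b c d
    using that by algebra
  have 2: "e \<otimes> a \<ominus> e \<otimes> b = e \<otimes> (a \<ominus> b)" if "a \<in> carrier R" "b \<in> carrier R" "e \<in> carrier R" for a b e
    using that by algebra
  show ?thesis
    unfolding left_hom_def using left_homD[OF assms(1)] left_homD[OF assms(2)] by (auto simp: 1 2)
qed

lemma left_hom_rmult: "a \<in> carrier R \<Longrightarrow> left_hom (\<lambda>y. y \<otimes> a)"
  unfolding left_hom_def by (auto simp: l_distr m_assoc)

text \<open>The coordinate map embeds \<open>J\<close> into the free module on \<open>X\<close>; the map below is its composite with the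
  homomorphism that sends the standard basis of that module to \<open>c\<close>.\<close>

lemma left_hom_combination:
  assumes c: "\<And>k. k \<in> X \<Longrightarrow> c k \<in> J"
  shows "left_hom (\<lambda>y. \<Oplus>k\<in>X. \<phi> k y \<otimes> c k)"
proof -
  have cl: "\<And>y. y \<in> J \<Longrightarrow> (\<lambda>k. \<phi> k y \<otimes> c k) \<in> X \<rightarrow> carrier R"
    using c coord_carrier by auto
  have cc: "\<And>k. k \<in> X \<Longrightarrow> c k \<in> carrier R" using c by auto
  show ?thesis
    unfolding left_hom_def
  proof (intro conjI ballI)
    show "\<And>y. y \<in> J \<Longrightarrow> (\<Oplus>k\<in>X. \<phi> k y \<otimes> c k) \<in> carrier R"
      using cl by (rule finsum_closed)
    fix x y assume xy: "x \<in> J" "y \<in> J"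
    have "(\<Oplus>k\<in>X. \<phi> k (x \<oplus> y) \<otimes> c k) = (\<Oplus>k\<in>X. \<phi> k x \<otimes> c k \<oplus> \<phi> k y \<otimes> c k)"
      using xy cc by (intro finsum_cong') (auto simp: coord_add coord_carrier l_distr)
    also have "\<dots> = (\<Oplus>k\<in>X. \<phi> k x \<otimes> c k) \<oplus> (\<Oplus>k\<in>X. \<phi> k y \<otimes> c k)"
      using cl xy by (intro finsum_addf) auto
    finally show "(\<Oplus>k\<in>X. \<phi> k (x \<oplus> y) \<otimes> c k) = (\<Oplus>k\<in>X. \<phi> k x \<otimes> c k) \<oplus> (\<Oplus>k\<in>X. \<phi> k y \<otimes> c k)" .
  next
    fix a y assume ay: "a \<in> carrier R" "y \<in> J"
    have "(\<Oplus>k\<in>X. \<phi> k (a \<otimes> y) \<otimes> c k) = (\<Oplus>k\<in>X. a \<otimes> (\<phi> k y \<otimes> c k))"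
      using ay cc by (intro finsum_cong') (auto simp: coord_mult coord_carrier m_assoc)
    also have "\<dots> = a \<otimes> (\<Oplus>k\<in>X. \<phi> k y \<otimes> c k)"
      using cl ay finite_basis by (intro finsum_rdistr[symmetric]) auto
    finally show "(\<Oplus>k\<in>X. \<phi> k (a \<otimes> y) \<otimes> c k) = a \<otimes> (\<Oplus>k\<in>X. \<phi> k y \<otimes> c k)" .
  qed
qed

text \<open>The submodule of \<open>J\<close> that is invisible to \<open>J\<close> itself. It contains \<open>rad \<otimes> J\<close> because
  \<open>J rad J = 0\<close>, so \<open>J\<close> modulo \<open>W\<close> is semisimple; and as \<open>J = J\<^sup>2\<close>, no nonzero homomorphism maps \<open>J\<close>
  into \<open>W\<close>.\<close>

definition W where "W = {y \<in> J. \<forall>i\<in>J. i \<otimes> y = \<zero>}"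

text \<open>The quotient of \<open>J\<close> by \<open>W\<close> embeds into a product of simple modules \<open>R / M\<close>: if all coordinates of
  \<open>y\<close> lie in the radical, then \<open>i \<otimes> y\<close> is in \<open>J rad J = 0\<close> for every \<open>i\<close> in \<open>J\<close>.\<close>

lemma coord_outside_maximal:
  assumes "y \<in> J" "y \<notin> W"
  obtains k M where "k \<in> X" "maximal_left_ideal R M" "\<phi> k y \<notin> M"
proof -
  have "\<exists>k\<in>X. \<phi> k y \<notin> jacobson_radical R"
  proof (rule ccontr)
    assume "\<not> ?thesis"
    then have rad: "\<And>k. k \<in> X \<Longrightarrow> \<phi> k y \<in> jacobson_radical R" by blast
    have "i \<otimes> y = \<zero>" if i: "i \<in> J" for i
    proof -
      have c: "\<And>k. k \<in> X \<Longrightarrow> \<phi> k y \<in> carrier R" "\<And>k. k \<in> X \<Longrightarrow> u k \<in> carrier R"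
        using assms coord_carrier u_mem by auto
      have "i \<otimes> y = i \<otimes> (\<Oplus>k\<in>X. \<phi> k y \<otimes> u k)" using expand[OF assms(1)] by simp
      also have "\<dots> = (\<Oplus>k\<in>X. i \<otimes> (\<phi> k y \<otimes> u k))"
        using c i finite_basis by (intro finsum_rdistr) auto
      also have "\<dots> = (\<Oplus>k\<in>X. \<zero>)"
      proof (intro finsum_cong')
        fix k assume k: "k \<in> X"
        have "i \<otimes> \<phi> k y \<in> ideal_prod R J (jacobson_radical R)"
          using i rad[OF k] by (rule ideal_prod.prod)
        then have "i \<otimes> \<phi> k y \<otimes> u k \<in> ideal_prod R (ideal_prod R J (jacobson_radical R)) J"
          using u_mem[OF k] by (rule ideal_prod.prod)
        then have "i \<otimes> \<phi> k y \<otimes> u k = \<zero>" using radical_zero by simp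
        then show "i \<otimes> (\<phi> k y \<otimes> u k) = \<zero>" using c k i by (simp add: m_assoc)
      qed auto
      finally show ?thesis by simp
    qed
    then show False using assms unfolding W_def by blast
  qed
  then obtain k where k: "k \<in> X" "\<phi> k y \<notin> jacobson_radical R" by blast
  then obtain M where "maximal_left_ideal R M" "\<phi> k y \<notin> M"
    using coord_carrier[OF k(1) assms(1)] unfolding jacobson_radical_def by blast
  then show ?thesis using that k by blast
qed

text \<open>The coordinate \<open>\<phi> k w\<close> lies in \<open>J\<close> and is annihilated by \<open>J\<close>. So its multiples have square zero, and
  the left ideal that it generates lies in every maximal left ideal.\<close>

lemma coord_W_mem_maximal:
  assumes k: "k \<in> X" and M: "maximal_left_ideal R M" and w: "w \<in> W"
  shows "\<phi> k w \<in> M"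
proof (rule ccontr)
  assume n: "\<phi> k w \<notin> M"
  let ?v = "\<phi> k w"
  have wJ: "w \<in> J" using w by (simp add: W_def)
  have v: "?v \<in> J" using left_hom_mem[OF left_hom_coord[OF k] wJ] .
  have zero: "i \<otimes> ?v = \<zero>" if "i \<in> J" for i
  proof -
    have "i \<otimes> ?v = \<phi> k (i \<otimes> w)" using coord_mult[OF k] that wJ by simp
    also have "\<dots> = \<phi> k (\<zero> \<otimes> \<zero>)" using w that by (simp add: W_def)
    also have "\<dots> = \<zero> \<otimes> \<phi> k \<zero>" using coord_mult[OF k] J_mem(2) by blast
    also have "\<dots> = \<zero>" using coord_carrier[OF k] J_mem(2) by simp
    finally show ?thesis .
  qed
  obtain a where a: "a \<in> carrier R" "\<one> \<ominus> a \<otimes> ?v \<in> M"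
    using maximal_left_ideal_decompose[OF M _ n one_closed] v by auto
  let ?b = "a \<otimes> ?v"
  have b: "?b \<in> J" using v a J_mem(4) by simp
  have "?b \<otimes> ?b = a \<otimes> (?v \<otimes> (a \<otimes> ?v))" using a v by (simp add: m_assoc)
  also have "\<dots> = a \<otimes> ((?v \<otimes> a) \<otimes> ?v)" using a v by (simp add: m_assoc)
  also have "\<dots> = \<zero>" using a v zero[OF J_r_closed] by simp
  finally have bb: "?b \<otimes> ?b = \<zero>" .
  \<comment> \<open>so \<open>\<one> + b\<close> is a left inverse of \<open>\<one> - b\<close>, which then cannot lie in \<open>M\<close>\<close>
  have "(\<one> \<oplus> b) \<otimes> (\<one> \<ominus> b) = \<one>" if "b \<in> carrier R" "b \<otimes> b = \<zero>" for b
    using that by (simp add: a_minus_def l_distr r_distr r_minus a_assoc l_neg r_neg)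
  then have "(\<one> \<oplus> ?b) \<otimes> (\<one> \<ominus> ?b) = \<one>" using bb b by simp
  moreover have "(\<one> \<oplus> ?b) \<otimes> (\<one> \<ominus> ?b) \<in> M"
    using left_ideal_mem(4)[OF maximal_left_idealD(1)[OF M]] a b by simp
  ultimately show False using maximal_left_idealD(2)[OF M] by simp
qed

text \<open>A left ideal \<open>C\<close> of least length with \<open>K + C = J\<close> is a complement. If \<open>K\<close> and \<open>C\<close> shared an element
  \<open>y\<close> outside \<open>W\<close>, then some coordinate of \<open>y\<close> would avoid a maximal left ideal \<open>M\<close>, and the elements of \<open>C\<close> with
  this coordinate in \<open>M\<close> would still suffice, since multiples of \<open>y\<close> correct the coordinate modulo \<open>M\<close>.\<close>

lemma complement_mod_W:
  assumes K: "left_ideal R K" "K \<subseteq> J"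
  obtains C where "left_ideal R C" "W \<subseteq> C" "C \<subseteq> J"
    "\<And>y. y \<in> J \<Longrightarrow> \<exists>x\<in>K. y \<ominus> x \<in> C" "K \<inter> C \<subseteq> W"
proof -
  obtain len :: "'a set \<Rightarrow> nat" where
    len: "\<And>I K. left_ideal R I \<Longrightarrow> left_ideal R K \<Longrightarrow> I \<subset> K \<Longrightarrow> len I < len K"
    using finite_length unfolding finite_left_length_def by blast
  let ?P = "\<lambda>C. left_ideal R C \<and> W \<subseteq> C \<and> C \<subseteq> J \<and> (\<forall>y\<in>J. \<exists>x\<in>K. y \<ominus> x \<in> C)"
  note Kmem = left_ideal_mem[OF K(1)]
  have "?P J" using J_left Kmem(2) by (auto simp: W_def a_minus_def intro!: bexI[of _ \<zero>])
  then obtain C where C: "?P C" "\<And>C'. ?P C' \<Longrightarrow> len C \<le> len C'"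
    using ex_has_least_nat[of ?P J len] by blast
  note Cmem = left_ideal_mem[OF conjunct1[OF C(1)]]
  have "K \<inter> C \<subseteq> W"
  proof (rule ccontr)
    assume "\<not> K \<inter> C \<subseteq> W"
    then obtain y where y: "y \<in> K" "y \<in> C" "y \<notin> W" by auto
    have yJ: "y \<in> J" using y K by auto
    obtain k M where kM: "k \<in> X" "maximal_left_ideal R M" "\<phi> k y \<notin> M"
      using coord_outside_maximal[OF yJ y(3)] .
    note M = left_ideal_mem[OF maximal_left_idealD(1)[OF kM(2)]]
    let ?C = "{c \<in> C. \<phi> k c \<in> M}"
    have CJ: "C \<subseteq> J" using C by simp
    have z: "\<phi> k \<zero> = \<zero>"
      using left_hom_finsum[OF left_hom_coord[OF kM(1)], of "{}" "\<lambda>_. \<zero>"] by simp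
    have L: "left_ideal R ?C"
    proof (rule left_idealI)
      show "?C \<subseteq> carrier R" using Cmem by auto
      show "\<zero> \<in> ?C" using z Cmem M by simp
      show "x \<oplus> y \<in> ?C" if "x \<in> ?C" "y \<in> ?C" for x y
        using that Cmem M coord_add[OF kM(1)] CJ by (auto simp: subset_iff)
      show "a \<otimes> x \<in> ?C" if "a \<in> carrier R" "x \<in> ?C" for a x
        using that Cmem M coord_mult[OF kM(1)] CJ by (auto simp: subset_iff)
    qed
    have "?P ?C"
    proof (intro conjI ballI)
      show "left_ideal R ?C" by (rule L)
      show "W \<subseteq> ?C" using coord_W_mem_maximal[OF kM(1,2)] C by auto
      show "?C \<subseteq> J" using C by auto
      fix z assume z: "z \<in> J"
      then obtain x where x: "x \<in> K" "z \<ominus> x \<in> C" using C by auto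
      have xJ: "x \<in> J" using x K by auto
      have zx: "z \<ominus> x \<in> J" using x CJ by auto
      obtain a where a: "a \<in> carrier R" "\<phi> k (z \<ominus> x) \<ominus> a \<otimes> \<phi> k y \<in> M"
        using maximal_left_ideal_decompose[OF kM(2) coord_carrier[OF kM(1) yJ] kM(3) coord_carrier[OF kM(1) zx]] .
      have eq: "z \<ominus> (x \<oplus> a \<otimes> y) = (z \<ominus> x) \<oplus> (\<ominus> a) \<otimes> y"
        using J_carr[OF z] J_carr[OF xJ] J_carr[OF yJ] a(1) by algebra
      have "\<phi> k (z \<ominus> (x \<oplus> a \<otimes> y)) = \<phi> k (z \<ominus> x) \<oplus> (\<ominus> a) \<otimes> \<phi> k y"
        unfolding eq using coord_add[OF kM(1)] coord_mult[OF kM(1)] zx yJ a J_mem(4) by simp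
      also have "\<dots> = \<phi> k (z \<ominus> x) \<ominus> a \<otimes> \<phi> k y"
        using a coord_carrier[OF kM(1)] zx yJ by (simp add: a_minus_def l_minus)
      finally have "\<phi> k (z \<ominus> (x \<oplus> a \<otimes> y)) \<in> M" using a by simp
      moreover have "z \<ominus> (x \<oplus> a \<otimes> y) \<in> C"
        unfolding eq using Cmem x y a by simp
      moreover have "x \<oplus> a \<otimes> y \<in> K" using Kmem x y a by simp
      ultimately show "\<exists>x\<in>K. z \<ominus> x \<in> ?C" by blast
    qed
    then have "len C \<le> len ?C" using C(2) by blast
    moreover have "?C \<subset> C" using y kM by auto
    ultimately show False using len[OF L conjunct1[OF C(1)]] by simp
  qed
  then show ?thesis using that C(1) by blast
qed

lemma left_hom_image_left:
  assumes "left_hom f" shows "left_ideal R (f ` J)"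
proof (rule left_idealI)
  show "f ` J \<subseteq> carrier R" using left_homD[OF assms] by auto
  show "\<zero> \<in> f ` J"
    using left_hom_finsum[OF assms, of "{}" "\<lambda>_. \<zero>"] J_mem(2) by (simp add: image_iff) metis
  show "x \<oplus> y \<in> f ` J" if "x \<in> f ` J" "y \<in> f ` J" for x y
    using that left_homD(2)[OF assms] J_mem(3) by (auto simp: image_iff) metis
  show "a \<otimes> x \<in> f ` J" if "a \<in> carrier R" "x \<in> f ` J" for a x
    using that left_homD(3)[OF assms] J_mem(4) by (auto simp: image_iff) metis
qed

text \<open>The endomorphism ring of \<open>J\<close> is von Neumann regular. Choose a complement \<open>D\<close> of the image of \<open>f\<close>
  modulo \<open>W\<close> and let \<open>g\<close> send \<open>u k\<close> to a preimage under \<open>f\<close> of its component in the image. Then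
  \<open>f g f - f\<close> maps into the image of \<open>f\<close> and into \<open>D\<close>, hence into \<open>W\<close>, and so vanishes.\<close>

lemma endomorphism_regular:
  assumes f: "left_hom f"
  obtains g where "left_hom g" "\<And>y. y \<in> J \<Longrightarrow> f (g (f y)) = f y"
proof -
  have fJ: "f ` J \<subseteq> J" using left_hom_mem[OF f] by auto
  obtain D where D: "left_ideal R D" "W \<subseteq> D" "D \<subseteq> J"
    "\<And>y. y \<in> J \<Longrightarrow> \<exists>x\<in>f ` J. y \<ominus> x \<in> D" "f ` J \<inter> D \<subseteq> W"
    using complement_mod_W[OF left_hom_image_left[OF f] fJ] by metis
  have "\<exists>c\<in>J. u k \<ominus> f c \<in> D" if "k \<in> X" for k
    using D(4)[OF u_mem[OF that]] by blast
  then obtain c where c: "\<And>k. k \<in> X \<Longrightarrow> c k \<in> J" "\<And>k. k \<in> X \<Longrightarrow> u k \<ominus> f (c k) \<in> D" by metis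
  let ?g = "\<lambda>y. \<Oplus>k\<in>X. \<phi> k y \<otimes> c k"
  have g: "left_hom ?g" using left_hom_combination c by blast
  have cc: "\<And>k. k \<in> X \<Longrightarrow> u k \<in> carrier R" "\<And>k. k \<in> X \<Longrightarrow> f (c k) \<in> carrier R"
    using c u_mem left_homD[OF f] by auto
  have D1: "y \<ominus> f (?g y) \<in> D" if y: "y \<in> J" for y
  proof -
    have yc: "\<And>k. k \<in> X \<Longrightarrow> \<phi> k y \<in> carrier R" using coord_carrier y by blast
    let ?d = "\<Oplus>k\<in>X. \<phi> k y \<otimes> (u k \<ominus> f (c k))"
    have dD: "?d \<in> D"
      by (intro left_ideal_finsum[OF D(1)] left_ideal_mem(4)[OF D(1)] yc c)
    have "f (?g y) = (\<Oplus>k\<in>X. f (\<phi> k y \<otimes> c k))"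
      using left_hom_finsum[OF f finite_basis] yc c J_mem(4) by simp
    also have "\<dots> = (\<Oplus>k\<in>X. \<phi> k y \<otimes> f (c k))"
      using yc c cc left_homD[OF f] by (intro finsum_cong') auto
    finally have fg: "f (?g y) = (\<Oplus>k\<in>X. \<phi> k y \<otimes> f (c k))" .
    have "y = (\<Oplus>k\<in>X. \<phi> k y \<otimes> u k)" using expand[OF y] .
    also have "\<dots> = (\<Oplus>k\<in>X. \<phi> k y \<otimes> (u k \<ominus> f (c k)) \<oplus> \<phi> k y \<otimes> f (c k))"
      using yc cc by (intro finsum_cong') (auto simp: r_distr[symmetric] minus_plus_cancel)
    also have "\<dots> = ?d \<oplus> (\<Oplus>k\<in>X. \<phi> k y \<otimes> f (c k))"
      using yc cc by (intro finsum_addf) auto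
    finally have "y = ?d \<oplus> f (?g y)" using fg by simp
    moreover have "?d \<in> carrier R" using dD D(3) by auto
    moreover have "f (?g y) \<in> carrier R" using left_homD(1)[OF f] left_hom_mem[OF g] y by simp
    ultimately have "y \<ominus> f (?g y) = ?d" by (rule minus_eq_if_eq_plus)
    then show ?thesis using dD by simp
  qed
  let ?h = "\<lambda>y. f y \<ominus> f (?g (f y))"
  have h: "left_hom ?h" using left_hom_minus[OF f left_hom_compose[OF f left_hom_compose[OF g f]]] .
  have hW: "?h y \<in> W" if y: "y \<in> J" for y
  proof -
    have "?h y \<in> D" using D1 left_hom_mem[OF f y] by simp
    moreover have "?h y \<in> f ` J"
      by (intro left_ideal_mem(5)[OF left_hom_image_left[OF f]] imageI left_hom_mem[OF f] left_hom_mem[OF g] y)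
    ultimately show ?thesis using D(5) by auto
  qed
  have "?h y = \<zero>" if y: "y \<in> J" for y
    using left_hom_eq_zero_if_annihilated[OF h _ y] hW unfolding W_def by blast
  then have "f (?g (f y)) = f y" if y: "y \<in> J" for y
  proof -
    have "f y = f (?g (f y))"
      by (rule eq_if_minus_eq_zero[OF \<open>\<And>y. y \<in> J \<Longrightarrow> ?h y = \<zero>\<close>[OF y]])
        (intro left_homD(1)[OF f] left_hom_mem[OF f] left_hom_mem[OF g] y)+
    then show ?thesis by simp
  qed
  then show ?thesis using that g by blast
qed

text \<open>The image under \<open>\<tau>\<close> of the Hattori-Stallings trace of an endomorphism of the projective module \<open>J\<close>.\<close>

definition hs_trace :: "('a \<Rightarrow> 'k) \<Rightarrow> ('a \<Rightarrow> 'a) \<Rightarrow> 'k::ab_group_add" where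
  "hs_trace \<tau> f = (\<Sum>k\<in>X. \<tau> (\<phi> k (f (u k))))"

context
  fixes \<tau> :: "'a \<Rightarrow> 'k::ab_group_add"
  assumes tau: "trace_functional R \<tau>"
begin

lemma tau_add: "x \<in> carrier R \<Longrightarrow> y \<in> carrier R \<Longrightarrow> \<tau> (x \<oplus> y) = \<tau> x + \<tau> y"
  and tau_mult: "x \<in> carrier R \<Longrightarrow> y \<in> carrier R \<Longrightarrow> \<tau> (x \<otimes> y) = \<tau> (y \<otimes> x)"
  using tau unfolding trace_functional_def by blast+

lemma tau_zero: "\<tau> \<zero> = 0"
  using tau_add[of \<zero> \<zero>] by simp

lemma tau_finsum:
  assumes "finite Y" "\<And>k. k \<in> Y \<Longrightarrow> f k \<in> carrier R"
  shows "\<tau> (\<Oplus>k\<in>Y. f k) = (\<Sum>k\<in>Y. \<tau> (f k))"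
  using assms
proof (induction Y)
  case empty
  then show ?case by (simp add: tau_zero)
next
  case (insert k Y)
  then have "f \<in> Y \<rightarrow> carrier R" by auto
  then show ?case using insert by (simp add: tau_add)
qed

text \<open>In coordinates this is the usual argument for \<open>tr (A B) = tr (B A)\<close>, with \<open>\<tau>\<close> absorbing the
  noncommutativity of the entries.\<close>

lemma hs_trace_commute:
  assumes f: "left_hom f" and g: "left_hom g"
  shows "hs_trace \<tau> (\<lambda>y. f (g y)) = hs_trace \<tau> (\<lambda>y. g (f y))"
proof -
  have exp: "hs_trace \<tau> (\<lambda>y. f (g y)) = (\<Sum>k\<in>X. \<Sum>l\<in>X. \<tau> (\<phi> l (g (u k)) \<otimes> \<phi> k (f (u l))))"
    if f: "left_hom f" and g: "left_hom g" for f g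
    unfolding hs_trace_def
  proof (rule sum.cong[OF refl])
    fix k assume k: "k \<in> X"
    have gk: "g (u k) \<in> J" using left_hom_mem[OF g u_mem[OF k]] .
    have c: "\<And>l. l \<in> X \<Longrightarrow> \<phi> l (g (u k)) \<in> carrier R" using gk coord_carrier by blast
    have fg: "left_hom (\<lambda>y. \<phi> k (f y))" using left_hom_compose[OF left_hom_coord[OF k] f] .
    have "\<phi> k (f (g (u k))) = \<phi> k (f (\<Oplus>l\<in>X. \<phi> l (g (u k)) \<otimes> u l))"
      using expand[OF gk] by simp
    also have "\<dots> = (\<Oplus>l\<in>X. \<phi> k (f (\<phi> l (g (u k)) \<otimes> u l)))"
      using left_hom_finsum[OF fg finite_basis] c u_mem J_mem(4) by simp
    also have "\<dots> = (\<Oplus>l\<in>X. \<phi> l (g (u k)) \<otimes> \<phi> k (f (u l)))"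
      using left_homD[OF fg] c u_mem by (intro finsum_cong') auto
    finally show "\<tau> (\<phi> k (f (g (u k)))) = (\<Sum>l\<in>X. \<tau> (\<phi> l (g (u k)) \<otimes> \<phi> k (f (u l))))"
      using tau_finsum[OF finite_basis] c left_homD[OF fg] u_mem by simp
  qed
  have "hs_trace \<tau> (\<lambda>y. f (g y)) = (\<Sum>k\<in>X. \<Sum>l\<in>X. \<tau> (\<phi> k (f (u l)) \<otimes> \<phi> l (g (u k))))"
    unfolding exp[OF f g]
    using left_hom_mem[OF f] left_hom_mem[OF g] u_mem coord_carrier by (intro sum.cong refl tau_mult) auto
  also have "\<dots> = hs_trace \<tau> (\<lambda>y. g (f y))"
    unfolding exp[OF g f] by (rule sum.swap)
  finally show ?thesis .
qed

lemma hs_trace_cong: "(\<And>y. y \<in> J \<Longrightarrow> f y = g y) \<Longrightarrow> hs_trace \<tau> f = hs_trace \<tau> g"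
  unfolding hs_trace_def using u_mem by (intro sum.cong) auto

lemma left_hom_funpow: "left_hom f \<Longrightarrow> left_hom (f ^^ k)"
proof (induction k)
  case 0
  then show ?case unfolding left_hom_def by auto
next
  case (Suc k)
  then show ?case using left_hom_compose[of f "f ^^ k"] by (simp add: comp_def)
qed

text \<open>Write \<open>f = f g f\<close>. Then \<open>f\<close> has the trace of \<open>g f f\<close>, whose \<open>m\<close>-th power is \<open>g f\<^sup>m\<^sup>+\<^sup>1\<close>:
  the index of nilpotency has dropped.\<close>

lemma hs_trace_nilpotent:
  assumes "left_hom f" "\<And>y. y \<in> J \<Longrightarrow> (f ^^ m) y = \<zero>"
  shows "hs_trace \<tau> f = 0"
  using assms
proof (induction m arbitrary: f)
  case 0
  then have "hs_trace \<tau> f = hs_trace \<tau> (\<lambda>_. \<zero>)"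
    using left_hom_mem[OF 0(1)] by (intro hs_trace_cong) auto
  moreover have "\<phi> k \<zero> = \<zero>" if "k \<in> X" for k
    using left_hom_finsum[OF left_hom_coord[OF that], of "{}" "\<lambda>_. \<zero>"] by simp
  ultimately show ?case by (simp add: hs_trace_def tau_zero)
next
  case (Suc m)
  note f = Suc.prems(1)
  obtain g where g: "left_hom g" "\<And>y. y \<in> J \<Longrightarrow> f (g (f y)) = f y"
    using endomorphism_regular[OF f] by blast
  let ?h = "\<lambda>y. g (f (f y))"
  have h: "left_hom ?h" using left_hom_compose[OF g(1) left_hom_compose[OF f f]] .
  have z: "f' \<zero> = \<zero>" if "left_hom f'" for f'
    using left_hom_finsum[OF that, of "{}" "\<lambda>_. \<zero>"] by simp
  have pow: "(?h ^^ Suc j) y = g ((f ^^ Suc (Suc j)) y)" if "y \<in> J" for y j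
  proof (induction j)
    case 0
    then show ?case by simp
  next
    case (Suc j)
    have "(f ^^ Suc j) y \<in> J" using left_hom_mem[OF left_hom_funpow[OF f] that] .
    then have "f (g ((f ^^ Suc (Suc j)) y)) = (f ^^ Suc (Suc j)) y"
      using g(2)[of "(f ^^ Suc j) y"] by simp
    then show ?case using Suc by simp
  qed
  have hm: "hs_trace \<tau> ?h = 0"
  proof (cases m)
    case 0
    then have "f y = \<zero>" if "y \<in> J" for y using Suc.prems(2)[OF that] by simp
    then have "?h y = \<zero>" if "y \<in> J" for y using z[OF f] z[OF g(1)] that by simp
    then have "hs_trace \<tau> ?h = hs_trace \<tau> (\<lambda>_. \<zero>)" by (intro hs_trace_cong) auto
    moreover have "\<phi> k \<zero> = \<zero>" if "k \<in> X" for k using z[OF left_hom_coord[OF that]] .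
    ultimately show ?thesis by (simp add: hs_trace_def tau_zero)
  next
    case (Suc j)
    have "(?h ^^ m) y = \<zero>" if "y \<in> J" for y
      using pow[OF that, of j] Suc.prems(2)[OF that] z[OF g(1)] Suc by (metis)
    then show ?thesis using Suc.IH[OF h] by blast
  qed
  have "hs_trace \<tau> f = hs_trace \<tau> (\<lambda>y. f (g (f y)))" using g(2) by (intro hs_trace_cong) simp
  also have "\<dots> = hs_trace \<tau> ?h"
    using hs_trace_commute[OF f left_hom_compose[OF g(1) f]] by simp
  finally show ?case using hm by simp
qed

lemma hs_trace_functional: "trace_functional R (\<lambda>a. hs_trace \<tau> (\<lambda>y. y \<otimes> a))"
  unfolding trace_functional_def
proof (intro ballI conjI)
  fix a b assume ab: "a \<in> carrier R" "b \<in> carrier R"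
  have "hs_trace \<tau> (\<lambda>y. y \<otimes> (a \<oplus> b)) = (\<Sum>k\<in>X. \<tau> (\<phi> k (u k \<otimes> a)) + \<tau> (\<phi> k (u k \<otimes> b)))"
    unfolding hs_trace_def
  proof (rule sum.cong[OF refl])
    fix k assume k: "k \<in> X"
    have "\<phi> k (u k \<otimes> (a \<oplus> b)) = \<phi> k (u k \<otimes> a) \<oplus> \<phi> k (u k \<otimes> b)"
      using coord_add[OF k J_r_closed J_r_closed] u_mem[OF k] ab by (simp add: r_distr)
    then show "\<tau> (\<phi> k (u k \<otimes> (a \<oplus> b))) = \<tau> (\<phi> k (u k \<otimes> a)) + \<tau> (\<phi> k (u k \<otimes> b))"
      using tau_add coord_carrier[OF k] J_r_closed u_mem[OF k] ab by simp
  qed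
  then show "hs_trace \<tau> (\<lambda>y. y \<otimes> (a \<oplus> b)) = hs_trace \<tau> (\<lambda>y. y \<otimes> a) + hs_trace \<tau> (\<lambda>y. y \<otimes> b)"
    by (simp add: hs_trace_def sum.distrib)
  have "hs_trace \<tau> (\<lambda>y. y \<otimes> (a \<otimes> b)) = hs_trace \<tau> (\<lambda>y. y \<otimes> a \<otimes> b)"
    using ab by (intro hs_trace_cong) (simp add: m_assoc)
  also have "\<dots> = hs_trace \<tau> (\<lambda>y. y \<otimes> b \<otimes> a)"
    using hs_trace_commute[OF left_hom_rmult[OF ab(2)] left_hom_rmult[OF ab(1)]] .
  also have "\<dots> = hs_trace \<tau> (\<lambda>y. y \<otimes> (b \<otimes> a))"
    using ab by (intro hs_trace_cong) (simp add: m_assoc)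
  finally show "hs_trace \<tau> (\<lambda>y. y \<otimes> (a \<otimes> b)) = hs_trace \<tau> (\<lambda>y. y \<otimes> (b \<otimes> a))" .
qed

text \<open>For \<open>j\<close> in \<open>J\<close> the coordinates of \<open>u k \<otimes> j\<close> are \<open>u k \<otimes> \<phi> k j\<close>, and \<open>\<tau>\<close> swaps the two factors.\<close>

lemma hs_trace_on_ideal:
  assumes j: "j \<in> J"
  shows "hs_trace \<tau> (\<lambda>y. y \<otimes> j) = \<tau> j"
proof -
  have c: "\<And>k. k \<in> X \<Longrightarrow> \<phi> k j \<in> carrier R" "\<And>k. k \<in> X \<Longrightarrow> u k \<in> carrier R"
    using coord_carrier j u_mem by auto
  have "hs_trace \<tau> (\<lambda>y. y \<otimes> j) = (\<Sum>k\<in>X. \<tau> (\<phi> k j \<otimes> u k))"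
    unfolding hs_trace_def
    using coord_mult j c by (intro sum.cong refl) (simp add: tau_mult)
  also have "\<dots> = \<tau> j"
    using tau_finsum[OF finite_basis, of "\<lambda>k. \<phi> k j \<otimes> u k"] c expand[OF j] by simp
  finally show ?thesis .
qed

lemma hs_trace_nilpotent_element:
  assumes x: "x \<in> carrier R" "x [^] (m::nat) = \<zero>"
  shows "hs_trace \<tau> (\<lambda>y. y \<otimes> x) = 0"
proof (rule hs_trace_nilpotent[OF left_hom_rmult[OF x(1)]])
  fix y assume y: "y \<in> J"
  have "((\<lambda>y. y \<otimes> x) ^^ k) y = y \<otimes> x [^] k" for k :: nat
    using x y by (induction k) (auto simp: m_assoc)
  then show "((\<lambda>y. y \<otimes> x) ^^ m) y = \<zero>" using x y by simp
qed

end

end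

section \<open>Nilpotent elements of quasi-hereditary rings\<close>

context ring
begin

text \<open>A direct summand of a free module has a dual basis, consisting of the images of the standard basis and
  the coordinates of the embedding.\<close>

lemma heredity_basis_exists:
  assumes len: "finite_left_length R" and heredity: "heredity_ideal R J"
  obtains X :: "'a set" and u \<phi> where "heredity_basis R J X u \<phi>"
proof -
  have id: "ideal J R" and proj: "projective_left_module R (ideal_as_left_module R J)"
    using heredity unfolding heredity_ideal_def by auto
  have J: "left_ideal R J"
    using id by (rule left_ideal_if_ideal)
  note Jm = left_ideal_mem[OF J]
  obtain X :: "'a set" and i q where
    i: "i \<in> left_module_hom R (ideal_as_left_module R J) (free_left_module R X)" and
    q: "q \<in> left_module_hom R (free_left_module R X) (ideal_as_left_module R J)" and
    qi: "\<And>y. y \<in> J \<Longrightarrow> q (i y) = y"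
    using proj unfolding projective_left_module_def ideal_as_left_module_def by auto
  let ?F = "{f. f \<in> X \<rightarrow> carrier R \<and> (\<forall>x. x \<notin> X \<longrightarrow> f x = \<zero>) \<and> finite {x. f x \<noteq> \<zero>}}"
  have i_mem: "i y \<in> ?F" if "y \<in> J" for y
    using i that unfolding left_module_hom_def free_left_module_def ideal_as_left_module_def by auto
  have i_add: "i (y \<oplus> z) = (\<lambda>x. i y x \<oplus> i z x)" if "y \<in> J" "z \<in> J" for y z
    using i that unfolding left_module_hom_def free_left_module_def ideal_as_left_module_def by auto
  have i_mult: "i (a \<otimes> y) = (\<lambda>x. a \<otimes> i y x)" if "a \<in> carrier R" "y \<in> J" for y a
    using i that unfolding left_module_hom_def free_left_module_def ideal_as_left_module_def by auto
  have q_mem: "q f \<in> J" if "f \<in> ?F" for f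
    using q that unfolding left_module_hom_def free_left_module_def ideal_as_left_module_def by auto
  have q_add: "q (\<lambda>x. f x \<oplus> g x) = q f \<oplus> q g" if "f \<in> ?F" "g \<in> ?F" for f g
    using q that unfolding left_module_hom_def free_left_module_def ideal_as_left_module_def by auto
  have q_mult: "q (\<lambda>x. a \<otimes> f x) = a \<otimes> q f" if "a \<in> carrier R" "f \<in> ?F" for f a
    using q that unfolding left_module_hom_def free_left_module_def ideal_as_left_module_def by auto
  define e where "e = (\<lambda>(k::'a) (x::'a). if x = k then \<one> else \<zero>)"
  have e_mem: "e k \<in> ?F" if "k \<in> X" for k
    using that unfolding e_def by (auto intro: finite_subset[of _ "{k}"])
  define u where "u = (\<lambda>k. q (e k))"
  have u: "u k \<in> J" if "k \<in> X" for k using q_mem e_mem that unfolding u_def by simp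
  have qsum: "q f = (\<Oplus>k\<in>Y. f k \<otimes> u k)"
    if "finite Y" "Y \<subseteq> X" "f \<in> ?F" "\<And>x. x \<notin> Y \<Longrightarrow> f x = \<zero>" for f Y
    using that
  proof (induction Y arbitrary: f)
    case empty
    have "q (\<lambda>x. \<zero> \<otimes> f x) = \<zero> \<otimes> q f" using q_mult[of \<zero> f] empty by simp
    moreover have "(\<lambda>x. \<zero> \<otimes> f x) = f" using empty by auto
    ultimately have "q f = \<zero>" using q_mem[of f] empty Jm(1) by auto
    then show ?case by simp
  next
    case (insert k Y)
    let ?g = "f(k := \<zero>)"
    have fk: "f k \<in> carrier R" and kX: "k \<in> X" using insert by auto
    have sub: "{x. ?g x \<noteq> \<zero>} \<subseteq> {x. f x \<noteq> \<zero>}" by auto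
    then have "finite {x. ?g x \<noteq> \<zero>}" using insert.prems(2) finite_subset by blast
    then have g: "?g \<in> ?F" using insert.prems(2) by auto
    have "{x. f k \<otimes> e k x \<noteq> \<zero>} \<subseteq> {k}" using fk by (auto simp: e_def)
    then have "finite {x. f k \<otimes> e k x \<noteq> \<zero>}" by (rule finite_subset) simp
    then have fe: "(\<lambda>x. f k \<otimes> e k x) \<in> ?F" using fk kX by (auto simp: e_def)
    have "f = (\<lambda>x. f k \<otimes> e k x \<oplus> ?g x)"
    proof
      fix x
      have "f x \<in> carrier R" using insert.prems(2) by (cases "x \<in> X") auto
      then show "f x = f k \<otimes> e k x \<oplus> ?g x" using fk by (simp add: e_def)
    qed
    then have "q f = q (\<lambda>x. f k \<otimes> e k x \<oplus> ?g x)" by simp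
    also have "\<dots> = q (\<lambda>x. f k \<otimes> e k x) \<oplus> q ?g" using q_add[OF fe g] .
    also have "q (\<lambda>x. f k \<otimes> e k x) = f k \<otimes> u k" using q_mult[OF fk e_mem[OF kX]] by (simp add: u_def)
    also have "q ?g = (\<Oplus>j\<in>Y. ?g j \<otimes> u j)"
      by (rule insert.IH[OF _ g]) (use insert.prems in auto)
    also have "\<dots> = (\<Oplus>j\<in>Y. f j \<otimes> u j)"
      using insert.hyps insert.prems u Jm(1) by (intro finsum_cong') (auto simp: subset_iff Pi_iff)
    also have "f k \<otimes> u k \<oplus> \<dots> = (\<Oplus>j\<in>insert k Y. f j \<otimes> u j)"
    proof (rule finsum_insert[symmetric])
      show "(\<lambda>j. f j \<otimes> u j) \<in> Y \<rightarrow> carrier R"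
        using insert.prems u Jm(1) by (auto simp: subset_iff Pi_iff)
    qed (use insert.hyps fk u[OF kX] Jm(1) in auto)
    finally show ?case .
  qed
  \<comment> \<open>finitely many coordinates suffice: the elements supported on a finite subset of \<open>X\<close>
    form a left ideal, and some such left ideal has maximal length\<close>
  obtain length :: "'a set \<Rightarrow> nat" where
    length: "\<And>I K. left_ideal R I \<Longrightarrow> left_ideal R K \<Longrightarrow> I \<subset> K \<Longrightarrow> length I < length K"
    using len unfolding finite_left_length_def by blast
  define S where "S = (\<lambda>Y. {y \<in> J. \<forall>x. x \<notin> Y \<longrightarrow> i y x = \<zero>})"
  have i_zero: "i \<zero> x = \<zero>" for x
  proof -
    have c: "i \<zero> x \<in> carrier R"
      using i_mem[OF Jm(2)] by (cases "x \<in> X") auto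
    have "i \<zero> x = i (\<zero> \<otimes> \<zero>) x" by simp
    also have "\<dots> = \<zero> \<otimes> i \<zero> x" by (subst i_mult) (use Jm(2) in auto)
    finally show ?thesis using c by simp
  qed
  have S_left: "left_ideal R (S Y)" for Y
    by (rule left_idealI) (use Jm i_add i_mult i_zero in \<open>auto simp: S_def\<close>)
  let ?P = "\<lambda>Y. finite Y \<and> Y \<subseteq> X"
  have bound: "\<forall>Y. ?P Y \<longrightarrow> length (S Y) < Suc (length J)"
  proof (intro allI impI)
    fix Y
    have "S Y \<subseteq> J" by (auto simp: S_def)
    then show "length (S Y) < Suc (length J)"
      using length[OF S_left J] by (cases "S Y = J") (auto simp: less_Suc_eq)
  qed
  obtain Y where Y: "?P Y" "\<And>Z. ?P Z \<Longrightarrow> length (S Z) \<le> length (S Y)"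
    using ex_has_greatest_nat[of ?P "{}" "\<lambda>Y. length (S Y)" "Suc (length J)"] bound by auto
  have all: "y \<in> S Y" if y: "y \<in> J" for y
  proof -
    let ?Z = "Y \<union> {x. i y x \<noteq> \<zero>}"
    have "{x. i y x \<noteq> \<zero>} \<subseteq> X" using i_mem[OF y] by auto
    then have "?P ?Z" using i_mem[OF y] Y(1) by auto
    then have "length (S ?Z) \<le> length (S Y)" using Y(2) by blast
    moreover have "S Y \<subseteq> S ?Z" by (auto simp: S_def)
    ultimately have "S Y = S ?Z" using length[OF S_left S_left, of Y ?Z] by (metis not_le psubsetI)
    moreover have "y \<in> S ?Z" using y by (auto simp: S_def)
    ultimately show ?thesis by simp
  qed
  have "heredity_basis R J Y u (\<lambda>k y. i y k)"
  proof (intro heredity_basis.intro heredity_basis_axioms.intro)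
    show "ring R" by (rule ring_axioms)
    show "ideal J R" "ideal_prod R J J = J" "finite_left_length R"
      "ideal_prod R (ideal_prod R J (jacobson_radical R)) J = {\<zero>}"
      using heredity len unfolding heredity_ideal_def by auto
    show "finite Y" using Y by simp
    show "u k \<in> J" if "k \<in> Y" for k using that u Y by auto
    show "i y k \<in> carrier R" if "k \<in> Y" "y \<in> J" for k y using i_mem[OF that(2)] that Y by auto
    show "i (x \<oplus> y) k = i x k \<oplus> i y k" if "x \<in> J" "y \<in> J" for x y k using i_add that by simp
    show "i (a \<otimes> y) k = a \<otimes> i y k" if "a \<in> carrier R" "y \<in> J" for a y k using i_mult that by simp
    show "y = (\<Oplus>k\<in>Y. i y k \<otimes> u k)" if y: "y \<in> J" for y
      using qsum[of Y "i y"] qi[OF y] i_mem[OF y] Y(1) all[OF y] unfolding S_def by auto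
  qed
  then show ?thesis by (rule that)
qed

text \<open>The trace \<open>T a\<close> of right multiplication by \<open>a\<close> on \<open>J\<close> agrees with \<open>\<tau>\<close> on \<open>J\<close> and
  vanishes at nilpotent elements; so it is what has to be subtracted from \<open>\<tau>\<close> to pass to the quotient by \<open>J\<close>.\<close>

lemma heredity_trace:
  fixes \<tau> :: "'a \<Rightarrow> 'k::ab_group_add"
  assumes len: "finite_left_length R" and J: "heredity_ideal R J" and tau: "trace_functional R \<tau>"
  shows "\<exists>T :: 'a \<Rightarrow> 'k. trace_functional R T \<and> (\<forall>j\<in>J. T j = \<tau> j) \<and>
    (\<forall>x\<in>carrier R. \<forall>m::nat. x [^] m = \<zero> \<longrightarrow> T x = 0)"
proof -
  obtain X :: "'a set" and u \<phi> where "heredity_basis R J X u \<phi>"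
    using heredity_basis_exists[OF len J] .
  then interpret heredity_basis R J X u \<phi> .
  show ?thesis
    using hs_trace_functional[OF tau] hs_trace_on_ideal[OF tau] hs_trace_nilpotent_element[OF tau]
    by (intro exI[of _ "\<lambda>a. hs_trace \<tau> (\<lambda>y. y \<otimes> a)"]) blast
qed

end

context ideal
begin

lemma quot_carrier: "carrier (R Quot I) = (\<lambda>a. I +> a) ` carrier R"
  by (auto simp: FactRing_def A_RCOSETS_def')

lemma quot_ring: "ring (R Quot I)" by (rule quotient_is_ring)

lemma quot_mult: "a \<in> carrier R \<Longrightarrow> b \<in> carrier R \<Longrightarrow> (I +> a) \<otimes>\<^bsub>R Quot I\<^esub> (I +> b) = I +> (a \<otimes> b)"
  by (simp add: FactRing_def rcoset_mult_add)

lemma quot_add: "a \<in> carrier R \<Longrightarrow> b \<in> carrier R \<Longrightarrow> (I +> a) \<oplus>\<^bsub>R Quot I\<^esub> (I +> b) = I +> (a \<oplus> b)"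
  by (simp add: FactRing_def a_rcos_sum)

lemma quot_one: "\<one>\<^bsub>R Quot I\<^esub> = I +> \<one>"
  by (simp add: FactRing_def)

lemma quot_zero: "\<zero>\<^bsub>R Quot I\<^esub> = I +> \<zero>"
  by (simp add: FactRing_def a_coset_add_zero[OF a_subset])

lemma quot_eq_iff:
  assumes "a \<in> carrier R" "b \<in> carrier R"
  shows "I +> a = I +> b \<longleftrightarrow> a \<ominus> b \<in> I"
  using assms by (metis a_rcos_module_minus a_rcos_self a_repr_independence' ring_axioms)

lemma quot_pow: "a \<in> carrier R \<Longrightarrow> (I +> a) [^]\<^bsub>R Quot I\<^esub> (k::nat) = I +> (a [^] k)"
proof (induction k)
  case 0
  then show ?case
    using monoid.nat_pow_0[OF ring.is_monoid[OF quot_ring]] quot_one by simp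
next
  case (Suc k)
  then show ?case
    using monoid.nat_pow_Suc[OF ring.is_monoid[OF quot_ring]] quot_mult by simp
qed

lemma quot_preimage_left:
  assumes "left_ideal (R Quot I) K"
  shows "left_ideal R {a \<in> carrier R. I +> a \<in> K}"
proof -
  interpret Q: ring "R Quot I" by (rule quot_ring)
  note K = Q.left_ideal_mem[OF assms]
  show ?thesis
  proof (rule left_idealI)
    show "\<zero> \<in> {a \<in> carrier R. I +> a \<in> K}" using K(2) quot_zero by simp
    show "x \<oplus> y \<in> {a \<in> carrier R. I +> a \<in> K}"
      if "x \<in> {a \<in> carrier R. I +> a \<in> K}" "y \<in> {a \<in> carrier R. I +> a \<in> K}" for x y
      using that K(3)[of "I +> x" "I +> y"] quot_add by simp
    show "a \<otimes> x \<in> {a \<in> carrier R. I +> a \<in> K}"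
      if "a \<in> carrier R" "x \<in> {a \<in> carrier R. I +> a \<in> K}" for a x
      using that K(4)[of "I +> a" "I +> x"] quot_mult quot_carrier by simp
  qed auto
qed

lemma quot_finite_left_length:
  assumes "finite_left_length R"
  shows "finite_left_length (R Quot I)"
proof -
  interpret Q: ring "R Quot I" by (rule quot_ring)
  obtain length :: "'a set \<Rightarrow> nat" where
    length: "\<And>I K. left_ideal R I \<Longrightarrow> left_ideal R K \<Longrightarrow> I \<subset> K \<Longrightarrow> length I < length K"
    using assms unfolding finite_left_length_def by blast
  show ?thesis
    unfolding finite_left_length_def
  proof (intro exI allI impI)
    fix K L assume KL: "left_ideal (R Quot I) K" "left_ideal (R Quot I) L" "K \<subset> L"
    then obtain C where C: "C \<in> L" "C \<notin> K" by auto
    then obtain a where a: "a \<in> carrier R" "C = I +> a"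
      using Q.left_ideal_mem(1)[OF KL(2)] quot_carrier by auto
    have "{a \<in> carrier R. I +> a \<in> K} \<subset> {a \<in> carrier R. I +> a \<in> L}"
      using KL(3) a C by blast
    then show "length {a \<in> carrier R. I +> a \<in> K} < length {a \<in> carrier R. I +> a \<in> L}"
      using length quot_preimage_left KL by blast
  qed
qed

end

text \<open>Trace functionals cannot detect nilpotent elements of these rings, in the spirit of
  Lenzing's theorem on rings of finite global dimension. The functional \<open>\<tau>\<close> is assumed to vanish on one member of
  the chain. There it descends to the quotient, is replaced by its difference from the trace of
  \<open>heredity_trace\<close>, and the difference vanishes on the next member.\<close>

theorem (in ring) quasi_hereditary_trace_nilpotent:
  fixes \<tau> :: "'a \<Rightarrow> 'k::ab_group_add"
  assumes qh: "quasi_hereditary R" and len: "finite_left_length R"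
    and x: "x \<in> carrier R" "x [^] (N::nat) = \<zero>" and tau: "trace_functional R \<tau>"
  shows "\<tau> x = 0"
proof -
  obtain m :: nat and J where chain: "J 0 = {\<zero>} \<and> J m = carrier R \<and> (\<forall>i\<le>m. ideal (J i) R) \<and>
      (\<forall>i<m. J i \<subset> J (Suc i) \<and> heredity_ideal (R Quot (J i)) ((\<lambda>a. J i +> a) ` J (Suc i)))"
    using qh unfolding quasi_hereditary_def by (elim exE)
  have J: "J 0 = {\<zero>}" "J m = carrier R" "\<And>i. i \<le> m \<Longrightarrow> ideal (J i) R"
    "\<And>i. i < m \<Longrightarrow> heredity_ideal (R Quot (J i)) ((\<lambda>a. J i +> a) ` J (Suc i))"
    using chain by simp_all
  \<comment> \<open>the induction starts with the whole ring, \<open>k = 0\<close>,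
    and ends with the zero ideal, \<open>k = m\<close>, where the condition on \<open>\<tau>\<close> is void\<close>
  have main: "\<tau> x = 0"
    if "k \<le> m" "trace_functional R \<tau>" "\<And>j. j \<in> J (m - k) \<Longrightarrow> \<tau> j = 0" for k and \<tau> :: "'a \<Rightarrow> 'k"
    using that
  proof (induction k arbitrary: \<tau>)
    case 0
    then show ?case using J(2) x by simp
  next
    case (Suc k)
    define i where "i = m - Suc k"
    have i: "i < m" "Suc i = m - k" using Suc.prems by (auto simp: i_def)
    interpret I: ideal "J i" R using J(3) i by simp
    let ?Q = "R Quot (J i)"
    have t: "\<tau> (a \<oplus> b) = \<tau> a + \<tau> b" "\<tau> (a \<otimes> b) = \<tau> (b \<otimes> a)"
      if "a \<in> carrier R" "b \<in> carrier R" for a b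
      using Suc.prems(2) that unfolding trace_functional_def by auto
    have zero: "\<tau> j = 0" if "j \<in> J i" for j using Suc.prems(3) that by (simp add: i_def)
    \<comment> \<open>the functional on cosets induced by \<open>\<tau>\<close>, evaluated at an arbitrary representative\<close>
    define \<tau>' where "\<tau>' = (\<lambda>C. \<tau> (SOME a. a \<in> carrier R \<and> J i +> a = C))"
    have tau': "\<tau>' (J i +> a) = \<tau> a" if a: "a \<in> carrier R" for a
    proof -
      define b where "b = (SOME b. b \<in> carrier R \<and> J i +> b = J i +> a)"
      have b: "b \<in> carrier R \<and> J i +> b = J i +> a"
        unfolding b_def by (rule someI[of _ a]) (use a in simp)
      then have "b \<ominus> a \<in> J i" using I.quot_eq_iff[of b a] a by blast
      then have "\<tau> (b \<ominus> a) = 0" using zero by simp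
      moreover have "\<tau> b = \<tau> (b \<ominus> a) + \<tau> a" using t(1)[of "b \<ominus> a" a] minus_plus_cancel a b by simp
      ultimately show ?thesis by (simp add: \<tau>'_def b_def)
    qed
    have tr: "trace_functional ?Q \<tau>'"
      unfolding trace_functional_def I.quot_carrier
      using I.quot_add I.quot_mult tau' t by simp
    obtain T where "trace_functional ?Q T \<and> (\<forall>C\<in>(\<lambda>a. J i +> a) ` J (Suc i). T C = \<tau>' C) \<and>
      (\<forall>C\<in>carrier ?Q. \<forall>m::nat. C [^]\<^bsub>?Q\<^esub> m = \<zero>\<^bsub>?Q\<^esub> \<longrightarrow> T C = 0)"
      using ring.heredity_trace[OF I.quot_ring I.quot_finite_left_length[OF len] J(4)[OF i(1)] tr] by (elim exE)
    then have T: "trace_functional ?Q T"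
      "\<And>C. C \<in> (\<lambda>a. J i +> a) ` J (Suc i) \<Longrightarrow> T C = \<tau>' C"
      "\<And>C (m::nat). C \<in> carrier ?Q \<Longrightarrow> C [^]\<^bsub>?Q\<^esub> m = \<zero>\<^bsub>?Q\<^esub> \<Longrightarrow> T C = 0"
      by blast+
    define \<sigma> where "\<sigma> = (\<lambda>a. \<tau> a - T (J i +> a))"
    have Tt: "T (J i +> (a \<oplus> b)) = T (J i +> a) + T (J i +> b)"
      "T (J i +> (a \<otimes> b)) = T (J i +> (b \<otimes> a))" if "a \<in> carrier R" "b \<in> carrier R" for a b
      using T(1) that unfolding trace_functional_def I.quot_carrier
      by (auto simp: I.quot_add[symmetric] I.quot_mult[symmetric])
    have "trace_functional R \<sigma>"
      unfolding trace_functional_def \<sigma>_def using t Tt by simp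
    moreover have "\<sigma> j = 0" if "j \<in> J (m - k)" for j
    proof -
      have "j \<in> J (Suc i)" using that i by simp
      moreover from this have "j \<in> carrier R" using ideal.Icarr[OF J(3)[of "Suc i"]] i(1) by simp
      ultimately show ?thesis using T(2) tau' by (simp add: \<sigma>_def)
    qed
    ultimately have "\<sigma> x = 0" using Suc.IH Suc.prems(1) by simp
    moreover have "T (J i +> x) = 0"
      using T(3)[of "J i +> x" N] I.quot_pow I.quot_carrier I.quot_zero x by simp
    ultimately show ?case by (simp add: \<sigma>_def)
  qed
  have "\<tau> \<zero> = 0"
  proof -
    have "\<tau> (\<zero> \<oplus> \<zero>) = \<tau> \<zero> + \<tau> \<zero>" using tau unfolding trace_functional_def by blast
    then show ?thesis by simp
  qed
  then show ?thesis using main[of m \<tau>] tau J(1) by simp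
qed

section \<open>A criterion for heredity ideals\<close>

context ring
begin

text \<open>If \<open>r\<close> is in the radical then \<open>\<one> \<ominus> w \<otimes> a \<otimes> r\<close> has a left inverse, and this annihilates
  the idempotent \<open>a \<otimes> r \<otimes> w\<close>.\<close>

lemma radical_idempotent_zero:
  assumes len: "finite_left_length R" and r: "r \<in> jacobson_radical R"
    and a: "a \<in> carrier R" and w: "w \<in> carrier R"
    and idem: "a \<otimes> r \<otimes> w \<otimes> (a \<otimes> r \<otimes> w) = a \<otimes> r \<otimes> w"
  shows "a \<otimes> r \<otimes> w = \<zero>"
proof -
  have rc: "r \<in> carrier R" using r by (rule radical_carrier)
  define g where "g = w \<otimes> a \<otimes> r"
  have g: "g \<in> carrier R" using a w rc by (simp add: g_def)
  let ?L = "{x \<otimes> (\<one> \<ominus> g) | x. x \<in> carrier R}"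
  have L: "left_ideal R ?L"
  proof (rule left_idealI)
    show "?L \<subseteq> carrier R" using g by auto
    have "\<zero> = \<zero> \<otimes> (\<one> \<ominus> g)" using g by simp
    then show "\<zero> \<in> ?L" by blast
    show "x \<oplus> y \<in> ?L" if prem: "x \<in> ?L" "y \<in> ?L" for x y
    proof -
      obtain s t where "x = s \<otimes> (\<one> \<ominus> g)" "y = t \<otimes> (\<one> \<ominus> g)" "s \<in> carrier R" "t \<in> carrier R"
        using prem by blast
      moreover from this have "x \<oplus> y = (s \<oplus> t) \<otimes> (\<one> \<ominus> g)" using g by (simp add: l_distr)
      ultimately show ?thesis by blast
    qed
    show "b \<otimes> x \<in> ?L" if b: "b \<in> carrier R" "x \<in> ?L" for b x
    proof -
      obtain s where "x = s \<otimes> (\<one> \<ominus> g)" "s \<in> carrier R" using b by auto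
      moreover from this have "b \<otimes> x = (b \<otimes> s) \<otimes> (\<one> \<ominus> g)" using g b by (simp add: m_assoc)
      ultimately show ?thesis using b by blast
    qed
  qed
  have "\<one> \<in> ?L"
  proof (rule ccontr)
    assume "\<one> \<notin> ?L"
    then obtain M where M: "maximal_left_ideal R M" "?L \<subseteq> M"
      using maximal_left_ideal_exists[OF len L] by blast
    note Mm = left_ideal_mem[OF maximal_left_idealD(1)[OF M(1)]]
    have "g \<in> M" using Mm(4)[of "w \<otimes> a" r] radical_mem[OF r M(1)] a w by (simp add: g_def)
    moreover have "\<one> \<otimes> (\<one> \<ominus> g) \<in> M" using M(2) by blast
    ultimately have "(\<one> \<ominus> g) \<oplus> g \<in> M" using Mm(3) g by simp
    then show False using maximal_left_idealD(2)[OF M(1)] minus_plus_cancel g by simp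
  qed
  then obtain v where v: "v \<in> carrier R" "\<one> = v \<otimes> (\<one> \<ominus> g)" by auto
  let ?f = "a \<otimes> r \<otimes> w"
  have f: "?f \<in> carrier R" using a w rc by simp
  have wf: "w \<otimes> ?f = g \<otimes> w" using a w rc by (simp add: g_def m_assoc)
  have "g \<otimes> (g \<otimes> w) = w \<otimes> (?f \<otimes> ?f)" using a w rc by (simp add: g_def m_assoc)
  also have "\<dots> = g \<otimes> w" using idem wf by simp
  finally have gg: "g \<otimes> (g \<otimes> w) = g \<otimes> w" .
  have "g \<otimes> w = (v \<otimes> (\<one> \<ominus> g)) \<otimes> (g \<otimes> w)" using v(2)[symmetric] g w by simp
  also have "\<dots> = v \<otimes> (g \<otimes> w \<ominus> g \<otimes> (g \<otimes> w))"
    using v(1) g w by (simp add: m_assoc a_minus_def l_distr l_minus)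
  also have "\<dots> = \<zero>" using v(1) g w gg by (simp add: a_minus_def r_neg)
  finally have "w \<otimes> ?f = \<zero>" using wf by simp
  then have "?f \<otimes> ?f = a \<otimes> r \<otimes> \<zero>" using a w rc by (metis m_assoc m_closed)
  then show ?thesis using idem a rc by simp
qed

lemma projective_if_dual_basis:
  assumes J: "left_ideal R J" and X: "finite X" "X \<subseteq> J"
    and c: "\<And>x y. x \<in> X \<Longrightarrow> y \<in> J \<Longrightarrow> \<phi> x y \<in> carrier R"
    and add: "\<And>x y z. x \<in> X \<Longrightarrow> y \<in> J \<Longrightarrow> z \<in> J \<Longrightarrow> \<phi> x (y \<oplus> z) = \<phi> x y \<oplus> \<phi> x z"
    and mult: "\<And>x a y. x \<in> X \<Longrightarrow> a \<in> carrier R \<Longrightarrow> y \<in> J \<Longrightarrow> \<phi> x (a \<otimes> y) = a \<otimes> \<phi> x y"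
    and expand: "\<And>y. y \<in> J \<Longrightarrow> y = (\<Oplus>x\<in>X. \<phi> x y \<otimes> x)"
  shows "projective_left_module R (ideal_as_left_module R J)"
proof -
  note Jm = left_ideal_mem[OF J]
  have Xc: "x \<in> carrier R" if "x \<in> X" for x using that X Jm by auto
  let ?i = "\<lambda>y x. if x \<in> X then \<phi> x y else \<zero>"
  let ?q = "\<lambda>f. \<Oplus>x\<in>X. f x \<otimes> x"
  have "?i \<in> left_module_hom R (ideal_as_left_module R J) (free_left_module R X)"
    unfolding left_module_hom_def ideal_as_left_module_def free_left_module_def
    using c add mult X(1) by (auto simp: finite_subset[OF _ X(1)] intro!: finite_subset[OF _ X(1)])
  moreover have "?q \<in> left_module_hom R (free_left_module R X) (ideal_as_left_module R J)"
  proof -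
    have 1: "?q f \<in> J" if "f \<in> X \<rightarrow> carrier R" for f
      by (rule left_ideal_finsum[OF J]) (use that X Jm(4) in auto)
    have 2: "(\<Oplus>x\<in>X. (f x \<oplus> g x) \<otimes> x) = ?q f \<oplus> ?q g"
      if "f \<in> X \<rightarrow> carrier R" "g \<in> X \<rightarrow> carrier R" for f g
    proof -
      have "(\<Oplus>x\<in>X. (f x \<oplus> g x) \<otimes> x) = (\<Oplus>x\<in>X. f x \<otimes> x \<oplus> g x \<otimes> x)"
        using that Xc by (intro finsum_cong') (auto simp: l_distr Pi_iff)
      also have "\<dots> = ?q f \<oplus> ?q g" using that Xc by (intro finsum_addf) auto
      finally show ?thesis .
    qed
    have 3: "(\<Oplus>x\<in>X. a \<otimes> f x \<otimes> x) = a \<otimes> ?q f" if "f \<in> X \<rightarrow> carrier R" "a \<in> carrier R" for f a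
    proof -
      have "(\<Oplus>x\<in>X. a \<otimes> f x \<otimes> x) = (\<Oplus>x\<in>X. a \<otimes> (f x \<otimes> x))"
        using that Xc by (intro finsum_cong') (auto simp: m_assoc Pi_iff)
      also have "\<dots> = a \<otimes> ?q f" using that Xc X(1) by (intro finsum_rdistr[symmetric]) auto
      finally show ?thesis .
    qed
    show ?thesis
      unfolding left_module_hom_def ideal_as_left_module_def free_left_module_def
      using 1 2 3 by auto
  qed
  moreover have "?q (?i y) = y" if "y \<in> J" for y
  proof -
    have "?q (?i y) = (\<Oplus>x\<in>X. \<phi> x y \<otimes> x)" using Xc c that by (intro finsum_cong') auto
    then show ?thesis using expand[OF that] by simp
  qed
  ultimately show ?thesis
    unfolding projective_left_module_def ideal_as_left_module_def by (auto intro!: exI[of _ X])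
qed

text \<open>The elements \<open>x\<close> of \<open>X\<close> generate \<open>J\<close> on both sides and, with the functionals \<open>\<phi> x\<close>, form a dual
  basis, which gives projectivity; as the coordinates lie in \<open>J\<close>, it also gives \<open>J = J\<^sup>2\<close>. It remains to see that
  \<open>x \<otimes> r \<otimes> y\<close> vanishes for generators \<open>x\<close>, \<open>y\<close> and \<open>r\<close> in the radical; by the last hypothesis it factors
  through an idempotent of the form treated in \<open>radical_idempotent_zero\<close>.\<close>

lemma heredity_ideal_criterion:
  assumes len: "finite_left_length R" and J: "ideal J R" and X: "finite X" "X \<subseteq> J"
    and c: "\<And>x y. x \<in> X \<Longrightarrow> y \<in> J \<Longrightarrow> \<phi> x y \<in> J"
    and add: "\<And>x y z. x \<in> X \<Longrightarrow> y \<in> J \<Longrightarrow> z \<in> J \<Longrightarrow> \<phi> x (y \<oplus> z) = \<phi> x y \<oplus> \<phi> x z"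
    and mult: "\<And>x a y. x \<in> X \<Longrightarrow> a \<in> carrier R \<Longrightarrow> y \<in> J \<Longrightarrow> \<phi> x (a \<otimes> y) = a \<otimes> \<phi> x y"
    and expand: "\<And>y. y \<in> J \<Longrightarrow> y = (\<Oplus>x\<in>X. \<phi> x y \<otimes> x)"
    and expand_left: "\<And>y. y \<in> J \<Longrightarrow> \<exists>\<psi>. \<psi> \<in> X \<rightarrow> carrier R \<and> y = (\<Oplus>x\<in>X. x \<otimes> \<psi> x)"
    and sandwich: "\<And>x y r. x \<in> X \<Longrightarrow> y \<in> X \<Longrightarrow> r \<in> carrier R \<Longrightarrow>
      \<exists>a\<in>carrier R. \<exists>w\<in>carrier R. \<exists>z\<in>carrier R. \<exists>z'\<in>carrier R.
        a \<otimes> r \<otimes> w \<otimes> (a \<otimes> r \<otimes> w) = a \<otimes> r \<otimes> w \<and> x \<otimes> r \<otimes> y = z \<otimes> (a \<otimes> r \<otimes> w) \<otimes> z'"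
  shows "heredity_ideal R J"
proof -
  have left: "left_ideal R J"
    using J by (rule left_ideal_if_ideal)
  note Jm = left_ideal_mem[OF left]
  have Jc: "y \<in> carrier R" if "y \<in> J" for y using that Jm(1) by auto
  have Xc: "x \<in> carrier R" if "x \<in> X" for x using that X Jc by auto
  have cc: "\<phi> x y \<in> carrier R" if "x \<in> X" "y \<in> J" for x y using c[OF that] Jc by auto
  have JJ: "ideal_prod R J J = J"
  proof
    show "ideal_prod R J J \<subseteq> J" using ideal_prod_inter[OF J J] by auto
    show "J \<subseteq> ideal_prod R J J"
    proof
      fix y assume y: "y \<in> J"
      have "left_ideal R (ideal_prod R J J)"
        using ideal_prod_is_ideal[OF J J] by (rule left_ideal_if_ideal)
      then have "(\<Oplus>x\<in>X. \<phi> x y \<otimes> x) \<in> ideal_prod R J J"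
        by (rule left_ideal_finsum) (use c y X in \<open>auto intro!: ideal_prod.prod\<close>)
      then show "y \<in> ideal_prod R J J" using expand[OF y] by simp
    qed
  qed
  have xry: "x \<otimes> r \<otimes> y = \<zero>" if prem: "x \<in> X" "y \<in> X" "r \<in> jacobson_radical R" for x y r
  proof -
    obtain a w z z' where 1: "a \<in> carrier R" "w \<in> carrier R" "z \<in> carrier R" "z' \<in> carrier R"
      "a \<otimes> r \<otimes> w \<otimes> (a \<otimes> r \<otimes> w) = a \<otimes> r \<otimes> w" "x \<otimes> r \<otimes> y = z \<otimes> (a \<otimes> r \<otimes> w) \<otimes> z'"
      using sandwich[OF prem(1,2) radical_carrier[OF prem(3)]] by blast
    then show ?thesis using radical_idempotent_zero[OF len prem(3) 1(1,2,5)] by simp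
  qed
  have xrj: "x \<otimes> r \<otimes> j = \<zero>" if prem: "x \<in> X" "j \<in> J" "r \<in> jacobson_radical R" for x j r
  proof -
    obtain \<psi> where psi: "\<psi> \<in> X \<rightarrow> carrier R" "j = (\<Oplus>x\<in>X. x \<otimes> \<psi> x)"
      using expand_left[OF prem(2)] by blast
    have rc: "r \<in> carrier R" using radical_carrier[OF prem(3)] .
    have xr: "x \<otimes> r \<in> carrier R" using Xc prem rc by simp
    have "x \<otimes> r \<otimes> j = (\<Oplus>y\<in>X. x \<otimes> r \<otimes> (y \<otimes> \<psi> y))"
      unfolding psi(2) using X(1) xr Xc psi(1) by (intro finsum_rdistr) auto
    also have "\<dots> = (\<Oplus>y\<in>X. \<zero>)"
    proof (rule finsum_cong')
      fix y assume y: "y \<in> X"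
      have p: "\<psi> y \<in> carrier R" using psi(1) y by auto
      have "x \<otimes> r \<otimes> (y \<otimes> \<psi> y) = x \<otimes> r \<otimes> y \<otimes> \<psi> y"
        using m_assoc[OF xr Xc[OF y] p] by simp
      then show "x \<otimes> r \<otimes> (y \<otimes> \<psi> y) = \<zero>" using xry[OF prem(1) y prem(3)] p by simp
    qed auto
    finally show ?thesis by simp
  qed
  have irj: "i \<otimes> r \<otimes> j = \<zero>" if "i \<in> J" "j \<in> J" "r \<in> jacobson_radical R" for i j r
  proof -
    have rc: "r \<in> carrier R" using radical_carrier[OF that(3)] .
    have rj: "r \<otimes> j \<in> carrier R" using rc Jc that by simp
    have "i \<otimes> r \<otimes> j = i \<otimes> (r \<otimes> j)" using Jc that rc by (simp add: m_assoc)
    also have "\<dots> = (\<Oplus>x\<in>X. \<phi> x i \<otimes> x) \<otimes> (r \<otimes> j)" using expand[OF that(1)] by simp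
    also have "\<dots> = (\<Oplus>x\<in>X. \<phi> x i \<otimes> x \<otimes> (r \<otimes> j))"
      using X(1) rj Xc cc that by (intro finsum_ldistr) auto
    also have "\<dots> = (\<Oplus>x\<in>X. \<zero>)"
    proof (rule finsum_cong')
      fix x assume x: "x \<in> X"
      have "\<phi> x i \<otimes> x \<otimes> (r \<otimes> j) = \<phi> x i \<otimes> (x \<otimes> r \<otimes> j)"
        using Xc[OF x] cc[OF x that(1)] rc Jc that by (simp add: m_assoc)
      then show "\<phi> x i \<otimes> x \<otimes> (r \<otimes> j) = \<zero>"
        using xrj[OF x that(2,3)] cc[OF x that(1)] by simp
    qed auto
    finally show ?thesis by simp
  qed
  have rad: "s \<otimes> j = \<zero> \<and> s \<in> carrier R" if "s \<in> ideal_prod R J (jacobson_radical R)" "j \<in> J" for s j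
    using that
  proof (induction rule: ideal_prod.induct)
    case (prod i r)
    then show ?case using irj Jc radical_carrier by simp
  next
    case (sum s t)
    then show ?case using Jc by (simp add: l_distr)
  qed
  have zr: "\<zero> \<in> jacobson_radical R"
    unfolding jacobson_radical_def using maximal_left_idealD(1) left_ideal_mem(2) by auto
  have sub: "t = \<zero>" if "t \<in> ideal_prod R (ideal_prod R J (jacobson_radical R)) J" for t
    using that
  proof (induction rule: ideal_prod.induct)
    case (prod s j)
    then show ?case using rad by blast
  qed simp
  have zero3: "\<zero> \<otimes> \<zero> \<otimes> \<zero> = \<zero>" by simp
  have mem: "\<zero> \<in> ideal_prod R (ideal_prod R J (jacobson_radical R)) J"
    using ideal_prod.prod[where R = R, OF ideal_prod.prod[where R = R, OF Jm(2) zr] Jm(2)]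
    unfolding zero3 .
  have JradJ: "ideal_prod R (ideal_prod R J (jacobson_radical R)) J = {\<zero>}"
  proof (rule equalityI; rule subsetI)
    show "t \<in> {\<zero>}" if "t \<in> ideal_prod R (ideal_prod R J (jacobson_radical R)) J" for t
      using sub[OF that] by (rule ssubst) (rule singletonI)
    show "t \<in> ideal_prod R (ideal_prod R J (jacobson_radical R)) J" if "t \<in> {\<zero>}" for t
      using mem by (rule ssubst[OF singletonD[OF that]])
  qed
  have "projective_left_module R (ideal_as_left_module R J)"
    by (rule projective_if_dual_basis[OF left X cc add mult expand])
  then show ?thesis unfolding heredity_ideal_def using J JJ JradJ by simp
qed

end

context ideal
begin

lemma quot_finsum:
  assumes "finite Y" "f \<in> Y \<rightarrow> carrier R"
  shows "I +> (\<Oplus>k\<in>Y. f k) = (\<Oplus>\<^bsub>R Quot I\<^esub>k\<in>Y. I +> f k)"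
  using assms
proof (induction Y)
  case empty
  interpret Q: ring "R Quot I" by (rule quot_ring)
  show ?case using quot_zero by simp
next
  case (insert k Y)
  interpret Q: ring "R Quot I" by (rule quot_ring)
  have c: "f \<in> Y \<rightarrow> carrier R" "f k \<in> carrier R" using insert.prems by auto
  have "(\<Oplus>\<^bsub>R Quot I\<^esub>k\<in>insert k Y. I +> f k) = (I +> f k) \<oplus>\<^bsub>R Quot I\<^esub> (\<Oplus>\<^bsub>R Quot I\<^esub>k\<in>Y. I +> f k)"
    using insert c by (intro Q.finsum_insert) (auto simp: quot_carrier)
  also have "\<dots> = I +> (f k \<oplus> (\<Oplus>k\<in>Y. f k))"
    using insert.IH[OF c(1), symmetric] c quot_add[OF c(2) finsum_closed[OF c(1)]] by simp
  also have "\<dots> = I +> (\<Oplus>k\<in>insert k Y. f k)" using insert c by simp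
  finally show ?case by simp
qed

text \<open>The criterion for a quotient ring, with all conditions stated for representatives and modulo \<open>I\<close>. The
  family \<open>e\<close> must be injective modulo \<open>I\<close> because the criterion is about a set of generators, so that each coset
  has to determine its index.\<close>

lemma heredity_ideal_quotient:
  assumes len: "finite_left_length R" and J: "ideal J R" and B: "finite B"
    and e: "\<And>b. b \<in> B \<Longrightarrow> e b \<in> J" and inj: "inj_on (\<lambda>b. I +> e b) B"
    and \<phi>: "\<And>b y. b \<in> B \<Longrightarrow> y \<in> J \<Longrightarrow> \<phi> b y \<in> J"
    and \<phi>_I: "\<And>b x y. b \<in> B \<Longrightarrow> x \<in> J \<Longrightarrow> y \<in> J \<Longrightarrow> x \<ominus> y \<in> I \<Longrightarrow> \<phi> b x \<ominus> \<phi> b y \<in> I"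
    and add: "\<And>b x y. b \<in> B \<Longrightarrow> x \<in> J \<Longrightarrow> y \<in> J \<Longrightarrow> \<phi> b (x \<oplus> y) = \<phi> b x \<oplus> \<phi> b y"
    and mult: "\<And>b a y. b \<in> B \<Longrightarrow> a \<in> carrier R \<Longrightarrow> y \<in> J \<Longrightarrow> \<phi> b (a \<otimes> y) \<ominus> a \<otimes> \<phi> b y \<in> I"
    and expand: "\<And>y. y \<in> J \<Longrightarrow> y \<ominus> (\<Oplus>b\<in>B. \<phi> b y \<otimes> e b) \<in> I"
    and expand_left: "\<And>y. y \<in> J \<Longrightarrow> \<exists>\<psi>. \<psi> \<in> B \<rightarrow> carrier R \<and> y \<ominus> (\<Oplus>b\<in>B. e b \<otimes> \<psi> b) \<in> I"
    and sandwich: "\<And>b c r. b \<in> B \<Longrightarrow> c \<in> B \<Longrightarrow> r \<in> carrier R \<Longrightarrow>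
      \<exists>a\<in>carrier R. \<exists>w\<in>carrier R. \<exists>z\<in>carrier R. \<exists>z'\<in>carrier R.
        a \<otimes> r \<otimes> w \<otimes> (a \<otimes> r \<otimes> w) \<ominus> a \<otimes> r \<otimes> w \<in> I \<and>
        e b \<otimes> r \<otimes> e c \<ominus> z \<otimes> (a \<otimes> r \<otimes> w) \<otimes> z' \<in> I"
  shows "heredity_ideal (R Quot I) ((\<lambda>a. I +> a) ` J)"
proof -
  interpret Q: ring "R Quot I" by (rule quot_ring)
  let ?Q = "R Quot I"
  let ?X = "(\<lambda>b. I +> e b) ` B"
  have Jc: "y \<in> carrier R" if "y \<in> J" for y using ideal.Icarr[OF J that] .
  have Jadd: "x \<oplus> y \<in> J" if "x \<in> J" "y \<in> J" for x y
    using additive_subgroup.a_closed[OF ideal.axioms(1)[OF J] that] .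
  have Jmult: "a \<otimes> y \<in> J" if "a \<in> carrier R" "y \<in> J" for a y
    using ideal.I_l_closed[OF J that(2,1)] .
  have \<phi>c: "\<phi> b y \<in> carrier R" if "b \<in> B" "y \<in> J" for b y using Jc \<phi> that by blast
  have ec: "e b \<in> carrier R" if "b \<in> B" for b using Jc e that by blast
  have eq: "I +> a = I +> b" if "a \<ominus> b \<in> I" "a \<in> carrier R" "b \<in> carrier R" for a b
    using quot_eq_iff that by blast
  define idx where "idx = the_inv_into B (\<lambda>b. I +> e b)"
  have idx: "idx (I +> e b) = b" if "b \<in> B" for b
    unfolding idx_def using the_inv_into_f_f[OF inj that] .
  define rep where "rep = (\<lambda>C. SOME y. y \<in> J \<and> I +> y = C)"
  have rep: "rep (I +> y) \<in> J \<and> I +> rep (I +> y) = I +> y" if "y \<in> J" for y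
    unfolding rep_def by (rule someI[of _ y]) (use that in simp)
  define \<Phi> where "\<Phi> = (\<lambda>x C. I +> \<phi> (idx x) (rep C))"
  have \<Phi>: "\<Phi> (I +> e b) (I +> y) = I +> \<phi> b y" if b: "b \<in> B" and y: "y \<in> J" for b y
  proof -
    have "rep (I +> y) \<ominus> y \<in> I" using rep[OF y] quot_eq_iff Jc y by blast
    then have "\<phi> b (rep (I +> y)) \<ominus> \<phi> b y \<in> I" using \<phi>_I b y rep[OF y] by blast
    then show ?thesis unfolding \<Phi>_def idx[OF b] using eq \<phi>c b y rep[OF y] by blast
  qed
  show ?thesis
  proof (rule Q.heredity_ideal_criterion[where X = ?X and \<phi> = \<Phi>])
    show "finite_left_length ?Q" by (rule quot_finite_left_length[OF len])
    show "ideal ((+>) I ` J) ?Q"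
    proof (rule idealI)
      show "ring ?Q" by (rule quot_ring)
      have "additive_subgroup ((+>) I ` J) ?Q"
      proof -
        have "left_ideal ?Q ((+>) I ` J)"
        proof (rule Q.left_idealI)
          show "(+>) I ` J \<subseteq> carrier ?Q" using Jc by (auto simp: quot_carrier)
          show "\<zero>\<^bsub>?Q\<^esub> \<in> (+>) I ` J"
            using additive_subgroup.zero_closed[OF ideal.axioms(1)[OF J]] quot_zero by auto
          show "x \<oplus>\<^bsub>?Q\<^esub> y \<in> (+>) I ` J" if "x \<in> (+>) I ` J" "y \<in> (+>) I ` J" for x y
            using that quot_add Jc Jadd by auto
          show "a \<otimes>\<^bsub>?Q\<^esub> y \<in> (+>) I ` J" if "a \<in> carrier ?Q" "y \<in> (+>) I ` J" for a y
            using that quot_mult Jc Jmult by (auto simp: quot_carrier)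
        qed
        then show ?thesis unfolding left_ideal_def by simp
      qed
      then show "subgroup ((+>) I ` J) (add_monoid ?Q)" by (rule additive_subgroup.a_subgroup)
      show "x \<otimes>\<^bsub>?Q\<^esub> a \<in> (+>) I ` J" if "a \<in> (+>) I ` J" "x \<in> carrier ?Q" for a x
        using that quot_mult Jc Jmult by (auto simp: quot_carrier)
      show "a \<otimes>\<^bsub>?Q\<^esub> x \<in> (+>) I ` J" if "a \<in> (+>) I ` J" "x \<in> carrier ?Q" for a x
        using that quot_mult Jc ideal.I_r_closed[OF J] by (auto simp: quot_carrier)
    qed
    show "finite ?X" using B by simp
    show "?X \<subseteq> (+>) I ` J" using e by auto
    show "\<Phi> x y \<in> (+>) I ` J" if "x \<in> ?X" "y \<in> (+>) I ` J" for x y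
      using that \<Phi> \<phi> by auto
    show "\<Phi> x (y \<oplus>\<^bsub>?Q\<^esub> z) = \<Phi> x y \<oplus>\<^bsub>?Q\<^esub> \<Phi> x z"
      if "x \<in> ?X" "y \<in> (+>) I ` J" "z \<in> (+>) I ` J" for x y z
      using that \<Phi> \<phi>c Jc Jadd add by (auto simp: quot_add)
    show "\<Phi> x (a \<otimes>\<^bsub>?Q\<^esub> y) = a \<otimes>\<^bsub>?Q\<^esub> \<Phi> x y"
      if prem: "x \<in> ?X" "a \<in> carrier ?Q" "y \<in> (+>) I ` J" for x a y
    proof -
      obtain b r s where 1: "x = I +> e b" "b \<in> B" "a = I +> r" "r \<in> carrier R" "y = I +> s" "s \<in> J"
        using prem unfolding quot_carrier by blast
      have "\<phi> b (r \<otimes> s) \<ominus> r \<otimes> \<phi> b s \<in> I" using mult 1 by blast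
      then have "I +> \<phi> b (r \<otimes> s) = I +> (r \<otimes> \<phi> b s)" using eq 1 \<phi>c Jmult by simp
      then show ?thesis using 1 \<Phi> \<phi>c Jmult Jc by (simp add: quot_mult)
    qed
    show "y = (\<Oplus>\<^bsub>?Q\<^esub>x\<in>?X. \<Phi> x y \<otimes>\<^bsub>?Q\<^esub> x)" if prem: "y \<in> (+>) I ` J" for y
    proof -
      obtain s where s: "s \<in> J" "y = I +> s" using prem by auto
      have "(\<Oplus>\<^bsub>?Q\<^esub>x\<in>?X. \<Phi> x y \<otimes>\<^bsub>?Q\<^esub> x) = (\<Oplus>\<^bsub>?Q\<^esub>b\<in>B. \<Phi> (I +> e b) y \<otimes>\<^bsub>?Q\<^esub> (I +> e b))"
        using inj s \<Phi> \<phi>c ec by (intro Q.finsum_reindex) (auto simp: quot_carrier quot_mult)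
      also have "\<dots> = (\<Oplus>\<^bsub>?Q\<^esub>b\<in>B. I +> \<phi> b s \<otimes> e b)"
        using s \<Phi> \<phi>c ec by (intro Q.finsum_cong') (auto simp: quot_carrier quot_mult)
      also have "\<dots> = I +> (\<Oplus>b\<in>B. \<phi> b s \<otimes> e b)"
        using quot_finsum[OF B, of "\<lambda>b. \<phi> b s \<otimes> e b"] \<phi>c ec s by simp
      also have "\<dots> = I +> s"
        using eq[OF expand[OF s(1)]] s Jc \<phi>c ec by simp
      finally show ?thesis using s by simp
    qed
    show "\<exists>\<psi>. \<psi> \<in> ?X \<rightarrow> carrier ?Q \<and> y = (\<Oplus>\<^bsub>?Q\<^esub>x\<in>?X. x \<otimes>\<^bsub>?Q\<^esub> \<psi> x)" if prem: "y \<in> (+>) I ` J" for y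
    proof -
      obtain s where s: "s \<in> J" "y = I +> s" using prem by auto
      obtain \<psi> where psi: "\<psi> \<in> B \<rightarrow> carrier R" "s \<ominus> (\<Oplus>b\<in>B. e b \<otimes> \<psi> b) \<in> I"
        using expand_left[OF s(1)] by blast
      let ?p = "\<lambda>x. I +> \<psi> (idx x)"
      have "(\<Oplus>\<^bsub>?Q\<^esub>x\<in>?X. x \<otimes>\<^bsub>?Q\<^esub> ?p x) = (\<Oplus>\<^bsub>?Q\<^esub>b\<in>B. (I +> e b) \<otimes>\<^bsub>?Q\<^esub> ?p (I +> e b))"
        using inj psi ec idx by (intro Q.finsum_reindex) (auto simp: quot_carrier quot_mult Pi_iff)
      also have "\<dots> = (\<Oplus>\<^bsub>?Q\<^esub>b\<in>B. I +> e b \<otimes> \<psi> b)"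
        using psi ec idx by (intro Q.finsum_cong') (auto simp: quot_carrier quot_mult Pi_iff)
      also have "\<dots> = I +> (\<Oplus>b\<in>B. e b \<otimes> \<psi> b)"
        using quot_finsum[OF B, of "\<lambda>b. e b \<otimes> \<psi> b"] psi ec by (simp add: Pi_iff)
      also have "\<dots> = I +> s"
        using eq[OF psi(2)] s Jc psi ec by (simp add: Pi_iff)
      finally have "y = (\<Oplus>\<^bsub>?Q\<^esub>x\<in>?X. x \<otimes>\<^bsub>?Q\<^esub> ?p x)" using s by simp
      moreover have "?p \<in> ?X \<rightarrow> carrier ?Q" using psi idx by (auto simp: quot_carrier Pi_iff)
      ultimately show ?thesis by blast
    qed
    show "\<exists>a\<in>carrier ?Q. \<exists>w\<in>carrier ?Q. \<exists>z\<in>carrier ?Q. \<exists>z'\<in>carrier ?Q.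
        a \<otimes>\<^bsub>?Q\<^esub> r \<otimes>\<^bsub>?Q\<^esub> w \<otimes>\<^bsub>?Q\<^esub> (a \<otimes>\<^bsub>?Q\<^esub> r \<otimes>\<^bsub>?Q\<^esub> w) = a \<otimes>\<^bsub>?Q\<^esub> r \<otimes>\<^bsub>?Q\<^esub> w \<and>
        x \<otimes>\<^bsub>?Q\<^esub> r \<otimes>\<^bsub>?Q\<^esub> y = z \<otimes>\<^bsub>?Q\<^esub> (a \<otimes>\<^bsub>?Q\<^esub> r \<otimes>\<^bsub>?Q\<^esub> w) \<otimes>\<^bsub>?Q\<^esub> z'"
      if prem: "x \<in> ?X" "y \<in> ?X" "r \<in> carrier ?Q" for x y r
    proof -
      obtain b c s where 1: "x = I +> e b" "b \<in> B" "y = I +> e c" "c \<in> B" "r = I +> s" "s \<in> carrier R"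
        using prem unfolding quot_carrier by blast
      obtain a w z z' where 2: "a \<in> carrier R" "w \<in> carrier R" "z \<in> carrier R" "z' \<in> carrier R"
        "a \<otimes> s \<otimes> w \<otimes> (a \<otimes> s \<otimes> w) \<ominus> a \<otimes> s \<otimes> w \<in> I"
        "e b \<otimes> s \<otimes> e c \<ominus> z \<otimes> (a \<otimes> s \<otimes> w) \<otimes> z' \<in> I"
        using sandwich[OF 1(2,4,6)] by blast
      have "I +> (a \<otimes> s \<otimes> w \<otimes> (a \<otimes> s \<otimes> w)) = I +> (a \<otimes> s \<otimes> w)"
        "I +> (e b \<otimes> s \<otimes> e c) = I +> (z \<otimes> (a \<otimes> s \<otimes> w) \<otimes> z')"
        using eq 1 2 ec by simp_all
      then show ?thesis
        using 1 2 ec by (intro bexI[of _ "I +> a"] bexI[of _ "I +> w"] bexI[of _ "I +> z"] bexI[of _ "I +> z'"])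
          (auto simp: quot_mult quot_carrier)
    qed
  qed
qed

end

section \<open>Maschke's theorem\<close>

definition scale_fun :: "'k::field \<Rightarrow> ('a \<Rightarrow> 'k) \<Rightarrow> 'a \<Rightarrow> 'k" where
  "scale_fun c f = (\<lambda>x. c * f x)"

lemma scale_fun_apply [simp]: "scale_fun c f x = c * f x"
  by (simp add: scale_fun_def)

interpretation fun_space: vector_space scale_fun
  by unfold_locales (auto simp: scale_fun_def algebra_simps)

lemma sum_fun_apply: "(\<Sum>i\<in>A. F i) x = (\<Sum>i\<in>A. F i x)" for F :: "'i \<Rightarrow> 'a \<Rightarrow> 'k::comm_monoid_add"
  by (induction A rule: infinite_finite_induct) auto

definition convolution ::
  "('g, 'm) monoid_scheme \<Rightarrow> ('g \<Rightarrow> 'k::field) \<Rightarrow> ('g \<Rightarrow> 'k) \<Rightarrow> 'g \<Rightarrow> 'k" where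
  "convolution G f h = (\<lambda>x. if x \<in> carrier G
     then \<Sum>y\<in>carrier G. f y * h (inv\<^bsub>G\<^esub> y \<otimes>\<^bsub>G\<^esub> x) else 0)"

lemma subspace_projection:
  fixes V :: "('a \<Rightarrow> 'k::field) set"
  assumes "fun_space.subspace V"
  obtains p where "\<And>f. p f \<in> V" "\<And>f. f \<in> V \<Longrightarrow> p f = f"
    "\<And>f g. p (f + g) = p f + p g" "\<And>c f. p (scale_fun c f) = scale_fun c (p f)"
proof -
  interpret vector_space_pair "scale_fun :: 'k \<Rightarrow> ('a \<Rightarrow> 'k) \<Rightarrow> _" "scale_fun :: 'k \<Rightarrow> ('a \<Rightarrow> 'k) \<Rightarrow> _"
    by unfold_locales
  obtain p where p: "p ` UNIV \<subseteq> V" "Vector_Spaces.linear scale_fun scale_fun p" "\<forall>v\<in>V. p (id v) = v"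
    using linear_exists_left_inverse_on[OF fun_space.linear_id assms] by auto
  interpret p: Vector_Spaces.linear scale_fun scale_fun p by (rule p(2))
  show ?thesis
    by (rule that[of p]) (use p p.add p.scale in auto)
qed

context group
begin

text \<open>Maschke's theorem, in the form that the group algebra is von Neumann regular. A linear
  projection onto the left ideal generated by \<open>r\<close>, averaged over the group, is right multiplication
  by an element \<open>f\<close> of this ideal, and \<open>r = r f\<close>.\<close>

theorem group_algebra_regular:
  fixes r :: "'a \<Rightarrow> 'k::field"
  assumes fin: "finite (carrier G)" and card: "of_nat (card (carrier G)) \<noteq> (0 :: 'k)"
    and r: "\<And>x. x \<notin> carrier G \<Longrightarrow> r x = 0"
  obtains s where "convolution G r (convolution G s r) = r"
proof -
  let ?C = "carrier G"
  \<comment> \<open>the action of the group by left translation\<close>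
  define L :: "'a \<Rightarrow> ('a \<Rightarrow> 'k) \<Rightarrow> 'a \<Rightarrow> 'k" where
    "L = (\<lambda>g h x. if x \<in> ?C then h (inv g \<otimes> x) else 0)"
  have L_add: "L g (f + h) = L g f + L g h" for g f h by (auto simp: L_def)
  have L_scale: "L g (scale_fun c f) = scale_fun c (L g f)" for g c f by (auto simp: L_def)
  have L_sum: "L g (\<Sum>i\<in>A. F i) = (\<Sum>i\<in>A. L g (F i))" for g A and F :: "'a \<Rightarrow> 'a \<Rightarrow> 'k"
    by (auto simp: L_def sum_fun_apply)
  have L_L: "L g (L h f) = L (g \<otimes> h) f" if "g \<in> ?C" "h \<in> ?C" for g h f
    using that by (auto simp: L_def inv_mult_group m_assoc)
  have L_inv: "L g (L (inv g) f) = f" if "g \<in> ?C" "\<And>x. x \<notin> ?C \<Longrightarrow> f x = 0" for g f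
    using that by (auto simp: L_def m_assoc[symmetric])
  have bij: "bij_betw (\<lambda>h. g \<otimes> h) ?C ?C" if "g \<in> ?C" for g
    by (rule bij_betw_byWitness[of _ "\<lambda>h. inv g \<otimes> h"]) (use that in \<open>auto simp: m_assoc[symmetric]\<close>)
  define \<delta> :: "'a \<Rightarrow> 'k" where "\<delta> = (\<lambda>x. if x = \<one> then 1 else 0)"
  define V where "V = range (\<lambda>a. convolution G a r)"
  have L_conv: "L g (convolution G a r) = convolution G (L g a) r" if g: "g \<in> ?C" for g a
  proof
    fix x
    show "L g (convolution G a r) x = convolution G (L g a) r x"
    proof (cases "x \<in> ?C")
      case x: True
      have "convolution G (L g a) r x = (\<Sum>y\<in>?C. a (inv g \<otimes> y) * r (inv y \<otimes> x))"
        using x by (auto simp: convolution_def L_def intro: sum.cong)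
      also have "\<dots> = (\<Sum>y\<in>?C. a (inv g \<otimes> (g \<otimes> y)) * r (inv (g \<otimes> y) \<otimes> x))"
        by (rule sum.reindex_bij_betw[OF bij[OF g], symmetric])
      also have "\<dots> = (\<Sum>y\<in>?C. a y * r (inv y \<otimes> (inv g \<otimes> x)))"
        using g x by (intro sum.cong) (auto simp: m_assoc[symmetric] inv_mult_group)
      also have "\<dots> = L g (convolution G a r) x"
        using g x by (simp add: convolution_def L_def)
      finally show ?thesis by simp
    qed (auto simp: convolution_def L_def)
  qed
  have sub: "fun_space.subspace V"
    unfolding fun_space.subspace_def
  proof (intro conjI ballI allI)
    have "convolution G 0 r = 0" by (auto simp: convolution_def)
    then show "0 \<in> V" unfolding V_def by (metis rangeI)
    show "f + h \<in> V" if "f \<in> V" "h \<in> V" for f h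
    proof -
      obtain a b where "f = convolution G a r" "h = convolution G b r" using \<open>f \<in> V\<close> \<open>h \<in> V\<close> by (auto simp: V_def)
      then have "f + h = convolution G (a + b) r"
        by (auto simp: convolution_def sum.distrib[symmetric] distrib_right)
      then show ?thesis by (auto simp: V_def)
    qed
    show "scale_fun c f \<in> V" if "f \<in> V" for c f
    proof -
      obtain a where "f = convolution G a r" using \<open>f \<in> V\<close> by (auto simp: V_def)
      then have "scale_fun c f = convolution G (scale_fun c a) r"
        by (auto simp: convolution_def sum_distrib_left mult.assoc)
      then show ?thesis by (auto simp: V_def)
    qed
  qed
  have V_L: "L g f \<in> V" if "g \<in> ?C" "f \<in> V" for g f
    using that L_conv by (auto simp: V_def)
  have V_out: "f x = 0" if "f \<in> V" "x \<notin> ?C" for f x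
    using that by (auto simp: V_def convolution_def)
  have expand: "h = (\<Sum>g\<in>?C. scale_fun (h g) (L g \<delta>))" if h: "\<And>x. x \<notin> ?C \<Longrightarrow> h x = 0" for h
  proof
    fix x
    show "h x = (\<Sum>g\<in>?C. scale_fun (h g) (L g \<delta>)) x"
    proof (cases "x \<in> ?C")
      case x: True
      have "(\<Sum>g\<in>?C. scale_fun (h g) (L g \<delta>)) x = (\<Sum>g\<in>?C. if g = x then h g else 0)"
        unfolding sum_fun_apply
      proof (rule sum.cong[OF refl])
        fix g assume g: "g \<in> ?C"
        have "inv g \<otimes> x = \<one> \<longleftrightarrow> g = x"
          using g x by (metis inv_closed inv_equality inv_inv l_inv)
        then show "scale_fun (h g) (L g \<delta>) x = (if g = x then h g else 0)"
          using x by (auto simp: L_def \<delta>_def)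
      qed
      then show ?thesis using x fin by simp
    qed (auto simp: h sum_fun_apply L_def)
  qed
  have conv_eq: "convolution G a f = (\<Sum>g\<in>?C. scale_fun (a g) (L g f))" for a f
    by (auto simp: convolution_def sum_fun_apply L_def)
  have rV: "r \<in> V"
  proof -
    have "convolution G \<delta> r = r"
    proof
      fix x
      show "convolution G \<delta> r x = r x"
      proof (cases "x \<in> ?C")
        case x: True
        have "convolution G \<delta> r x = (\<Sum>y\<in>?C. if y = \<one> then r (inv y \<otimes> x) else 0)"
          using x by (auto simp: convolution_def \<delta>_def intro!: sum.cong)
        then show ?thesis using x fin by simp
      qed (auto simp: convolution_def r)
    qed
    then show ?thesis unfolding V_def by (metis rangeI)
  qed
  obtain p where p: "\<And>f. p f \<in> V" "\<And>f. f \<in> V \<Longrightarrow> p f = f" "\<And>f g. p (f + g) = p f + p g"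
    "\<And>c f. p (scale_fun c f) = scale_fun c (p f)"
    using subspace_projection[OF sub] by metis
  define c where "c = inverse (of_nat (card ?C) :: 'k)"
  \<comment> \<open>average of the conjugates of \<open>p\<close>: still a projection onto \<open>V\<close>, and equivariant\<close>
  define P where "P = (\<lambda>h. scale_fun c (\<Sum>g\<in>?C. L g (p (L (inv g) h))))"
  have P_add: "P (f + h) = P f + P h" for f h
    by (simp add: P_def L_add p(3) sum.distrib fun_space.scale_right_distrib)
  have P_scale: "P (scale_fun d f) = scale_fun d (P f)" for d f
    by (simp add: P_def L_scale p(4) fun_space.scale_sum_right[symmetric] fun_space.scale_left_commute)
  have P_0: "P 0 = 0" using P_add[of 0 0] by simp
  have P_sum: "P (\<Sum>i\<in>A. F i) = (\<Sum>i\<in>A. P (F i))" for A and F :: "'a \<Rightarrow> 'a \<Rightarrow> 'k"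
    by (induction A rule: infinite_finite_induct)
      (simp_all only: sum.infinite sum.empty sum.insert P_add P_0 not_False_eq_True)
  have P_V: "P h \<in> V" for h
    unfolding P_def using V_L p(1)
    by (intro fun_space.subspace_scale[OF sub] fun_space.subspace_sum[OF sub]) auto
  have P_L: "P (L k h) = L k (P h)" if k: "k \<in> ?C" for k h
  proof -
    have "(\<Sum>g\<in>?C. L g (p (L (inv g) (L k h)))) = (\<Sum>g\<in>?C. L (k \<otimes> g) (p (L (inv (k \<otimes> g)) (L k h))))"
      by (rule sum.reindex_bij_betw[OF bij[OF k], symmetric])
    also have "\<dots> = (\<Sum>g\<in>?C. L k (L g (p (L (inv g) h))))"
      using k by (intro sum.cong) (auto simp: L_L inv_mult_group m_assoc)
    finally show ?thesis by (simp add: P_def L_scale L_sum)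
  qed
  have P_r: "P r = r"
  proof -
    have "(\<Sum>g\<in>?C. L g (p (L (inv g) r))) = (\<Sum>g\<in>?C. r)"
      using p(2) V_L rV L_inv r by (intro sum.cong) auto
    then have "P r = scale_fun c (scale_fun (of_nat (card ?C)) r)"
      by (auto simp: P_def sum_fun_apply)
    then show ?thesis using card by (auto simp: c_def)
  qed
  \<comment> \<open>An equivariant map is right convolution with its value at the unit \<open>\<delta>\<close>. This value lies in \<open>V\<close>,
    hence is a left multiple of \<open>r\<close>.\<close>
  obtain s where s: "P \<delta> = convolution G s r" using P_V[of \<delta>] by (auto simp: V_def)
  have "r = P (\<Sum>g\<in>?C. scale_fun (r g) (L g \<delta>))" using expand[of r] r P_r by simp
  also have "\<dots> = (\<Sum>g\<in>?C. scale_fun (r g) (L g (P \<delta>)))"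
    by (simp add: P_sum P_scale P_L)
  also have "\<dots> = convolution G r (P \<delta>)" by (simp add: conv_eq)
  finally have "convolution G r (convolution G s r) = r" unfolding s by (rule sym)
  then show ?thesis by (rule that)
qed

end

text \<open>Strict monotonicity of the dimension below a space spanned by a finite set \<open>B\<close>; the ambient function space
  may have infinite dimension.\<close>

lemma subspace_dim_strict_mono:
  fixes V U :: "('a \<Rightarrow> 'k::field) set"
  assumes V: "fun_space.subspace V" and VU: "V \<subset> U" and U: "U \<subseteq> fun_space.span B" "finite B"
  shows "fun_space.dim V < fun_space.dim U"
proof -
  obtain C where C: "C \<subseteq> V" "fun_space.independent C" "V \<subseteq> fun_space.span C"
    using fun_space.maximal_independent_subset[of V] by blast
  have VC: "V = fun_space.span C" using C V fun_space.span_minimal by blast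
  obtain x where x: "x \<in> U" "x \<notin> V" using VU by auto
  have ind: "fun_space.independent (insert x C)"
    using x VC C(2) fun_space.independent_insertI by blast
  obtain D where D: "insert x C \<subseteq> D" "D \<subseteq> U" "fun_space.independent D" "U \<subseteq> fun_space.span D"
    using fun_space.maximal_independent_subset_extend[of "insert x C" U] ind C(1) VU x by blast
  have "finite D"
    using fun_space.independent_span_bound[OF U(2) D(3)] D(2) U(1) by blast
  moreover have "x \<notin> C" using x C by blast
  ultimately have "C \<subset> D" "finite D" using D(1) by auto
  then have "card C < card D" by (rule psubset_card_mono[rotated])
  moreover have "fun_space.dim V = card C" using fun_space.basis_card_eq_dim[of C V] C by simp
  moreover have "fun_space.dim U = card D"
    using fun_space.basis_card_eq_dim[of D U] D by simp
  ultimately show ?thesis by simp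
qed

section \<open>Components of edge sets\<close>

text \<open>Connectedness in a graph given by its set of edges alone. A node on no edge is connected exactly to itself, so
  no vertex set is needed.\<close>

definition conn :: "'v set set \<Rightarrow> ('v \<times> 'v) set" where
  "conn E = {(x, y). \<exists>e\<in>E. x \<in> e \<and> y \<in> e}\<^sup>*"

lemma conn_refl [simp]: "(x, x) \<in> conn E"
  by (simp add: conn_def)

lemma conn_trans: "(x, y) \<in> conn E \<Longrightarrow> (y, z) \<in> conn E \<Longrightarrow> (x, z) \<in> conn E"
  unfolding conn_def by (rule rtrancl_trans)

lemma conn_edge: "e \<in> E \<Longrightarrow> x \<in> e \<Longrightarrow> y \<in> e \<Longrightarrow> (x, y) \<in> conn E"
  unfolding conn_def by (intro r_into_rtrancl) auto

lemma conn_sym: "(x, y) \<in> conn E \<Longrightarrow> (y, x) \<in> conn E"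
proof -
  have "sym {(x, y). \<exists>e\<in>E. x \<in> e \<and> y \<in> e}" by (auto intro: symI)
  then have "sym (conn E)" unfolding conn_def by (rule sym_rtrancl)
  then show "(x, y) \<in> conn E \<Longrightarrow> (y, x) \<in> conn E" by (rule symD)
qed

lemma conn_induct [consumes 1, case_names base step]:
  assumes "(x, y) \<in> conn E" and "P x"
    and "\<And>y z e. (x, y) \<in> conn E \<Longrightarrow> P y \<Longrightarrow> e \<in> E \<Longrightarrow> y \<in> e \<Longrightarrow> z \<in> e \<Longrightarrow> P z"
  shows "P y"
  using assms(1) unfolding conn_def
proof (induction rule: rtrancl_induct)
  case base
  then show ?case by (rule assms(2))
next
  case (step y z)
  then show ?case using assms(3)[of y _ z] unfolding conn_def by auto
qed

text \<open>To compare two graphs it suffices to look at single edges of the first one.\<close>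

lemma conn_least:
  assumes "(x, y) \<in> conn E" "\<And>e x y. e \<in> E \<Longrightarrow> x \<in> e \<Longrightarrow> y \<in> e \<Longrightarrow> (x, y) \<in> conn F"
  shows "(x, y) \<in> conn F"
  using assms(1)
proof (induction rule: conn_induct)
  case (step y z e)
  then show ?case using assms(2) conn_trans by metis
qed simp

lemma conn_mono: "E \<subseteq> F \<Longrightarrow> (x, y) \<in> conn E \<Longrightarrow> (x, y) \<in> conn F"
  by (erule conn_least) (auto intro: conn_edge)

lemma conn_closed:
  assumes "(x, y) \<in> conn E" "x \<in> S" "\<And>e. e \<in> E \<Longrightarrow> e \<inter> S \<noteq> {} \<Longrightarrow> e \<subseteq> S"
  shows "y \<in> S"
  using assms(1)
proof (induction rule: conn_induct)
  case base
  show ?case by (rule assms(2))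
next
  case (step y z e)
  then show ?case using assms(3)[of e] by blast
qed

lemma conn_isolated: "(x, y) \<in> conn E \<Longrightarrow> x \<notin> \<Union>E \<Longrightarrow> y = x"
  using conn_closed[of x y E "{x}"] by auto

lemma conn_image: "(x, y) \<in> conn E \<Longrightarrow> (f x, f y) \<in> conn ((`) f ` E)"
proof (induction rule: conn_induct)
  case (step y z e)
  have "(f y, f z) \<in> conn ((`) f ` E)" by (rule conn_edge[of "f ` e"]) (use step in auto)
  then show ?case using step conn_trans by metis
qed simp

lemma conn_image_inj:
  assumes "inj f"
  shows "(a, b) \<in> conn ((`) f ` E) \<longleftrightarrow> a = b \<or> (\<exists>x y. a = f x \<and> b = f y \<and> (x, y) \<in> conn E)"
proof
  assume "(a, b) \<in> conn ((`) f ` E)"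
  then show "a = b \<or> (\<exists>x y. a = f x \<and> b = f y \<and> (x, y) \<in> conn E)"
  proof (induction rule: conn_induct)
    case (step y z e)
    then obtain e' y' z' where e: "e' \<in> E" "y = f y'" "z = f z'" "y' \<in> e'" "z' \<in> e'" by auto
    then have yz: "(y', z') \<in> conn E" by (intro conn_edge)
    show ?case
      using step.IH
    proof
      assume "a = y"
      then show ?thesis using e yz by blast
    next
      assume "\<exists>x u. a = f x \<and> y = f u \<and> (x, u) \<in> conn E"
      then obtain x u where "a = f x" "y = f u" "(x, u) \<in> conn E" by blast
      then have "u = y'" using e assms by (simp add: inj_eq)
      then have "(x, z') \<in> conn E" using conn_trans[OF \<open>(x, u) \<in> conn E\<close>] yz by simp
      then show ?thesis using e \<open>a = f x\<close> by blast
    qed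
  qed simp
qed (auto intro: conn_image)

lemma conn_image_inj_iff: "inj f \<Longrightarrow> (f x, f y) \<in> conn ((`) f ` E) \<longleftrightarrow> (x, y) \<in> conn E"
  by (auto simp: conn_image_inj inj_eq)

text \<open>The graph \<open>D\<close> avoids \<open>I\<close> and records how \<open>E\<close> connects the nodes outside \<open>I\<close>. Composing diagrams is
  the main example, with the middle row as \<open>I\<close>.\<close>

definition contracts :: "'v set \<Rightarrow> 'v set set \<Rightarrow> 'v set set \<Rightarrow> bool" where
  "contracts I D E \<longleftrightarrow> (\<forall>e\<in>D. e \<inter> I = {}) \<and>
     (\<forall>x y. x \<notin> I \<longrightarrow> y \<notin> I \<longrightarrow> (x, y) \<in> conn D \<longleftrightarrow> (x, y) \<in> conn E)"

text \<open>Edges \<open>F\<close> that avoid \<open>I\<close> do not interfere with the contraction: a path in \<open>E \<union> F\<close> enters and leaves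
  \<open>I\<close> by stretches of \<open>E\<close>-edges between nodes outside \<open>I\<close>, and \<open>D\<close> shortcuts each of them.\<close>

lemma contracts_conn:
  assumes c: "contracts I D E" and F: "\<And>e. e \<in> F \<Longrightarrow> e \<inter> I = {}" and xy: "x \<notin> I" "y \<notin> I"
  shows "(x, y) \<in> conn (E \<union> F) \<longleftrightarrow> (x, y) \<in> conn (D \<union> F)"
proof
  assume "(x, y) \<in> conn (E \<union> F)"
  \<comment> \<open>\<open>z\<close> is where the current stretch of \<open>E\<close>-edges started\<close>
  then have "\<exists>z. z \<notin> I \<and> (x, z) \<in> conn (D \<union> F) \<and> (z, y) \<in> conn E"
  proof (induction rule: conn_induct)
    case base
    then show ?case using xy by auto
  next
    case (step u v e)
    then obtain z where z: "z \<notin> I" "(x, z) \<in> conn (D \<union> F)" "(z, u) \<in> conn E" by blast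
    show ?case
    proof (cases "e \<in> E")
      case True
      then have "(u, v) \<in> conn E" using step by (intro conn_edge)
      then show ?thesis using z conn_trans by metis
    next
      case False
      then have e: "e \<in> F" using step by auto
      then have out: "u \<notin> I" "v \<notin> I" using F step by auto
      have "(z, u) \<in> conn D" using c z out unfolding contracts_def by blast
      then have "(z, u) \<in> conn (D \<union> F)" using conn_mono[of D "D \<union> F"] by auto
      moreover have "(u, v) \<in> conn (D \<union> F)" by (rule conn_edge[of e]) (use e step in auto)
      ultimately have "(x, v) \<in> conn (D \<union> F)" using z conn_trans by metis
      then show ?thesis using out by auto
    qed
  qed
  then obtain z where z: "z \<notin> I" "(x, z) \<in> conn (D \<union> F)" "(z, y) \<in> conn E" by blast
  then have "(z, y) \<in> conn D" using c xy unfolding contracts_def by blast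
  then have "(z, y) \<in> conn (D \<union> F)" using conn_mono[of D "D \<union> F"] by auto
  then show "(x, y) \<in> conn (D \<union> F)" using z conn_trans by metis
next
  assume "(x, y) \<in> conn (D \<union> F)"
  then show "(x, y) \<in> conn (E \<union> F)"
  proof (rule conn_least)
    fix e u v assume e: "e \<in> D \<union> F" "u \<in> e" "v \<in> e"
    show "(u, v) \<in> conn (E \<union> F)"
    proof (cases "e \<in> F")
      case True
      then show ?thesis using e by (intro conn_edge[of e]) auto
    next
      case False
      then have D: "e \<in> D" using e by simp
      then have "u \<notin> I" "v \<notin> I" using c e unfolding contracts_def by blast+
      moreover have "(u, v) \<in> conn D" using D e by (intro conn_edge)
      ultimately have "(u, v) \<in> conn E" using c unfolding contracts_def by blast
      then show ?thesis using conn_mono[of E "E \<union> F"] by auto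
    qed
  qed
qed

text \<open>The components of \<open>E\<close> that lie inside \<open>K\<close>; for \<open>K\<close> an inner row of a stack these are the closed loops.\<close>

definition closed_classes :: "'v set set \<Rightarrow> 'v set \<Rightarrow> 'v set set" where
  "closed_classes E K = {C. \<exists>z\<in>K. C = conn E `` {z} \<and> C \<subseteq> K}"

lemma finite_closed_classes: "finite K \<Longrightarrow> finite (closed_classes E K)"
  by (rule finite_subset[of _ "Pow K"]) (auto simp: closed_classes_def)

lemma class_eq:
  assumes "(x, y) \<in> conn E"
  shows "conn E `` {x} = conn E `` {y}"
proof (intro equalityI subsetI)
  fix z
  show "z \<in> conn E `` {x} \<Longrightarrow> z \<in> conn E `` {y}" using conn_trans[OF conn_sym[OF assms]] by simp
  show "z \<in> conn E `` {y} \<Longrightarrow> z \<in> conn E `` {x}" using conn_trans[OF assms] by simp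
qed

lemma closed_classes_image:
  assumes "inj f"
  shows "closed_classes ((`) f ` E) (f ` K) = (`) f ` closed_classes E K"
proof -
  have cls: "conn ((`) f ` E) `` {f z} = f ` (conn E `` {z})" for z
    using assms by (auto simp: conn_image_inj inj_eq)
  show ?thesis
  proof (intro equalityI subsetI)
    fix C assume "C \<in> closed_classes ((`) f ` E) (f ` K)"
    then obtain z where "z \<in> K" "C = f ` (conn E `` {z})" "f ` (conn E `` {z}) \<subseteq> f ` K"
      unfolding closed_classes_def using cls by auto
    moreover from this have "conn E `` {z} \<in> closed_classes E K"
      using inj_image_subset_iff[OF assms] unfolding closed_classes_def by blast
    ultimately show "C \<in> (`) f ` closed_classes E K" by blast
  next
    fix C assume "C \<in> (`) f ` closed_classes E K"
    then obtain z where "z \<in> K" "C = f ` (conn E `` {z})" "conn E `` {z} \<subseteq> K"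
      unfolding closed_classes_def by auto
    then show "C \<in> closed_classes ((`) f ` E) (f ` K)"
      unfolding closed_classes_def using cls by blast
  qed
qed

lemma card_closed_classes_image:
  assumes "inj f"
  shows "card (closed_classes ((`) f ` E) (f ` K)) = card (closed_classes E K)"
  unfolding closed_classes_image[OF assms]
  by (rule card_image) (meson assms inj_image_eq_iff inj_onI)

text \<open>A component of \<open>E \<union> F\<close> lies in \<open>I\<close>, and then is a component of \<open>E\<close> alone, or it meets
  the outside of \<open>I\<close> and is visible after the contraction.\<close>

lemma card_closed_classes_contract:
  assumes c: "contracts I D E" and F: "\<And>e. e \<in> F \<Longrightarrow> e \<inter> I = {}"
    and IK: "I \<inter> K = {}" and fin: "finite I" "finite K"
  shows "card (closed_classes (E \<union> F) (I \<union> K)) =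
    card (closed_classes E I) + card (closed_classes (D \<union> F) K)"
proof -
  have inI: "conn (E \<union> F) `` {z} = conn E `` {z}" if "z \<in> I" "conn E `` {z} \<subseteq> I" for z
  proof (intro equalityI subsetI)
    fix y assume "y \<in> conn (E \<union> F) `` {z}"
    then have "(z, y) \<in> conn (E \<union> F)" by simp
    then have "(z, y) \<in> conn E"
    proof (induction rule: conn_induct)
      case (step u v e)
      then have "u \<in> I" using that by auto
      then have "e \<in> E" using F step by auto
      then show ?case using step conn_trans conn_edge by metis
    qed simp
    then show "y \<in> conn E `` {z}" by simp
  next
    fix y assume "y \<in> conn E `` {z}"
    then show "y \<in> conn (E \<union> F) `` {z}" using conn_mono[of E "E \<union> F"] by auto
  qed
  have A1: "closed_classes E I = {C \<in> closed_classes (E \<union> F) (I \<union> K). C \<subseteq> I}" (is "?L = ?R")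
  proof (intro equalityI subsetI)
    fix C assume "C \<in> ?L"
    then obtain z where "z \<in> I" "C = conn E `` {z}" "C \<subseteq> I" by (auto simp: closed_classes_def)
    then show "C \<in> ?R" using inI[of z] by (auto simp: closed_classes_def)
  next
    fix C assume "C \<in> ?R"
    then obtain z where z: "C = conn (E \<union> F) `` {z}" "C \<subseteq> I" by (auto simp: closed_classes_def)
    then have zI: "z \<in> I" by auto
    have "conn E `` {z} \<subseteq> C" using z conn_mono[of E "E \<union> F"] by auto
    then show "C \<in> ?L" using z zI inI[of z] by (auto simp: closed_classes_def)
  qed
  have out: "(conn (E \<union> F) `` {z}) - I = conn (D \<union> F) `` {z}" if z: "z \<notin> I" for z
  proof -
    have "y \<notin> I" if "(z, y) \<in> conn (D \<union> F)" for y
    proof -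
      have "y \<in> - I"
        using that by (rule conn_closed) (use z c F in \<open>auto simp: contracts_def\<close>)
      then show ?thesis by simp
    qed
    then show ?thesis using contracts_conn[OF c F z] by auto
  qed
  have A2: "bij_betw (\<lambda>C. C - I) {C \<in> closed_classes (E \<union> F) (I \<union> K). \<not> C \<subseteq> I}
      (closed_classes (D \<union> F) K)" (is "bij_betw _ ?A ?B")
  proof -
    have A: "\<exists>z. z \<in> K \<and> z \<notin> I \<and> C = conn (E \<union> F) `` {z} \<and> C \<subseteq> I \<union> K" if C: "C \<in> ?A" for C
    proof -
      obtain x where x: "C = conn (E \<union> F) `` {x}" "C \<subseteq> I \<union> K" "\<not> C \<subseteq> I"
        using C by (auto simp: closed_classes_def)
      then obtain z where z: "z \<in> C" "z \<notin> I" by auto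
      have "z \<in> K" using z x by blast
      moreover have "C = conn (E \<union> F) `` {z}" using class_eq[of x z] z x by simp
      ultimately show ?thesis using z(2) x(2) by blast
    qed
    show ?thesis
      unfolding bij_betw_def
    proof
      show "inj_on (\<lambda>C. C - I) ?A"
      proof (rule inj_onI)
        fix C C' assume C: "C \<in> ?A" "C' \<in> ?A" "C - I = C' - I"
        obtain z where z: "z \<notin> I" "C = conn (E \<union> F) `` {z}" using A[OF C(1)] by blast
        obtain x where x: "C' = conn (E \<union> F) `` {x}" using A[OF C(2)] by blast
        have "z \<in> C - I" using z by simp
        then have "z \<in> C'" using C(3) by auto
        then show "C = C'" using x z class_eq[of x z] by simp
      qed
      show "(\<lambda>C. C - I) ` ?A = ?B"
      proof (intro equalityI subsetI)
        fix X assume "X \<in> (\<lambda>C. C - I) ` ?A"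
        then obtain C where C: "C \<in> ?A" "X = C - I" by auto
        obtain z where z: "z \<in> K" "z \<notin> I" "C = conn (E \<union> F) `` {z}" "C \<subseteq> I \<union> K"
          using A[OF C(1)] by blast
        then show "X \<in> ?B" using out[OF z(2)] C(2) by (auto simp: closed_classes_def)
      next
        fix X assume "X \<in> ?B"
        then obtain z where z: "z \<in> K" "X = conn (D \<union> F) `` {z}" "X \<subseteq> K"
          by (auto simp: closed_classes_def)
        then have zI: "z \<notin> I" using IK by auto
        let ?C = "conn (E \<union> F) `` {z}"
        have "?C - I = X" using out[OF zI] z by simp
        moreover have "?C \<in> ?A"
        proof -
          have "?C \<subseteq> I \<union> K" using out[OF zI] z by auto
          moreover have "z \<in> ?C" by simp
          ultimately show ?thesis using z(1) zI unfolding closed_classes_def by blast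
        qed
        ultimately show "X \<in> (\<lambda>C. C - I) ` ?A" by blast
      qed
    qed
  qed
  have "finite (closed_classes (E \<union> F) (I \<union> K))" using fin by (intro finite_closed_classes) auto
  then have "card (closed_classes (E \<union> F) (I \<union> K)) =
      card {C \<in> closed_classes (E \<union> F) (I \<union> K). C \<subseteq> I} +
      card {C \<in> closed_classes (E \<union> F) (I \<union> K). \<not> C \<subseteq> I}"
    by (subst card_Un_disjoint[symmetric]) (auto intro!: arg_cong[of _ _ card])
  then show ?thesis using A1 bij_betw_same_card[OF A2] by simp
qed

text \<open>A connected graph has at most one vertex more than it has edges: grow a vertex set from \<open>x\<close>,
  one crossing edge at a time.\<close>

lemma card_class_le_edges:
  fixes E :: "'v set set"
  assumes fin: "finite (conn E `` {x})" and two: "\<And>e. e \<in> E \<Longrightarrow> card e = 2"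
  shows "card (conn E `` {x}) \<le> card {e \<in> E. e \<subseteq> conn E `` {x}} + 1"
proof -
  let ?C = "conn E `` {x}"
  have finE: "finite {e \<in> E. e \<subseteq> S}" if "S \<subseteq> ?C" for S
    using finite_subset[OF that fin] by (rule_tac finite_subset[of _ "Pow S"]) auto
  \<comment> \<open>a largest \<open>S\<close> with this property is all of the component\<close>
  let ?P = "\<lambda>S. S \<subseteq> ?C \<and> x \<in> S \<and> card S \<le> card {e \<in> E. e \<subseteq> S} + 1"
  have "?P {x}" by simp
  moreover have "\<forall>S. ?P S \<longrightarrow> card S < Suc (card ?C)"
    using fin card_mono less_Suc_eq_le by blast
  ultimately obtain S where S: "?P S" "\<forall>T. ?P T \<longrightarrow> card T \<le> card S"
    using ex_has_greatest_nat[of ?P "{x}" card "Suc (card ?C)"] by blast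
  have "?C \<subseteq> S"
  proof (rule ccontr)
    assume "\<not> ?C \<subseteq> S"
    then obtain y where y: "(x, y) \<in> conn E" "y \<notin> S" by auto
    then obtain e where e: "e \<in> E" "e \<inter> S \<noteq> {}" "\<not> e \<subseteq> S"
      using conn_closed[of x y E S] S by blast
    then obtain u v where uv: "u \<in> e" "u \<in> S" "v \<in> e" "v \<notin> S" by auto
    have xu: "(x, u) \<in> conn E" using S uv by auto
    have "(u, v) \<in> conn E" using e uv by (intro conn_edge)
    then have vC: "v \<in> ?C" using conn_trans[OF xu] by simp
    have "e = {u, v}"
    proof -
      have "finite e" using two[OF e(1)] card.infinite by fastforce
      then show ?thesis using card_subset_eq[of e "{u, v}"] two[OF e(1)] uv by (metis card_2_iff empty_subsetI insert_subset)
    qed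
    then have "insert e {e \<in> E. e \<subseteq> S} \<subseteq> {e \<in> E. e \<subseteq> insert v S}" using e uv by auto
    moreover have sub: "insert v S \<subseteq> ?C" using vC S by auto
    ultimately have "card (insert e {e \<in> E. e \<subseteq> S}) \<le> card {e \<in> E. e \<subseteq> insert v S}"
      using finE by (intro card_mono) auto
    moreover have "card (insert e {e \<in> E. e \<subseteq> S}) = Suc (card {e \<in> E. e \<subseteq> S})"
      using finE S e by simp
    moreover have cS: "card (insert v S) = Suc (card S)"
      using uv finite_subset[OF _ fin] S by simp
    ultimately have "?P (insert v S)" using S sub by auto
    then have "card (insert v S) \<le> card S" using S(2) by blast
    then show False using cS by simp
  qed
  then have "S = ?C" using S by auto
  then show ?thesis using S by simp
qed

section \<open>Composition of diagrams as contraction\<close>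

abbreviation outer_rows :: "nat \<Rightarrow> node set" where
  "outer_rows n \<equiv> node_row n 0 \<union> node_row n 1"

definition shift :: "node \<Rightarrow> node" where "shift = map_prod Suc id"

text \<open>In the stack of two diagrams the outer rows are 0 and 2. The map \<open>spread\<close> places the nodes of the composite
  there; it is inverse to the renumbering \<open>r div 2\<close>.\<close>

definition spread :: "node \<Rightarrow> node" where "spread = map_prod (\<lambda>r. 2 * r) id"

lemma inj_shift: "inj shift"
  by (auto simp: shift_def inj_def map_prod_def split: prod.splits)

lemma inj_spread: "inj spread"
  by (auto simp: spread_def inj_def map_prod_def split: prod.splits)

lemma stack_edges_eq: "stack_edges d1 d2 = d1 \<union> (`) shift ` d2"
  by (simp add: stack_edges_def shift_def)

lemma outer_rowsE:
  assumes "x \<in> outer_rows n"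
  obtains j where "x = (0, j)" "j \<in> {1..2 * n}" | j where "x = (1, j)" "j \<in> {1..2 * n}"
  using assms by (auto simp: node_row_def)

lemma finite_node_row [simp]: "finite (node_row n r)"
  by (simp add: node_row_def)

lemma node_row_disjoint: "r \<noteq> s \<Longrightarrow> node_row n r \<inter> node_row n s = {}"
  by (auto simp: node_row_def)

lemma shift_row: "shift ` node_row n r = node_row n (Suc r)"
  by (force simp: shift_def node_row_def)

lemma shift_outer:
  "shift ` outer_rows n = node_row n 1 \<union> node_row n 2"
  "shift ` (node_row n 1 \<union> node_row n 2) = node_row n 2 \<union> node_row n 3"
  by (simp_all only: image_Un shift_row numeral_2_eq_2 numeral_3_eq_3 One_nat_def)

lemma spread_not_middle: "spread x \<notin> node_row n 1"
  by (cases x) (auto simp: spread_def node_row_def)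

lemma spread_outer: "spread ` outer_rows n = node_row n 0 \<union> node_row n 2"
  by (force simp: spread_def node_row_def)

lemma spread_outer_iff: "spread x \<in> node_row n 0 \<union> node_row n 2 \<longleftrightarrow> x \<in> outer_rows n"
  unfolding spread_outer[symmetric] by (rule inj_image_mem_iff[OF inj_spread])

lemma collapse_spread: "(\<lambda>(r, j). (r div 2, j)) (spread x) = x"
  by (cases x) (simp add: spread_def)

lemma stack_class_subset:
  assumes "\<Union>d1 \<subseteq> outer_rows n" "\<Union>d2 \<subseteq> outer_rows n" "(x, y) \<in> conn (stack_edges d1 d2)"
    "x \<in> node_row n 0 \<union> node_row n 1 \<union> node_row n 2"
  shows "y \<in> node_row n 0 \<union> node_row n 1 \<union> node_row n 2"
  using assms(3,4)
proof (rule conn_closed)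
  fix e assume "e \<in> stack_edges d1 d2"
  moreover have "shift ` f \<subseteq> node_row n 1 \<union> node_row n 2" if "f \<subseteq> outer_rows n" for f
    using image_mono[OF that, of shift] by (simp add: image_Un shift_row numeral_2_eq_2)
  ultimately show "e \<subseteq> node_row n 0 \<union> node_row n 1 \<union> node_row n 2"
    using assms(1,2) unfolding stack_edges_eq by blast
qed

text \<open>The composite, seen as an equivalence relation on its own nodes: connectedness in the stack. Its
  classes are the edges of the composite.\<close>

definition composite_rel :: "nat \<Rightarrow> diagram \<Rightarrow> diagram \<Rightarrow> (node \<times> node) set" where
  "composite_rel n d1 d2 = {(x, y). x \<in> outer_rows n \<and> y \<in> outer_rows n \<and>
     (spread x, spread y) \<in> conn (stack_edges d1 d2)}"

lemma equiv_composite_rel: "equiv (outer_rows n) (composite_rel n d1 d2)"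
  by (rule equivI)
    (auto simp: composite_rel_def refl_on_def sym_def trans_def dest: conn_sym intro: conn_trans)

lemma compose_eq_quotient:
  assumes "\<Union>d1 \<subseteq> outer_rows n" "\<Union>d2 \<subseteq> outer_rows n"
  shows "compose_diagrams n d1 d2 = outer_rows n // composite_rel n d1 d2"
proof -
  let ?c = "conn (stack_edges d1 d2)"
  let ?N = "node_row n 0 \<union> node_row n 1 \<union> node_row n 2"
  let ?down = "\<lambda>(r, j). (r div 2, j)"
  have key: "?down ` (?c `` {spread x} - node_row n 1) = composite_rel n d1 d2 `` {x}"
    if x: "x \<in> outer_rows n" for x
  proof (intro equalityI subsetI)
    fix y assume "y \<in> ?down ` (?c `` {spread x} - node_row n 1)"
    then obtain v where v: "y = ?down v" "(spread x, v) \<in> ?c" "v \<notin> node_row n 1" by auto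
    have "v \<in> ?N" using stack_class_subset[OF assms v(2)] spread_outer_iff[of x n] x by blast
    then have "v \<in> spread ` outer_rows n" using v(3) spread_outer[of n] by auto
    then obtain u where u: "u \<in> outer_rows n" "v = spread u" by auto
    then have "y = u" using v(1) collapse_spread by simp
    then show "y \<in> composite_rel n d1 d2 `` {x}" using u v x by (simp add: composite_rel_def)
  next
    fix y assume "y \<in> composite_rel n d1 d2 `` {x}"
    then have "(spread x, spread y) \<in> ?c" by (simp add: composite_rel_def)
    then have "spread y \<in> ?c `` {spread x} - node_row n 1" using spread_not_middle by simp
    then have "?down (spread y) \<in> ?down ` (?c `` {spread x} - node_row n 1)" by (rule imageI)
    then show "y \<in> ?down ` (?c `` {spread x} - node_row n 1)" unfolding collapse_spread .
  qed
  have comp: "stack_components n d1 d2 = {?c `` {z} | z. z \<in> ?N}"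
    by (auto simp: stack_components_def quotient_def conn_def)
  show ?thesis
  proof (intro equalityI subsetI)
    fix e assume "e \<in> compose_diagrams n d1 d2"
    then obtain z where z: "e = ?down ` (?c `` {z} - node_row n 1)" "z \<in> ?N"
      "\<not> ?c `` {z} \<subseteq> node_row n 1"
      unfolding compose_diagrams_def comp by blast
    then obtain w where w: "(z, w) \<in> ?c" "w \<notin> node_row n 1" by auto
    have "w \<in> ?N" using stack_class_subset[OF assms w(1) z(2)] .
    then have "w \<in> spread ` outer_rows n" using w(2) spread_outer[of n] by auto
    then obtain x where x: "x \<in> outer_rows n" "w = spread x" by auto
    have "e = composite_rel n d1 d2 `` {x}"
      using z(1) key[OF x(1)] class_eq[OF w(1)] x(2) by simp
    then show "e \<in> outer_rows n // composite_rel n d1 d2" using x(1) by (auto simp: quotient_def)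
  next
    fix e assume "e \<in> outer_rows n // composite_rel n d1 d2"
    then obtain x where x: "x \<in> outer_rows n" "e = composite_rel n d1 d2 `` {x}"
      by (auto simp: quotient_def)
    have "spread x \<in> ?N" using x(1) spread_outer_iff[of x n] by blast
    moreover have "\<not> ?c `` {spread x} \<subseteq> node_row n 1"
      using spread_not_middle[of x n] conn_refl[of "spread x"] by blast
    ultimately show "e \<in> compose_diagrams n d1 d2"
      unfolding compose_diagrams_def comp x(2) key[OF x(1), symmetric] by blast
  qed
qed

lemma compose_subset_outer:
  assumes "\<Union>d1 \<subseteq> outer_rows n" "\<Union>d2 \<subseteq> outer_rows n"
  shows "\<Union>(compose_diagrams n d1 d2) \<subseteq> outer_rows n"
  unfolding compose_eq_quotient[OF assms] by (auto simp: quotient_def composite_rel_def)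

lemma closed_loops_eq:
  "closed_loops n d1 d2 = card (closed_classes (stack_edges d1 d2) (node_row n 1))"
proof -
  have "{C \<in> stack_components n d1 d2. C \<subseteq> node_row n 1} =
      closed_classes (stack_edges d1 d2) (node_row n 1)"
  proof (intro equalityI subsetI)
    fix C assume "C \<in> {C \<in> stack_components n d1 d2. C \<subseteq> node_row n 1}"
    then obtain z where z: "C = conn (stack_edges d1 d2) `` {z}" "C \<subseteq> node_row n 1"
      by (auto simp: stack_components_def quotient_def conn_def)
    then have "z \<in> node_row n 1" by auto
    then show "C \<in> closed_classes (stack_edges d1 d2) (node_row n 1)"
      using z unfolding closed_classes_def by blast
  qed (auto simp: closed_classes_def stack_components_def quotient_def conn_def)
  then show ?thesis by (simp add: closed_loops_def)
qed

text \<open>The main instance of a contraction: the edges of the composite are the traces of the components of the stack on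
  the outer rows, so they connect the same outer nodes as the stack does.\<close>

lemma contracts_stack:
  assumes "\<Union>d1 \<subseteq> outer_rows n" "\<Union>d2 \<subseteq> outer_rows n"
  shows "contracts (node_row n 1) ((`) spread ` compose_diagrams n d1 d2) (stack_edges d1 d2)"
  unfolding contracts_def
proof (intro conjI ballI allI impI)
  fix e assume "e \<in> (`) spread ` compose_diagrams n d1 d2"
  then show "e \<inter> node_row n 1 = {}" using spread_not_middle by auto
next
  let ?D = "(`) spread ` compose_diagrams n d1 d2" and ?E = "stack_edges d1 d2"
  fix x y assume xy: "x \<notin> node_row n 1" "y \<notin> node_row n 1"
  show "(x, y) \<in> conn ?D \<longleftrightarrow> (x, y) \<in> conn ?E"
  proof
    assume "(x, y) \<in> conn ?D"
    then show "(x, y) \<in> conn ?E"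
    proof (rule conn_least)
      fix e u v assume e: "e \<in> ?D" "u \<in> e" "v \<in> e"
      then obtain z where z: "e = spread ` (composite_rel n d1 d2 `` {z})"
        unfolding compose_eq_quotient[OF assms] quotient_def by auto
      obtain a b where ab: "u = spread a" "v = spread b" "(z, a) \<in> composite_rel n d1 d2"
        "(z, b) \<in> composite_rel n d1 d2" using e z by auto
      have "(spread z, spread a) \<in> conn ?E" "(spread z, spread b) \<in> conn ?E"
        using ab(3,4) by (auto simp: composite_rel_def)
      then show "(u, v) \<in> conn ?E" using conn_trans[OF conn_sym] ab by metis
    qed
  next
    assume c: "(x, y) \<in> conn ?E"
    show "(x, y) \<in> conn ?D"
    proof (cases "x = y")
      case False
      let ?N = "node_row n 0 \<union> node_row n 1 \<union> node_row n 2"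
      have sub: "\<Union>?E \<subseteq> ?N"
      proof -
        have "shift ` f \<subseteq> node_row n 1 \<union> node_row n 2" if "f \<subseteq> outer_rows n" for f
          using image_mono[OF that, of shift] by (simp add: image_Un shift_row numeral_2_eq_2)
        then show ?thesis using assms unfolding stack_edges_eq by blast
      qed
      have "x \<in> ?N" using conn_isolated[OF c] False sub by blast
      moreover from stack_class_subset[OF assms c this] have "y \<in> ?N" .
      ultimately have "x \<in> spread ` outer_rows n" "y \<in> spread ` outer_rows n"
        using xy spread_outer[of n] by auto
      then obtain a b where ab: "x = spread a" "y = spread b" "a \<in> outer_rows n" "b \<in> outer_rows n"
        by auto
      have r: "(a, a) \<in> composite_rel n d1 d2" "(a, b) \<in> composite_rel n d1 d2"
        using ab c by (auto simp: composite_rel_def)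
      have "composite_rel n d1 d2 `` {a} \<in> compose_diagrams n d1 d2"
        unfolding compose_eq_quotient[OF assms] using ab by (auto simp: quotient_def)
      then have "spread ` (composite_rel n d1 d2 `` {a}) \<in> ?D" by (rule imageI)
      then show ?thesis by (rule conn_edge) (use r ab in auto)
    qed simp
  qed
qed

lemma contracts_image:
  assumes "contracts I D E" "inj f"
  shows "contracts (f ` I) ((`) f ` D) ((`) f ` E)"
  unfolding contracts_def
proof (intro conjI ballI allI impI)
  fix e assume "e \<in> (`) f ` D"
  then obtain d where "d \<in> D" "e = f ` d" by auto
  moreover from this have "d \<inter> I = {}" using assms(1) unfolding contracts_def by blast
  ultimately show "e \<inter> f ` I = {}" using image_Int[OF assms(2), of d I] by simp
next
  fix x y assume xy: "x \<notin> f ` I" "y \<notin> f ` I"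
  have "(a, b) \<in> conn D \<longleftrightarrow> (a, b) \<in> conn E" if "x = f a" "y = f b" for a b
  proof -
    have "a \<notin> I" "b \<notin> I" using xy that by auto
    then show ?thesis using assms(1) unfolding contracts_def by blast
  qed
  then show "(x, y) \<in> conn ((`) f ` D) \<longleftrightarrow> (x, y) \<in> conn ((`) f ` E)"
    unfolding conn_image_inj[OF assms(2)] by blast
qed

text \<open>Both ways of bracketing a triple product contract the two inner rows of the stack on the rows
  0, 1, 2, 3, one after the other. Hence both composites record connectedness of rows 0 and 3 in this stack, and both
  totals of closed loops count its components in rows 1 and 2.\<close>

lemma compose_assoc_loops:
  assumes "\<Union>d1 \<subseteq> outer_rows n" "\<Union>d2 \<subseteq> outer_rows n" "\<Union>d3 \<subseteq> outer_rows n"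
  shows "compose_diagrams n (compose_diagrams n d1 d2) d3 = compose_diagrams n d1 (compose_diagrams n d2 d3)"
    and "closed_loops n d1 d2 + closed_loops n (compose_diagrams n d1 d2) d3 =
      closed_loops n d2 d3 + closed_loops n d1 (compose_diagrams n d2 d3)"
proof -
  let ?c12 = "compose_diagrams n d1 d2" and ?c23 = "compose_diagrams n d2 d3"
  let ?E = "d1 \<union> (`) shift ` d2 \<union> (`) shift ` (`) shift ` d3"
  \<comment> \<open>After row 1 (respectively row 2) is contracted, three rows remain;
    \<open>\<rho>\<close> (respectively \<open>\<rho>'\<close>) maps the rows 0, 1, 2 of a stack of two diagrams to them.\<close>
  define \<rho> :: "node \<Rightarrow> node" where "\<rho> = map_prod (\<lambda>r. if r = 0 then 0 else r + 1) id"
  define \<rho>' :: "node \<Rightarrow> node" where "\<rho>' = map_prod (\<lambda>r. if r \<le> 1 then r else r + 1) id"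
  define wide :: "node \<Rightarrow> node" where "wide = map_prod (\<lambda>r. 3 * r) id"
  have inj: "inj \<rho>" "inj \<rho>'"
    by (auto simp: \<rho>_def \<rho>'_def inj_def map_prod_def split: prod.splits if_splits)
  have rho: "\<rho> (shift x) = shift (shift x)" "\<rho>' (shift x) = shift (spread x)" if "x \<in> outer_rows n" for x
    using that by (elim outer_rowsE; simp add: \<rho>_def \<rho>'_def shift_def spread_def)+
  have rho1: "\<rho> x = spread x" "\<rho>' x = x" if "x \<in> outer_rows n" for x
    using that by (elim outer_rowsE; simp add: \<rho>_def \<rho>'_def spread_def)+
  have wide: "\<rho> (spread x) = wide x" "\<rho>' (spread x) = wide x" if "x \<in> outer_rows n" for x
    using that by (elim outer_rowsE; simp add: \<rho>_def \<rho>'_def spread_def wide_def)+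
  have wide_out: "wide x \<notin> node_row n 1" "wide x \<notin> node_row n 2" for x
  proof -
    have "3 * r \<noteq> (1 :: nat)" "3 * r \<noteq> (2 :: nat)" for r by presburger+
    then show "wide x \<notin> node_row n 1" "wide x \<notin> node_row n 2"
      by (cases x; simp add: wide_def node_row_def)+
  qed
  have c12: "\<Union>?c12 \<subseteq> outer_rows n" and c23: "\<Union>?c23 \<subseteq> outer_rows n"
    using compose_subset_outer[OF assms(1,2)] compose_subset_outer[OF assms(2,3)] .
  have im: "(`) f ` d = (`) g ` d" if "\<Union>d \<subseteq> outer_rows n" "\<And>x. x \<in> outer_rows n \<Longrightarrow> f x = g x"
    for f g :: "node \<Rightarrow> node" and d
    using that by (intro image_cong refl) auto
  have im2: "(`) f ` (`) g ` d = (`) (\<lambda>x. f (g x)) ` d" for f g :: "node \<Rightarrow> node" and d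
    by (simp add: image_image)
  have L: "(`) \<rho> ` stack_edges ?c12 d3 = (`) spread ` ?c12 \<union> (`) shift ` (`) shift ` d3"
    unfolding stack_edges_eq image_Un im2
    using im[OF c12 rho1(1)] im[OF assms(3), of "\<lambda>x. \<rho> (shift x)" "\<lambda>x. shift (shift x)"] rho(1) by simp
  have R: "(`) \<rho>' ` stack_edges d1 ?c23 = (`) shift ` (`) spread ` ?c23 \<union> d1"
  proof -
    have "(`) \<rho>' ` d1 = d1" using im[OF assms(1), of \<rho>' "\<lambda>x. x"] rho1(2) by simp
    moreover have "(`) \<rho>' ` (`) shift ` ?c23 = (`) shift ` (`) spread ` ?c23"
      unfolding im2 using im[OF c23, of "\<lambda>x. \<rho>' (shift x)" "\<lambda>x. shift (spread x)"] rho(2) by simp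
    ultimately show ?thesis unfolding stack_edges_eq image_Un by (simp add: Un_commute)
  qed
  have EL: "?E = stack_edges d1 d2 \<union> (`) shift ` (`) shift ` d3" by (simp add: stack_edges_eq)
  have ER: "?E = (`) shift ` stack_edges d2 d3 \<union> d1" by (simp add: stack_edges_eq image_Un Un_ac)
  have sub2: "e \<subseteq> node_row n 2 \<union> node_row n 3" if prem: "e \<in> (`) shift ` (`) shift ` d3" for e
  proof -
    obtain f where "f \<in> d3" and e: "e = shift ` shift ` f" using prem by auto
    then have f: "f \<subseteq> outer_rows n" using assms(3) by blast
    have "shift ` shift ` f \<subseteq> shift ` shift ` outer_rows n" using f by (intro image_mono)
    then show ?thesis unfolding e shift_outer .
  qed
  have F: "e \<inter> node_row n 1 = {}" if "e \<in> (`) shift ` (`) shift ` d3" for e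
  proof -
    have "node_row n 1 \<inter> (node_row n 2 \<union> node_row n 3) = {}" by (auto simp: node_row_def)
    then show ?thesis using sub2[OF that] by (metis Int_commute disjoint_iff subsetD)
  qed
  have F': "e \<inter> node_row n 2 = {}" if "e \<in> d1" for e
  proof -
    have "node_row n 2 \<inter> outer_rows n = {}" by (auto simp: node_row_def)
    moreover have "e \<subseteq> outer_rows n" using assms(1) that by (meson Sup_le_iff)
    ultimately show ?thesis by (metis Int_commute disjoint_iff subsetD)
  qed
  note K = contracts_stack[OF assms(1,2)]
  have K': "contracts (node_row n 2) ((`) shift ` (`) spread ` ?c23) ((`) shift ` stack_edges d2 d3)"
    using contracts_image[OF contracts_stack[OF assms(2,3)] inj_shift] by (simp add: shift_row numeral_2_eq_2)
  have relL: "composite_rel n ?c12 d3 = {(x, y). x \<in> outer_rows n \<and> y \<in> outer_rows n \<and> (wide x, wide y) \<in> conn ?E}"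
  proof -
    have "(spread x, spread y) \<in> conn (stack_edges ?c12 d3) \<longleftrightarrow> (wide x, wide y) \<in> conn ?E"
      if "x \<in> outer_rows n" "y \<in> outer_rows n" for x y
    proof -
      have "(spread x, spread y) \<in> conn (stack_edges ?c12 d3) \<longleftrightarrow>
          (\<rho> (spread x), \<rho> (spread y)) \<in> conn ((`) \<rho> ` stack_edges ?c12 d3)"
        using conn_image_inj_iff[OF inj(1)] by simp
      also have "\<dots> \<longleftrightarrow> (wide x, wide y) \<in> conn ?E"
        unfolding L EL wide(1)[OF that(1)] wide(1)[OF that(2)]
        using contracts_conn[OF K F wide_out(1) wide_out(1)] by simp
      finally show ?thesis .
    qed
    then show ?thesis unfolding composite_rel_def by blast
  qed
  have relR: "composite_rel n d1 ?c23 = {(x, y). x \<in> outer_rows n \<and> y \<in> outer_rows n \<and> (wide x, wide y) \<in> conn ?E}"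
  proof -
    have "(spread x, spread y) \<in> conn (stack_edges d1 ?c23) \<longleftrightarrow> (wide x, wide y) \<in> conn ?E"
      if "x \<in> outer_rows n" "y \<in> outer_rows n" for x y
    proof -
      have "(spread x, spread y) \<in> conn (stack_edges d1 ?c23) \<longleftrightarrow>
          (\<rho>' (spread x), \<rho>' (spread y)) \<in> conn ((`) \<rho>' ` stack_edges d1 ?c23)"
        using conn_image_inj_iff[OF inj(2)] by simp
      also have "\<dots> \<longleftrightarrow> (wide x, wide y) \<in> conn ?E"
        unfolding R ER wide(2)[OF that(1)] wide(2)[OF that(2)]
        using contracts_conn[OF K' F' wide_out(2) wide_out(2)] by simp
      finally show ?thesis .
    qed
    then show ?thesis unfolding composite_rel_def by blast
  qed
  show "compose_diagrams n ?c12 d3 = compose_diagrams n d1 ?c23"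
    unfolding compose_eq_quotient[OF c12 assms(3)] compose_eq_quotient[OF assms(1) c23] relL relR ..
  have row: "\<rho> ` node_row n 1 = node_row n 2" "\<rho>' ` node_row n 1 = node_row n 1"
    by (force simp: \<rho>_def \<rho>'_def node_row_def)+
  have "card (closed_classes ?E (node_row n 1 \<union> node_row n 2)) =
      closed_loops n d1 d2 + closed_loops n ?c12 d3"
    unfolding EL closed_loops_eq
    using card_closed_classes_contract[OF K F node_row_disjoint[of 1 2 n]]
      card_closed_classes_image[OF inj(1), of "stack_edges ?c12 d3" "node_row n 1"]
    by (simp add: L row[unfolded One_nat_def])
  moreover have "card (closed_classes ?E (node_row n 2 \<union> node_row n 1)) =
      closed_loops n d2 d3 + closed_loops n d1 ?c23"
    unfolding ER closed_loops_eq
    using card_closed_classes_contract[OF K' F' node_row_disjoint[of 2 1 n]]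
      card_closed_classes_image[OF inj(2), of "stack_edges d1 ?c23" "node_row n 1"]
      card_closed_classes_image[OF inj_shift, of "stack_edges d2 d3" "node_row n 1"]
    by (simp add: R row[unfolded One_nat_def] shift_row numeral_2_eq_2)
  ultimately show "closed_loops n d1 d2 + closed_loops n ?c12 d3 =
      closed_loops n d2 d3 + closed_loops n d1 ?c23"
    by (simp add: Un_commute)
qed

section \<open>Composites of Brauer diagrams\<close>

lemma brauer_diagram_iff:
  "d \<in> brauer_diagrams n \<longleftrightarrow> \<Union>d = outer_rows n \<and> (\<forall>e\<in>d. card e = 2) \<and>
     (\<forall>e\<in>d. \<forall>f\<in>d. \<forall>x. x \<in> e \<longrightarrow> x \<in> f \<longrightarrow> e = f)"
proof -
  have "disjoint d \<longleftrightarrow> (\<forall>e\<in>d. \<forall>f\<in>d. \<forall>x. x \<in> e \<longrightarrow> x \<in> f \<longrightarrow> e = f)"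
    unfolding disjoint_def pairwise_def disjnt_def by blast
  moreover have "{} \<notin> d" if "\<forall>e\<in>d. card e = 2" using that by force
  ultimately show ?thesis unfolding brauer_diagrams_def partition_on_def by auto
qed

lemma brauer_diagramD:
  assumes "d \<in> brauer_diagrams n"
  shows "\<Union>d = outer_rows n" "e \<in> d \<Longrightarrow> card e = 2"
    "e \<in> d \<Longrightarrow> f \<in> d \<Longrightarrow> x \<in> e \<Longrightarrow> x \<in> f \<Longrightarrow> e = f"
  using assms unfolding brauer_diagram_iff by blast+

lemma brauer_union_subset: "d \<in> brauer_diagrams n \<Longrightarrow> \<Union>d \<subseteq> outer_rows n"
  using brauer_diagramD(1) by blast

lemma pair_eqI: "card e = 2 \<Longrightarrow> x \<in> e \<Longrightarrow> y \<in> e \<Longrightarrow> x \<noteq> y \<Longrightarrow> e = {x, y}"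
  by (auto simp: card_2_iff)

lemma brauer_partner:
  assumes "d \<in> brauer_diagrams n" "x \<in> outer_rows n"
  obtains y where "y \<noteq> x" "{x, y} \<in> d" "y \<in> outer_rows n"
proof -
  obtain e where e: "e \<in> d" "x \<in> e" using brauer_diagramD(1)[OF assms(1)] assms(2) by blast
  obtain a b where ab: "e = {a, b}" "a \<noteq> b" using brauer_diagramD(2)[OF assms(1) e(1)] by (auto simp: card_2_iff)
  define y where "y = (if x = a then b else a)"
  have "e = {x, y}" "y \<noteq> x" using ab e(2) by (auto simp: y_def)
  then show ?thesis using that[of y] e brauer_diagramD(1)[OF assms(1)] by blast
qed

text \<open>A perfect matching contained in another one equals it. So two diagrams are compared by checking that
  every edge of one occurs in the other.\<close>

lemma brauer_eqI:
  assumes "d \<in> brauer_diagrams n" "d' \<in> brauer_diagrams n" "d \<subseteq> d'"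
  shows "d = d'"
proof (intro equalityI subsetI)
  fix e assume e: "e \<in> d'"
  then have "e \<noteq> {}" using brauer_diagramD(2)[OF assms(2)] by fastforce
  then obtain x where x: "x \<in> e" by auto
  then have "x \<in> outer_rows n" using brauer_diagramD(1)[OF assms(2)] e by blast
  then obtain f where f: "f \<in> d" "x \<in> f" using brauer_diagramD(1)[OF assms(1)] by blast
  then have "e = f" using brauer_diagramD(3)[OF assms(2) e _ x] assms(3) by blast
  then show "e \<in> d" using f by simp
qed (use assms(3) in auto)

lemma finite_outer_rows: "finite (outer_rows n)" by simp

lemma finite_brauer_diagram: "d \<in> brauer_diagrams n \<Longrightarrow> finite d"
  using brauer_diagramD(1)[of d n] finite_outer_rows[of n] by (metis finite_UnionD)

lemma finite_brauer_diagrams: "finite (brauer_diagrams n)"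
proof (rule finite_subset)
  show "brauer_diagrams n \<subseteq> Pow (Pow (outer_rows n))"
    using brauer_diagramD(1) by blast
qed simp

text \<open>The edges of \<open>d\<close> inside a union \<open>C\<close> of edges pair off its nodes.\<close>

lemma card_edge_closed:
  assumes d: "d \<in> brauer_diagrams n" and C: "\<And>e. e \<in> d \<Longrightarrow> e \<inter> C \<noteq> {} \<Longrightarrow> e \<subseteq> C"
  shows "card (C \<inter> outer_rows n) = 2 * card {e \<in> d. e \<subseteq> C}"
proof -
  have U: "C \<inter> outer_rows n = \<Union>{e \<in> d. e \<subseteq> C}"
  proof (intro equalityI subsetI)
    fix x assume x: "x \<in> C \<inter> outer_rows n"
    then obtain e where "e \<in> d" "x \<in> e" using brauer_diagramD(1)[OF d] by blast
    then show "x \<in> \<Union>{e \<in> d. e \<subseteq> C}" using C[of e] x by blast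
  next
    fix x assume "x \<in> \<Union>{e \<in> d. e \<subseteq> C}"
    then show "x \<in> C \<inter> outer_rows n" using brauer_union_subset[OF d] by blast
  qed
  have "2 * card {e \<in> d. e \<subseteq> C} = card (\<Union>{e \<in> d. e \<subseteq> C})"
  proof (rule card_partition)
    show "finite {e \<in> d. e \<subseteq> C}" using finite_brauer_diagram[OF d] by simp
    show "finite (\<Union>{e \<in> d. e \<subseteq> C})" unfolding U[symmetric] by simp
    show "card c = 2" if "c \<in> {e \<in> d. e \<subseteq> C}" for c using that brauer_diagramD(2)[OF d] by blast
    show "c \<inter> c' = {}" if "c \<in> {e \<in> d. e \<subseteq> C}" "c' \<in> {e \<in> d. e \<subseteq> C}" "c \<noteq> c'" for c c'
      using that brauer_diagramD(3)[OF d] by blast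
  qed
  then show ?thesis using U by simp
qed

text \<open>Let \<open>C\<close> be a component of the stack that meets the outer rows, with \<open>c\<close> nodes in the middle row and \<open>e\<close>
  nodes in the outer rows. Counting its edges from both diagrams separately gives \<open>(e + 2 c) / 2\<close>, since
  every middle node lies on one edge of each and every outer node on one edge. A connected graph on \<open>e + c\<close> nodes has at least
  \<open>e + c - 1\<close> edges, so \<open>e \<le> 2\<close>; and \<open>e\<close> is even and nonzero.\<close>

lemma compose_brauer:
  assumes d1: "d1 \<in> brauer_diagrams n" and d2: "d2 \<in> brauer_diagrams n"
  shows "compose_diagrams n d1 d2 \<in> brauer_diagrams n"
proof -
  note sub = brauer_union_subset[OF d1] brauer_union_subset[OF d2]
  let ?E = "stack_edges d1 d2"
  have part: "partition_on (outer_rows n) (compose_diagrams n d1 d2)"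
    unfolding compose_eq_quotient[OF sub] by (rule partition_on_quotient[OF equiv_composite_rel])
  have "card e = 2" if prem: "e \<in> compose_diagrams n d1 d2" for e
  proof -
    obtain x where x: "x \<in> outer_rows n" "e = composite_rel n d1 d2 `` {x}"
      using prem unfolding compose_eq_quotient[OF sub] by (auto simp: quotient_def)
    define C where "C = conn ?E `` {spread x}"
    have C_sub: "C \<subseteq> node_row n 0 \<union> node_row n 1 \<union> node_row n 2"
      using stack_class_subset[OF sub, of "spread x"] spread_outer_iff[of x n] x(1)
      unfolding C_def by blast
    have finC: "finite C" using finite_subset[OF C_sub] by simp
    have closed: "f \<subseteq> C" if prem: "f \<in> ?E" "f \<inter> C \<noteq> {}" for f
    proof
      fix y assume y: "y \<in> f"
      obtain z where z: "z \<in> f" "(spread x, z) \<in> conn ?E" using prem(2) by (auto simp: C_def)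
      have "(z, y) \<in> conn ?E" using prem(1) z(1) y by (rule conn_edge)
      then show "y \<in> C" using conn_trans[OF z(2)] by (simp add: C_def)
    qed
    \<comment> \<open>the nodes of the lower diagram, in its own numbering of rows, that lie on \<open>C\<close>\<close>
    define C' where "C' = {y. shift y \<in> C}"
    have a: "card (C \<inter> outer_rows n) = 2 * card {f \<in> d1. f \<subseteq> C}"
      by (rule card_edge_closed[OF d1]) (rule closed, auto simp: stack_edges_eq)
    have "card (C' \<inter> outer_rows n) = 2 * card {f \<in> d2. f \<subseteq> C'}"
    proof (rule card_edge_closed[OF d2])
      fix f assume f: "f \<in> d2" "f \<inter> C' \<noteq> {}"
      have "shift ` f \<subseteq> C" by (rule closed) (use f in \<open>auto simp: stack_edges_eq C'_def\<close>)
      then show "f \<subseteq> C'" by (auto simp: C'_def)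
    qed
    moreover have "C \<inter> (node_row n 1 \<union> node_row n 2) = shift ` (C' \<inter> outer_rows n)"
      unfolding shift_outer(1)[symmetric] C'_def by auto
    ultimately have b: "card (C \<inter> (node_row n 1 \<union> node_row n 2)) = 2 * card {f \<in> d2. f \<subseteq> C'}"
      by (simp add: card_image inj_on_subset[OF inj_shift])
    have E: "{f \<in> ?E. f \<subseteq> C} = {f \<in> d1. f \<subseteq> C} \<union> (`) shift ` {f \<in> d2. f \<subseteq> C'}"
      unfolding stack_edges_eq C'_def by blast
    have two: "card f = 2" if prem: "f \<in> ?E" for f
    proof (cases "f \<in> d1")
      case True
      then show ?thesis by (rule brauer_diagramD(2)[OF d1])
    next
      case False
      then obtain g where g: "g \<in> d2" "f = shift ` g" using prem unfolding stack_edges_eq by blast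
      have "card f = card g"
        unfolding g(2) by (rule card_image[OF inj_on_subset[OF inj_shift subset_UNIV]])
      then show ?thesis using brauer_diagramD(2)[OF d2 g(1)] by simp
    qed
    have "card C \<le> card {f \<in> ?E. f \<subseteq> C} + 1"
      using card_class_le_edges[OF finC[unfolded C_def] two] unfolding C_def .
    also have "card {f \<in> ?E. f \<subseteq> C} \<le> card {f \<in> d1. f \<subseteq> C} + card {f \<in> d2. f \<subseteq> C'}"
      unfolding E using finite_brauer_diagram[OF d2]
      by (intro order_trans[OF card_Un_le add_left_mono[OF card_image_le]]) simp
    finally have c: "card C \<le> card {f \<in> d1. f \<subseteq> C} + card {f \<in> d2. f \<subseteq> C'} + 1" by simp
    let ?c = "\<lambda>r. card (C \<inter> node_row n r)"
    have dis: "(C \<inter> node_row n r) \<inter> (C \<inter> node_row n s) = {}" if "r \<noteq> s" for r s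
      using node_row_disjoint[OF that] by blast
    have 1: "card (C \<inter> outer_rows n) = ?c 0 + ?c 1"
      unfolding Int_Un_distrib using finC dis by (intro card_Un_disjoint) auto
    have 2: "card (C \<inter> (node_row n 1 \<union> node_row n 2)) = ?c 1 + ?c 2"
      unfolding Int_Un_distrib using finC dis by (intro card_Un_disjoint) auto
    have 02: "card (C \<inter> (node_row n 0 \<union> node_row n 2)) = ?c 0 + ?c 2"
      unfolding Int_Un_distrib using finC dis by (intro card_Un_disjoint) auto
    have "C = (C \<inter> (node_row n 0 \<union> node_row n 2)) \<union> (C \<inter> node_row n 1)" using C_sub by blast
    moreover have "(C \<inter> (node_row n 0 \<union> node_row n 2)) \<inter> (C \<inter> node_row n 1) = {}"
      by (auto simp: node_row_def)
    ultimately have "card C = card (C \<inter> (node_row n 0 \<union> node_row n 2)) + ?c 1"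
      using card_Un_disjoint[of "C \<inter> (node_row n 0 \<union> node_row n 2)" "C \<inter> node_row n 1"] finC
      by (metis finite_Int)
    then have 3: "card C = ?c 0 + ?c 2 + ?c 1" using 02 by simp
    have spread_e: "spread ` e = C \<inter> (node_row n 0 \<union> node_row n 2)"
      unfolding x(2) spread_outer[symmetric] C_def using x(1) by (auto simp: composite_rel_def)
    have "card e = card (spread ` e)" by (simp add: card_image inj_on_subset[OF inj_spread])
    then have e_card: "card e = ?c 0 + ?c 2" using spread_e 02 by simp
    have "x \<in> e" using x by (simp add: composite_rel_def)
    moreover have "finite e"
      using finite_imageD[of spread e] spread_e finC inj_on_subset[OF inj_spread] by simp
    ultimately have "card e \<noteq> 0" by auto
    moreover have sum: "card e + 2 * ?c 1 = 2 * (card {f \<in> d1. f \<subseteq> C} + card {f \<in> d2. f \<subseteq> C'})"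
    proof -
      have "card e + 2 * ?c 1 = card (C \<inter> outer_rows n) + card (C \<inter> (node_row n 1 \<union> node_row n 2))"
        unfolding e_card 1 2 by simp
      then show ?thesis unfolding a b by simp
    qed
    moreover have "card C = card e + ?c 1" unfolding e_card by (rule 3)
    moreover have "e' = 2" if "e' \<noteq> 0" "e' + 2 * c' = 2 * (a' + b')" "m = e' + c'" "m \<le> a' + b' + 1"
      for e' c' a' b' m :: nat using that by presburger
    ultimately show ?thesis using c by blast
  qed
  then show ?thesis using part unfolding brauer_diagrams_def by simp
qed

text \<open>As the composite is a matching, one connected pair of outer nodes is already a complete edge.\<close>

lemma compose_edgeI:
  assumes d1: "d1 \<in> brauer_diagrams n" and d2: "d2 \<in> brauer_diagrams n"
    and xy: "x \<in> outer_rows n" "y \<in> outer_rows n" "x \<noteq> y"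
    and c: "(spread x, spread y) \<in> conn (stack_edges d1 d2)"
  shows "{x, y} \<in> compose_diagrams n d1 d2"
proof -
  let ?e = "composite_rel n d1 d2 `` {x}"
  have e: "?e \<in> compose_diagrams n d1 d2"
    unfolding compose_eq_quotient[OF brauer_union_subset[OF d1] brauer_union_subset[OF d2]]
    using xy(1) by (auto simp: quotient_def)
  have "x \<in> ?e" "y \<in> ?e" using xy c by (auto simp: composite_rel_def)
  then have "?e = {x, y}"
    using pair_eqI[OF brauer_diagramD(2)[OF compose_brauer[OF d1 d2] e]] xy(3) by blast
  then show ?thesis using e by simp
qed

lemma compose_edge_conn:
  assumes d1: "d1 \<in> brauer_diagrams n" and d2: "d2 \<in> brauer_diagrams n"
    and e: "e \<in> compose_diagrams n d1 d2" "x \<in> e" "y \<in> e"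
  shows "(spread x, spread y) \<in> conn (stack_edges d1 d2)"
proof -
  have "(x, y) \<in> composite_rel n d1 d2"
    using in_quotient_imp_in_rel[OF equiv_composite_rel, of e n d1 d2 x y] e
    unfolding compose_eq_quotient[OF brauer_union_subset[OF d1] brauer_union_subset[OF d2]] by simp
  then show ?thesis by (simp add: composite_rel_def)
qed

section \<open>Symmetry\<close>

lemma reflect_node_apply [simp]: "reflect_node n (r, j) = (r, 2 * n + 1 - j)"
  by (simp add: reflect_node_def)

lemma reflect_outer: "x \<in> outer_rows n \<Longrightarrow> reflect_node n x \<in> outer_rows n"
  by (auto simp: node_row_def)

lemma reflect_reflect: "x \<in> outer_rows n \<Longrightarrow> reflect_node n (reflect_node n x) = x"
  by (auto simp: node_row_def)

lemma symmetric_diagramI: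
  assumes d: "d \<in> brauer_diagrams n" and "\<And>e. e \<in> d \<Longrightarrow> reflect_node n ` e \<in> d"
  shows "d \<in> symmetric_diagrams n"
proof -
  have "e \<in> (\<lambda>e. reflect_node n ` e) ` d" if e: "e \<in> d" for e
  proof -
    have "reflect_node n ` reflect_node n ` e = (\<lambda>x. x) ` e"
      unfolding image_image using e brauer_union_subset[OF d] reflect_reflect[of _ n]
      by (intro image_cong) auto
    then show ?thesis using assms(2)[OF e] by (metis image_eqI image_ident)
  qed
  then show ?thesis unfolding symmetric_diagrams_def using assms by auto
qed

lemma symmetric_diagramD:
  assumes "d \<in> symmetric_diagrams n"
  shows "d \<in> brauer_diagrams n" "e \<in> d \<Longrightarrow> reflect_node n ` e \<in> d"
  using assms unfolding symmetric_diagrams_def by auto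

lemma finite_symmetric_diagrams: "finite (symmetric_diagrams n)"
  by (rule finite_subset[OF _ finite_brauer_diagrams[of n]]) (auto simp: symmetric_diagrams_def)

lemma compose_symmetric:
  assumes d1: "d1 \<in> symmetric_diagrams n" and d2: "d2 \<in> symmetric_diagrams n"
  shows "compose_diagrams n d1 d2 \<in> symmetric_diagrams n"
proof (rule symmetric_diagramI)
  note B = symmetric_diagramD(1)[OF d1] symmetric_diagramD(1)[OF d2]
  show c: "compose_diagrams n d1 d2 \<in> brauer_diagrams n" by (rule compose_brauer[OF B])
  fix e assume e: "e \<in> compose_diagrams n d1 d2"
  obtain x y where xy: "e = {x, y}" "x \<noteq> y"
    using brauer_diagramD(2)[OF c e] by (auto simp: card_2_iff)
  have out: "x \<in> outer_rows n" "y \<in> outer_rows n" using brauer_union_subset[OF c] e xy by auto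
  have st: "(`) (reflect_node n) ` stack_edges d1 d2 \<subseteq> stack_edges d1 d2"
  proof -
    have "reflect_node n ` shift ` f = shift ` reflect_node n ` f" for f
      unfolding image_image by (intro image_cong) (auto simp: shift_def)
    then have "reflect_node n ` shift ` f \<in> (`) shift ` d2" if "f \<in> d2" for f
      using symmetric_diagramD(2)[OF d2 that] by simp
    then show ?thesis using symmetric_diagramD(2)[OF d1] unfolding stack_edges_eq by blast
  qed
  have "(spread x, spread y) \<in> conn (stack_edges d1 d2)"
    using compose_edge_conn[OF B e, of x y] xy(1) by simp
  then have "(reflect_node n (spread x), reflect_node n (spread y)) \<in> conn (stack_edges d1 d2)"
    by (rule conn_mono[OF st conn_image])
  moreover have "reflect_node n (spread z) = spread (reflect_node n z)" for z
    by (cases z) (simp add: spread_def)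
  ultimately have "(spread (reflect_node n x), spread (reflect_node n y)) \<in> conn (stack_edges d1 d2)"
    by simp
  moreover have "reflect_node n x \<noteq> reflect_node n y" using xy(2) out reflect_reflect by metis
  ultimately show "reflect_node n ` e \<in> compose_diagrams n d1 d2"
    using compose_edgeI[OF B reflect_outer[OF out(1)] reflect_outer[OF out(2)]] xy by simp
qed

section \<open>Arcs and through strands\<close>

text \<open>The edges of \<open>d\<close> with both ends in row \<open>r\<close>, as sets of positions, so that arcs of different rows
  can be compared.\<close>

definition arcs :: "diagram \<Rightarrow> nat \<Rightarrow> nat set set" where
  "arcs d r = {a. Pair r ` a \<in> d}"

lemma inj_Pair: "inj (Pair r)" by (simp add: inj_def)

lemma Pair_image_eq_iff: "Pair r ` a = Pair r ` b \<longleftrightarrow> a = b"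
  by (simp add: inj_image_eq_iff[OF inj_Pair])

lemma node_row_Pair: "node_row n r = Pair r ` {1..2 * n}"
  by (auto simp: node_row_def)

lemma row_mem_iff: "(r, j) \<in> node_row n s \<longleftrightarrow> r = s \<and> j \<in> {1..2 * n}"
  by (auto simp: node_row_def)

lemma arcs_subset:
  assumes "d \<in> brauer_diagrams n" "a \<in> arcs d r"
  shows "a \<subseteq> {1..2 * n}" "card a = 2" "a \<noteq> {}"
proof -
  have e: "Pair r ` a \<in> d" using assms(2) by (simp add: arcs_def)
  have "Pair r ` a \<subseteq> outer_rows n" using brauer_union_subset[OF assms(1)] e by blast
  then show "a \<subseteq> {1..2 * n}" by (auto simp: node_row_def)
  have "card (Pair r ` a) = card a" by (rule card_image[OF inj_on_subset[OF inj_Pair subset_UNIV]])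
  then show "card a = 2" using brauer_diagramD(2)[OF assms(1) e] by simp
  then show "a \<noteq> {}" by auto
qed

lemma finite_arcs:
  assumes "d \<in> brauer_diagrams n"
  shows "finite (arcs d r)"
proof (rule finite_subset)
  show "arcs d r \<subseteq> Pow {1..2 * n}" using arcs_subset(1)[OF assms] by blast
qed simp

lemma arcs_unique:
  assumes "d \<in> brauer_diagrams n" "a \<in> arcs d r" "b \<in> arcs d r" "i \<in> a" "i \<in> b"
  shows "a = b"
proof -
  have "Pair r ` a = Pair r ` b"
    by (rule brauer_diagramD(3)[OF assms(1), of _ _ "(r, i)"]) (use assms(2-5) in \<open>auto simp: arcs_def\<close>)
  then show ?thesis by (simp add: Pair_image_eq_iff)
qed

lemma arc_edge_iff: "{i, j} \<in> arcs d r \<longleftrightarrow> {(r, i), (r, j)} \<in> d"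
  by (simp add: arcs_def)

text \<open>A node on no arc of its row lies on an edge to the opposite row, and the other end of this through strand
  is on no arc either, since each node has only one edge.\<close>

lemma through_edge:
  assumes d: "d \<in> brauer_diagrams n" and r: "r = 0 \<or> r = 1" and i: "i \<in> {1..2 * n}" "i \<notin> \<Union>(arcs d r)"
  obtains j where "{(r, i), (1 - r, j)} \<in> d" "j \<in> {1..2 * n}" "j \<notin> \<Union>(arcs d (1 - r))"
proof -
  have "(r, i) \<in> outer_rows n" using r i(1) by (auto simp: row_mem_iff)
  then obtain y where y: "y \<noteq> (r, i)" "{(r, i), y} \<in> d" "y \<in> outer_rows n"
    by (rule brauer_partner[OF d])
  obtain s j where sj: "y = (s, j)" by (cases y)
  have s: "s = 0 \<or> s = 1" "j \<in> {1..2 * n}" using y(3) sj by (auto simp: row_mem_iff)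
  have "s \<noteq> r"
  proof
    assume "s = r"
    then have "{i, j} \<in> arcs d r" using y(2) sj by (simp add: arc_edge_iff)
    then show False using i(2) by blast
  qed
  then have s': "s = 1 - r" using s(1) r by auto
  have "j \<notin> \<Union>(arcs d (1 - r))"
  proof
    assume "j \<in> \<Union>(arcs d (1 - r))"
    then obtain a where a: "a \<in> arcs d (1 - r)" "j \<in> a" by blast
    then have "Pair (1 - r) ` a \<in> d" by (simp add: arcs_def)
    then have "Pair (1 - r) ` a = {(r, i), y}"
      using brauer_diagramD(3)[OF d _ y(2), of "Pair (1 - r) ` a" y] a(2) sj s' by blast
    then have "(r, i) \<in> Pair (1 - r) ` a" by blast
    then show False using r by auto
  qed
  then show ?thesis using that[of j] y(2) sj s' s(2) by simp
qed

lemma through_edge_top: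
  assumes d: "d \<in> brauer_diagrams n" and i: "i \<in> {1..2 * n}" "i \<notin> \<Union>(arcs d 0)"
  obtains j where "{(0, i), (1, j)} \<in> d" "j \<in> {1..2 * n}" "j \<notin> \<Union>(arcs d 1)"
  using through_edge[OF d disjI1[OF refl] i] unfolding diff_zero by blast

lemma through_edge_bottom:
  assumes d: "d \<in> brauer_diagrams n" and i: "i \<in> {1..2 * n}" "i \<notin> \<Union>(arcs d 1)"
  obtains j where "{(1, i), (0, j)} \<in> d" "j \<in> {1..2 * n}" "j \<notin> \<Union>(arcs d 0)"
  using through_edge[OF d disjI2[OF refl] i] unfolding diff_self_eq_0 by blast

text \<open>Both rows have the same number of nodes, and each through strand uses one node of either row. Formally,
  the contributions of an edge to both rows differ by twice the difference of its contributions to the arcs.\<close>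

lemma card_arcs_eq:
  assumes d: "d \<in> brauer_diagrams n"
  shows "card (arcs d 0) = card (arcs d 1)"
proof -
  have fin: "finite d" by (rule finite_brauer_diagram[OF d])
  have arcs: "card (arcs d r) = card {e \<in> d. e \<subseteq> node_row n r}" if "r = 0 \<or> r = 1" for r
  proof -
    have "(`) (Pair r) ` arcs d r = {e \<in> d. e \<subseteq> node_row n r}"
    proof (intro equalityI subsetI)
      fix e assume "e \<in> (`) (Pair r) ` arcs d r"
      then obtain a where a: "e = Pair r ` a" "a \<in> arcs d r" by blast
      then show "e \<in> {e \<in> d. e \<subseteq> node_row n r}"
        using arcs_subset(1)[OF d a(2)] by (auto simp: arcs_def node_row_Pair)
    next
      fix e assume e: "e \<in> {e \<in> d. e \<subseteq> node_row n r}"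
      then have "e \<subseteq> Pair r ` {1..2 * n}" by (simp add: node_row_Pair)
      then obtain a where "e = Pair r ` a" by (auto simp: subset_image_iff)
      then show "e \<in> (`) (Pair r) ` arcs d r" using e by (auto simp: arcs_def)
    qed
    moreover have "inj_on ((`) (Pair r)) (arcs d r)" by (rule inj_onI) (simp add: Pair_image_eq_iff)
    ultimately show ?thesis using card_image by metis
  qed
  have row: "(\<Sum>e\<in>d. card (e \<inter> node_row n r)) = 2 * n" if "r = 0 \<or> r = 1" for r
  proof -
    have "node_row n r \<subseteq> \<Union>d" using brauer_diagramD(1)[OF d] that by auto
    then have "node_row n r = (\<Union>e\<in>d. e \<inter> node_row n r)" by blast
    then have "card (node_row n r) = card (\<Union>e\<in>d. e \<inter> node_row n r)" by simp
    also have "\<dots> = (\<Sum>e\<in>d. card (e \<inter> node_row n r))"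
    proof (rule card_UN_disjoint[OF fin])
      show "\<forall>e\<in>d. finite (e \<inter> node_row n r)" by simp
      show "\<forall>e\<in>d. \<forall>f\<in>d. e \<noteq> f \<longrightarrow> (e \<inter> node_row n r) \<inter> (f \<inter> node_row n r) = {}"
        using brauer_diagramD(3)[OF d] by blast
    qed
    finally show ?thesis by (simp add: node_row_def card_cartesian_product)
  qed
  have e2: "card (e \<inter> node_row n 0) + 2 * (if e \<subseteq> node_row n 1 then 1 else 0) =
      card (e \<inter> node_row n 1) + 2 * (if e \<subseteq> node_row n 0 then 1 else 0)" if e: "e \<in> d" for e
  proof -
    obtain x y where xy: "e = {x, y}" "x \<noteq> y" using brauer_diagramD(2)[OF d e] by (auto simp: card_2_iff)
    have "x \<in> outer_rows n" "y \<in> outer_rows n" using brauer_union_subset[OF d] e xy by auto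
    then show ?thesis using xy(2) unfolding xy(1)
      by (elim outer_rowsE) (simp_all add: row_mem_iff Int_insert_left)
  qed
  have "(\<Sum>e\<in>d. card (e \<inter> node_row n 0) + 2 * (if e \<subseteq> node_row n 1 then 1 else 0)) =
      (\<Sum>e\<in>d. card (e \<inter> node_row n 1) + 2 * (if e \<subseteq> node_row n 0 then 1 else 0))"
    by (rule sum.cong[OF refl e2])
  moreover have "(\<Sum>e\<in>d. (if e \<subseteq> node_row n r then 1 else 0)) = card {e \<in> d. e \<subseteq> node_row n r}" for r
    using fin by (simp add: sum.If_cases Int_def)
  ultimately have "card {e \<in> d. e \<subseteq> node_row n 1} = card {e \<in> d. e \<subseteq> node_row n 0}"
    by (simp only: sum.distrib sum_distrib_left[symmetric] row) (simp add: row)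
  then show ?thesis using arcs[of 0] arcs[of 1] by simp
qed

text \<open>Arcs in the outer rows survive composition. This is why through strands cannot be created.\<close>

lemma arcs_compose_top:
  assumes d1: "d1 \<in> brauer_diagrams n" and d2: "d2 \<in> brauer_diagrams n"
  shows "arcs d1 0 \<subseteq> arcs (compose_diagrams n d1 d2) 0"
proof
  fix a assume a: "a \<in> arcs d1 0"
  obtain i j where ij: "a = {i, j}" "i \<noteq> j" using arcs_subset(2)[OF d1 a] by (auto simp: card_2_iff)
  have e: "{(0, i), (0, j)} \<in> d1" using a ij(1) arc_edge_iff by simp
  have "i \<in> {1..2 * n}" "j \<in> {1..2 * n}" using arcs_subset(1)[OF d1 a] ij(1) by auto
  then have o: "(0, i) \<in> outer_rows n" "(0, j) \<in> outer_rows n" by (simp_all add: row_mem_iff)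
  have "(spread (0, i), spread (0, j)) \<in> conn (stack_edges d1 d2)"
    by (rule conn_edge[of "{(0, i), (0, j)}"]) (use e in \<open>simp_all add: stack_edges_eq spread_def\<close>)
  then have "{(0, i), (0, j)} \<in> compose_diagrams n d1 d2"
    using compose_edgeI[OF d1 d2 o] ij(2) by simp
  then show "a \<in> arcs (compose_diagrams n d1 d2) 0" using ij(1) arc_edge_iff by simp
qed

lemma shift_edge: "{x, y} \<in> d2 \<Longrightarrow> (shift x, shift y) \<in> conn (stack_edges d1 d2)"
  unfolding stack_edges_eq by (rule conn_edge[OF UnI2[OF imageI]]) auto

lemma upper_edge: "{x, y} \<in> d1 \<Longrightarrow> (x, y) \<in> conn (stack_edges d1 d2)"
  by (rule conn_edge[of "{x, y}"]) (auto simp: stack_edges_eq)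

lemma arcs_compose_bottom:
  assumes d1: "d1 \<in> brauer_diagrams n" and d2: "d2 \<in> brauer_diagrams n"
  shows "arcs d2 1 \<subseteq> arcs (compose_diagrams n d1 d2) 1"
proof
  fix a assume a: "a \<in> arcs d2 1"
  obtain i j where ij: "a = {i, j}" "i \<noteq> j" using arcs_subset(2)[OF d2 a] by (auto simp: card_2_iff)
  have e: "{(1, i), (1, j)} \<in> d2" using a ij(1) arc_edge_iff by simp
  have "i \<in> {1..2 * n}" "j \<in> {1..2 * n}" using arcs_subset(1)[OF d2 a] ij(1) by auto
  then have o: "(1, i) \<in> outer_rows n" "(1, j) \<in> outer_rows n" by (simp_all add: row_mem_iff)
  have "(spread (1, i), spread (1, j)) \<in> conn (stack_edges d1 d2)"
    using shift_edge[OF e, of d1] by (simp add: shift_def spread_def numeral_2_eq_2)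
  then have "{(1, i), (1, j)} \<in> compose_diagrams n d1 d2"
    using compose_edgeI[OF d1 d2 o] ij(2) by simp
  then show "a \<in> arcs (compose_diagrams n d1 d2) 1" using ij(1) arc_edge_iff by simp
qed

text \<open>If the arcs in the middle row agree, then the through strands of both diagrams meet end to end, and no
  through strand is lost.\<close>

lemma arcs_compose_matching:
  assumes d1: "d1 \<in> brauer_diagrams n" and d2: "d2 \<in> brauer_diagrams n" and m: "arcs d1 1 = arcs d2 0"
  shows "arcs (compose_diagrams n d1 d2) 0 = arcs d1 0" "arcs (compose_diagrams n d1 d2) 1 = arcs d2 1"
proof -
  let ?c = "compose_diagrams n d1 d2"
  note c = compose_brauer[OF d1 d2]
  have "arcs ?c 0 \<subseteq> arcs d1 0"
  proof
    fix a assume a: "a \<in> arcs ?c 0"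
    obtain i where i: "i \<in> a" using arcs_subset(3)[OF c a] by blast
    have iN: "i \<in> {1..2 * n}" using arcs_subset(1)[OF c a] i by blast
    show "a \<in> arcs d1 0"
    proof (cases "i \<in> \<Union>(arcs d1 0)")
      case True
      then obtain b where b: "b \<in> arcs d1 0" "i \<in> b" by blast
      then have "b \<in> arcs ?c 0" using arcs_compose_top[OF d1 d2] by blast
      then show ?thesis using arcs_unique[OF c a _ i b(2)] b(1) by simp
    next
      case False
      obtain j where j: "{(0, i), (1, j)} \<in> d1" "j \<in> {1..2 * n}" "j \<notin> \<Union>(arcs d1 1)"
        using through_edge_top[OF d1 iN False] .
      obtain k where k: "{(0, j), (1, k)} \<in> d2" "k \<in> {1..2 * n}"
        using through_edge_top[OF d2 j(2)] j(3) unfolding m by blast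
      have "((0, i), (1, j)) \<in> conn (stack_edges d1 d2)" by (rule upper_edge[OF j(1)])
      moreover have "((1, j), (2, k)) \<in> conn (stack_edges d1 d2)"
        using shift_edge[OF k(1), of d1] by (simp add: shift_def numeral_2_eq_2)
      ultimately have "((0, i), (2, k)) \<in> conn (stack_edges d1 d2)" by (rule conn_trans)
      then have ik: "(spread (0, i), spread (1, k)) \<in> conn (stack_edges d1 d2)"
        by (simp add: spread_def)
      have o: "(0, i) \<in> outer_rows n" "(1, k) \<in> outer_rows n"
        using iN k(2) by (simp_all add: row_mem_iff)
      have e1: "{(0, i), (1, k)} \<in> ?c" by (rule compose_edgeI[OF d1 d2 o _ ik]) simp
      have e2: "Pair 0 ` a \<in> ?c" using a unfolding arcs_def by (rule CollectD)
      have "{(0 :: nat, i), (1, k)} = Pair 0 ` a"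
        by (rule brauer_diagramD(3)[OF c e1 e2 insertI1 imageI[OF i, of "Pair 0"]])
      moreover have "(1 :: nat, k) \<notin> Pair 0 ` a" by (simp add: image_iff)
      ultimately show ?thesis by (metis insertI1 insert_commute)
    qed
  qed
  then show top: "arcs ?c 0 = arcs d1 0" using arcs_compose_top[OF d1 d2] by blast
  have "card (arcs ?c 1) = card (arcs d2 1)"
    using card_arcs_eq[OF c] card_arcs_eq[OF d1] card_arcs_eq[OF d2] top m by simp
  then show "arcs ?c 1 = arcs d2 1"
    using card_subset_eq[OF finite_arcs[OF c] arcs_compose_bottom[OF d1 d2]] by simp
qed

text \<open>Each arc of the middle row occurs in both diagrams and closes up to a loop with its own copy, while a component
  through a node on no arc leaves the middle row.\<close>

lemma closed_loops_matching:
  assumes d1: "d1 \<in> brauer_diagrams n" and d2: "d2 \<in> brauer_diagrams n" and m: "arcs d1 1 = arcs d2 0"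
  shows "closed_loops n d1 d2 = card (arcs d1 1)"
proof -
  let ?E = "stack_edges d1 d2"
  have cls: "conn ?E `` {(1, i)} = Pair 1 ` a" if a: "a \<in> arcs d1 1" "i \<in> a" for a i
  proof (intro equalityI subsetI)
    fix y assume "y \<in> conn ?E `` {(1, i)}"
    then have "((1, i), y) \<in> conn ?E" by simp
    then show "y \<in> Pair 1 ` a"
    proof (rule conn_closed)
      show "(1, i) \<in> Pair 1 ` a" using a by simp
      fix e assume e: "e \<in> ?E" "e \<inter> Pair 1 ` a \<noteq> {}"
      have top: "Pair 1 ` a \<in> d1" and bot: "Pair 0 ` a \<in> d2" using a(1) m by (auto simp: arcs_def)
      show "e \<subseteq> Pair 1 ` a"
      proof (cases "e \<in> d1")
        case True
        obtain x where "x \<in> e" "x \<in> Pair 1 ` a" using e(2) by blast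
        then have "e = Pair 1 ` a" using brauer_diagramD(3)[OF d1 True top] by blast
        then show ?thesis by simp
      next
        case False
        then obtain f where f: "f \<in> d2" "e = shift ` f" using e(1) unfolding stack_edges_eq by blast
        have s: "Pair 1 ` a = shift ` Pair 0 ` a" by (simp add: image_image shift_def)
        obtain x where x: "x \<in> e" "x \<in> Pair 1 ` a" using e(2) by blast
        obtain y where y: "y \<in> f" "x = shift y" using x(1) f(2) by blast
        obtain z where z: "z \<in> Pair 0 ` a" "x = shift z" using x(2) unfolding s by blast
        have "y = z" using y(2) z(2) injD[OF inj_shift] by metis
        then have "f = Pair 0 ` a" using brauer_diagramD(3)[OF d2 f(1) bot y(1)] z(1) by simp
        then show ?thesis using s f(2) by simp
      qed
    qed
  next
    fix y :: node
    assume y: "y \<in> Pair 1 ` a"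
    have "((1, i), y) \<in> conn ?E"
      by (rule conn_edge[of "Pair 1 ` a"]) (use a y in \<open>auto simp: arcs_def stack_edges_eq\<close>)
    then show "y \<in> conn ?E `` {(1, i)}" by simp
  qed
  have "closed_classes ?E (node_row n 1) = (`) (Pair 1) ` arcs d1 1"
  proof (intro equalityI subsetI)
    fix C assume "C \<in> closed_classes ?E (node_row n 1)"
    then obtain z where z: "z \<in> node_row n 1" "C = conn ?E `` {z}" "C \<subseteq> node_row n 1"
      unfolding closed_classes_def by blast
    then obtain i where i: "z = (1, i)" "i \<in> {1..2 * n}" by (auto simp: node_row_def)
    have "i \<in> \<Union>(arcs d1 1)"
    proof (rule ccontr)
      assume n: "i \<notin> \<Union>(arcs d1 1)"
      obtain j where j: "{(1, i), (0, j)} \<in> d1" using through_edge_bottom[OF d1 i(2) n] by blast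
      have "(0, j) \<in> C" using upper_edge[OF j] z(2) i(1) by simp
      then show False using z(3) by (auto simp: node_row_def)
    qed
    then obtain a where a: "a \<in> arcs d1 1" "i \<in> a" by blast
    show "C \<in> (`) (Pair 1) ` arcs d1 1"
      unfolding z(2) i(1) cls[OF a] by (rule imageI[OF a(1)])
  next
    fix C :: "node set"
    assume "C \<in> (`) (Pair 1) ` arcs d1 1"
    then obtain a where a: "a \<in> arcs d1 1" "C = Pair 1 ` a" by blast
    obtain i where i: "i \<in> a" using arcs_subset(3)[OF d1 a(1)] by blast
    have sub: "Pair 1 ` a \<subseteq> node_row n 1" using arcs_subset(1)[OF d1 a(1)] by (auto simp: node_row_def)
    then have "(1, i) \<in> node_row n 1" using i by blast
    then show "C \<in> closed_classes ?E (node_row n 1)"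
      unfolding closed_classes_def a(2) cls[OF a(1) i, symmetric]
      using sub[folded cls[OF a(1) i]] by blast
  qed
  then have "closed_loops n d1 d2 = card ((`) (Pair (1::nat)) ` arcs d1 1)" by (simp only: closed_loops_eq)
  also have "\<dots> = card (arcs d1 1)"
    by (rule card_image) (rule inj_onI, simp add: Pair_image_eq_iff)
  finally show ?thesis .
qed

lemma closed_loops_eq_zero:
  assumes d1: "d1 \<in> brauer_diagrams n" and d2: "d2 \<in> brauer_diagrams n"
    and none: "arcs d1 1 = {} \<or> arcs d2 0 = {}"
  shows "closed_loops n d1 d2 = 0"
proof -
  let ?E = "stack_edges d1 d2"
  have "\<exists>y. y \<notin> node_row n 1 \<and> (z, y) \<in> conn ?E" if z: "z \<in> node_row n 1" for z
  proof -
    obtain i where i: "z = (1, i)" "i \<in> {1..2 * n}" using z by (auto simp: node_row_def)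
    from none show ?thesis
    proof
      assume "arcs d1 1 = {}"
      then have "i \<notin> \<Union>(arcs d1 1)" by simp
      then obtain j where j: "{(1, i), (0, j)} \<in> d1" by (rule through_edge_bottom[OF d1 i(2)])
      have "((1, i), (0, j)) \<in> conn ?E" by (rule upper_edge[OF j])
      then show ?thesis using i(1) by (intro exI[of _ "(0, j)"]) (simp add: row_mem_iff)
    next
      assume "arcs d2 0 = {}"
      then have "i \<notin> \<Union>(arcs d2 0)" by simp
      then obtain j where j: "{(0, i), (1, j)} \<in> d2" by (rule through_edge_top[OF d2 i(2)])
      have "((1, i), (2, j)) \<in> conn ?E"
        using shift_edge[OF j, of d1] by (simp add: shift_def numeral_2_eq_2)
      then show ?thesis using i(1) by (intro exI[of _ "(2, j)"]) (simp add: row_mem_iff)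
    qed
  qed
  then have "closed_classes ?E (node_row n 1) = {}" unfolding closed_classes_def by blast
  then show ?thesis unfolding closed_loops_eq by (simp only: card.empty)
qed

section \<open>Projections\<close>

text \<open>The sets of arcs that occur in a row of a symmetric diagram: pairwise disjoint pairs of positions, closed under the
  reflection.\<close>

definition arc_config :: "nat \<Rightarrow> nat set set \<Rightarrow> bool" where
  "arc_config n b \<longleftrightarrow> (\<forall>a\<in>b. a \<subseteq> {1..2 * n} \<and> card a = 2 \<and> (\<lambda>j. 2 * n + 1 - j) ` a \<in> b) \<and>
     (\<forall>a\<in>b. \<forall>a'\<in>b. a \<inter> a' \<noteq> {} \<longrightarrow> a = a')"

lemma arc_configD:
  assumes "arc_config n b" "a \<in> b"
  shows "a \<subseteq> {1..2 * n}" "card a = 2" "(\<lambda>j. 2 * n + 1 - j) ` a \<in> b"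
proof -
  have "a \<subseteq> {1..2 * n} \<and> card a = 2 \<and> (\<lambda>j. 2 * n + 1 - j) ` a \<in> b"
    by (rule bspec[OF conjunct1[OF assms(1)[unfolded arc_config_def]] assms(2)])
  then show "a \<subseteq> {1..2 * n}" "card a = 2" "(\<lambda>j. 2 * n + 1 - j) ` a \<in> b" by simp_all
qed

lemma arc_config_unique:
  assumes "arc_config n b" "a \<in> b" "a' \<in> b" "i \<in> a" "i \<in> a'"
  shows "a = a'"
proof -
  have "a \<inter> a' \<noteq> {} \<longrightarrow> a = a'"
    by (rule bspec[OF bspec[OF conjunct2[OF assms(1)[unfolded arc_config_def]] assms(2)] assms(3)])
  then show ?thesis using assms(4,5) by blast
qed

lemma arc_config_arcs:
  assumes d: "d \<in> symmetric_diagrams n"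
  shows "arc_config n (arcs d r)"
proof -
  note B = symmetric_diagramD(1)[OF d]
  have m: "(\<lambda>j. 2 * n + 1 - j) ` a \<in> arcs d r" if "a \<in> arcs d r" for a
  proof -
    have "reflect_node n ` Pair r ` a \<in> d"
      using symmetric_diagramD(2)[OF d] that by (simp add: arcs_def)
    moreover have "reflect_node n ` Pair r ` a = Pair r ` (\<lambda>j. 2 * n + 1 - j) ` a"
      by (simp add: image_image)
    ultimately show ?thesis by (simp add: arcs_def)
  qed
  show ?thesis
    unfolding arc_config_def
  proof (intro conjI ballI impI)
    fix a assume a: "a \<in> arcs d r"
    show "a \<subseteq> {1..2 * n}" "card a = 2" "(\<lambda>j. 2 * n + 1 - j) ` a \<in> arcs d r"
      by (rule arcs_subset[OF B a] m[OF a])+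
    fix b assume b: "b \<in> arcs d r" "a \<inter> b \<noteq> {}"
    then obtain i where "i \<in> a" "i \<in> b" by blast
    then show "a = b" by (rule arcs_unique[OF B a b(1)])
  qed
qed

definition free_positions :: "nat \<Rightarrow> nat set set \<Rightarrow> nat set" where
  "free_positions n b = {1..2 * n} - \<Union>b"

definition through_diagram :: "nat \<Rightarrow> nat set set \<Rightarrow> (nat \<Rightarrow> nat) \<Rightarrow> diagram" where
  "through_diagram n b f = (\<lambda>a. Pair 0 ` a) ` b \<union> (\<lambda>a. Pair 1 ` a) ` b \<union>
     {{(0, j), (1, f j)} | j. j \<in> free_positions n b}"

definition mirror_permutation :: "nat \<Rightarrow> nat set set \<Rightarrow> (nat \<Rightarrow> nat) \<Rightarrow> bool" where
  "mirror_permutation n b f \<longleftrightarrow> bij_betw f (free_positions n b) (free_positions n b) \<and>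
     (\<forall>j\<in>free_positions n b. f (2 * n + 1 - j) = 2 * n + 1 - f j)"

definition projection :: "nat \<Rightarrow> nat set set \<Rightarrow> diagram" where
  "projection n b = through_diagram n b (\<lambda>j. j)"

lemma through_diagram_edgeE:
  assumes "e \<in> through_diagram n b f"
  obtains r a where "r = 0 \<or> r = 1" "a \<in> b" "e = Pair r ` a"
    | j where "j \<in> free_positions n b" "e = {(0, j), (1, f j)}"
  using assms unfolding through_diagram_def
proof (elim UnE)
  assume "e \<in> (\<lambda>a. Pair 0 ` a) ` b"
  then obtain a where "a \<in> b" "e = Pair 0 ` a" by (rule imageE)
  then show thesis using that(1)[of 0 a] by simp
next
  assume "e \<in> (\<lambda>a. Pair 1 ` a) ` b"
  then obtain a where "a \<in> b" "e = Pair 1 ` a" by (rule imageE)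
  then show thesis using that(1)[of 1 a] by simp
next
  assume "e \<in> {{(0, j), (1, f j)} | j. j \<in> free_positions n b}"
  then obtain j where "j \<in> free_positions n b" "e = {(0, j), (1, f j)}" by (elim CollectE exE conjE)
  then show thesis using that(2)[of j] by simp
qed

lemma through_diagram_arc: "r = 0 \<or> r = 1 \<Longrightarrow> a \<in> b \<Longrightarrow> Pair r ` a \<in> through_diagram n b f"
  unfolding through_diagram_def by (elim disjE; simp)

lemma through_diagram_line: "j \<in> free_positions n b \<Longrightarrow> {(0, j), (1, f j)} \<in> through_diagram n b f"
  unfolding through_diagram_def by (intro UnI2 CollectI exI[of _ j]) simp

lemma free_positionsD: "j \<in> free_positions n b \<Longrightarrow> j \<in> {1..2 * n}"
  "j \<in> free_positions n b \<Longrightarrow> a \<in> b \<Longrightarrow> j \<notin> a"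
  unfolding free_positions_def by blast+

lemma free_positions_mirror:
  assumes b: "arc_config n b" and j: "j \<in> free_positions n b"
  shows "2 * n + 1 - j \<in> free_positions n b"
proof -
  have "2 * n + 1 - j \<notin> \<Union>b"
  proof
    assume "2 * n + 1 - j \<in> \<Union>b"
    then obtain a where a: "a \<in> b" "2 * n + 1 - j \<in> a" by blast
    have "2 * n + 1 - (2 * n + 1 - j) \<in> (\<lambda>j. 2 * n + 1 - j) ` a" using a(2) by (rule imageI)
    then have "j \<in> (\<lambda>j. 2 * n + 1 - j) ` a" using free_positionsD(1)[OF j] by simp
    then show False using free_positionsD(2)[OF j arc_configD(3)[OF b a(1)]] by simp
  qed
  moreover have "2 * n + 1 - j \<in> {1..2 * n}" using free_positionsD(1)[OF j] by auto
  ultimately show ?thesis by (simp add: free_positions_def)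
qed

lemma mirror_permutationD:
  assumes "mirror_permutation n b f" "j \<in> free_positions n b"
  shows "f j \<in> free_positions n b" "f (2 * n + 1 - j) = 2 * n + 1 - f j"
  using assms bij_betwE unfolding mirror_permutation_def by blast+

lemma through_diagram_symmetric:
  assumes b: "arc_config n b" and f: "mirror_permutation n b f"
  shows "through_diagram n b f \<in> symmetric_diagrams n"
proof (rule symmetric_diagramI)
  let ?m = "\<lambda>j. 2 * n + 1 - j"
  note bs = arc_configD[OF b] and bu = arc_config_unique[OF b]
  have bij: "bij_betw f (free_positions n b) (free_positions n b)"
    using f unfolding mirror_permutation_def by blast
  have inj: "j = k" if "j \<in> free_positions n b" "k \<in> free_positions n b" "f j = f k" for j k
    using bij_betw_imp_inj_on[OF bij] that by (auto dest: inj_onD)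
  show "through_diagram n b f \<in> brauer_diagrams n"
    unfolding brauer_diagram_iff
  proof (intro conjI ballI allI impI)
    show "\<Union>(through_diagram n b f) = outer_rows n"
    proof (intro equalityI subsetI)
      fix x assume "x \<in> \<Union>(through_diagram n b f)"
      then obtain e where e: "e \<in> through_diagram n b f" "x \<in> e" by blast
      from e(1) show "x \<in> outer_rows n"
      proof (cases rule: through_diagram_edgeE)
        case (1 r a)
        then show ?thesis using bs(1) e(2) by (auto simp: node_row_def)
      next
        case (2 j)
        then have "j \<in> {1..2 * n}" "f j \<in> {1..2 * n}"
          using free_positionsD(1) mirror_permutationD(1)[OF f] by blast+
        then show ?thesis using e(2) unfolding 2(2) by (auto simp: node_row_def)
      qed
    next
      fix x assume x: "x \<in> outer_rows n"
      obtain r j where rj: "x = (r, j)" by (cases x)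
      have r: "r = 0 \<or> r = 1" "j \<in> {1..2 * n}" using x rj by (auto simp: row_mem_iff)
      show "x \<in> \<Union>(through_diagram n b f)"
      proof (cases "j \<in> \<Union>b")
        case True
        then obtain a where a: "a \<in> b" "j \<in> a" by blast
        have "x \<in> Pair r ` a" unfolding rj using a(2) by (rule imageI)
        then show ?thesis using through_diagram_arc[OF r(1) a(1)] by blast
      next
        case False
        then have j: "j \<in> free_positions n b" using r(2) by (simp add: free_positions_def)
        then obtain k where k: "k \<in> free_positions n b" "j = f k"
          using bij unfolding bij_betw_def by blast
        from r(1) show ?thesis
        proof
          assume "r = 0"
          then have "x \<in> {(0, j), (1, f j)}" using rj by simp
          then show ?thesis using through_diagram_line[OF j] by blast
        next
          assume "r = 1"
          then have "x \<in> {(0, k), (1, f k)}" using rj k(2) by simp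
          then show ?thesis using through_diagram_line[OF k(1)] by blast
        qed
      qed
    qed
  next
    fix e assume "e \<in> through_diagram n b f"
    then show "card e = 2"
    proof (cases rule: through_diagram_edgeE)
      case (1 r a)
      then show ?thesis
        using bs(2) card_image[OF inj_on_subset[OF inj_Pair[of r] subset_UNIV], of a] by simp
    qed simp
  next
    fix e g x assume e: "e \<in> through_diagram n b f" and g: "g \<in> through_diagram n b f"
      and x: "x \<in> e" "x \<in> g"
    have line: "snd x \<in> free_positions n b" if "j \<in> free_positions n b" "x \<in> {(0, j), (1, f j)}" for j
      using that mirror_permutationD(1)[OF f] by auto
    from e show "e = g"
    proof (cases rule: through_diagram_edgeE)
      case e1: (1 r a)
      have xa: "snd x \<in> a" using e1(3) x(1) by auto
      from g show ?thesis
      proof (cases rule: through_diagram_edgeE)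
        case (1 s a')
        then have "r = s" using e1 x by auto
        moreover have "a = a'" using bu[OF e1(2) 1(2) xa] 1(3) x(2) by auto
        ultimately show ?thesis using e1(3) 1(3) by simp
      next
        case (2 j)
        then show ?thesis using line[of j] x(2) free_positionsD(2)[OF _ e1(2)] xa by blast
      qed
    next
      case e2: (2 j)
      from g show ?thesis
      proof (cases rule: through_diagram_edgeE)
        case (1 s a')
        then have "snd x \<in> a'" using x(2) by auto
        then show ?thesis using line[of j] e2 x(1) free_positionsD(2)[OF _ 1(2)] by blast
      next
        case (2 k)
        then have "j = k \<or> f j = f k" using e2 x by auto
        then have "j = k" using inj e2(1) 2(1) by blast
        then show ?thesis using 2 e2 by simp
      qed
    qed
  qed
  fix e assume "e \<in> through_diagram n b f"
  then show "reflect_node n ` e \<in> through_diagram n b f"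
  proof (cases rule: through_diagram_edgeE)
    case (1 r a)
    have "reflect_node n ` e = Pair r ` ?m ` a" unfolding 1(3) by (simp add: image_image)
    then show ?thesis using through_diagram_arc[OF 1(1) bs(3)[OF 1(2)]] by simp
  next
    case (2 j)
    have "reflect_node n ` e = {(0, ?m j), (1, f (?m j))}"
      unfolding 2(2) mirror_permutationD(2)[OF f 2(1)] by simp
    then show ?thesis using through_diagram_line[OF free_positions_mirror[OF b 2(1)]] by simp
  qed
qed

lemma arcs_through_diagram:
  assumes b: "arc_config n b" and f: "mirror_permutation n b f" and r: "r = 0 \<or> r = 1"
  shows "arcs (through_diagram n b f) r = b"
proof (intro equalityI subsetI)
  fix a assume a: "a \<in> arcs (through_diagram n b f) r"
  note B = symmetric_diagramD(1)[OF through_diagram_symmetric[OF b f]]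
  obtain i where i: "i \<in> a" using arcs_subset(3)[OF B a] by blast
  have "Pair r ` a \<in> through_diagram n b f" using a by (simp add: arcs_def)
  then show "a \<in> b"
  proof (cases rule: through_diagram_edgeE)
    case (1 s a')
    have "(r, i) \<in> Pair s ` a'" using 1(3) i by blast
    then have "r = s" by auto
    then show ?thesis using 1 Pair_image_eq_iff by metis
  next
    case (2 j)
    have "(0, j) \<in> Pair r ` a" "(1, f j) \<in> Pair r ` a" unfolding 2(2) by simp_all
    then show ?thesis by auto
  qed
next
  fix a assume "a \<in> b"
  then show "a \<in> arcs (through_diagram n b f) r" using through_diagram_arc[OF r] by (simp add: arcs_def)
qed

lemma mirror_permutation_id: "mirror_permutation n b (\<lambda>j. j)"
  unfolding mirror_permutation_def bij_betw_def by simp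

lemma projection_symmetric: "arc_config n b \<Longrightarrow> projection n b \<in> symmetric_diagrams n"
  unfolding projection_def by (rule through_diagram_symmetric[OF _ mirror_permutation_id])

lemma arcs_projection: "arc_config n b \<Longrightarrow> r = 0 \<or> r = 1 \<Longrightarrow> arcs (projection n b) r = b"
  unfolding projection_def by (rule arcs_through_diagram[OF _ mirror_permutation_id])

lemma projection_line:
  assumes "j \<in> {1..2 * n}" "j \<notin> \<Union>b"
  shows "{(0, j), (1, j)} \<in> projection n b"
  using through_diagram_line[of j n b "\<lambda>j. j"] assms by (simp add: projection_def free_positions_def)

lemma identity_eq_projection: "identity_diagram n = projection n {}"
  by (simp add: identity_diagram_def projection_def through_diagram_def free_positions_def)

text \<open>The through strands of the projection prolong the edges of \<open>d\<close> at the positions outside \<open>b\<close>; at the positions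
  in \<open>b\<close> the diagram \<open>d\<close> has the same arcs as the projection.\<close>

lemma projection_compose:
  assumes d: "d \<in> symmetric_diagrams n" and b: "arc_config n b" "b \<subseteq> arcs d 0"
  shows "compose_diagrams n (projection n b) d = d"
proof -
  let ?P = "projection n b"
  note B = symmetric_diagramD(1)[OF d]
  note PB = symmetric_diagramD(1)[OF projection_symmetric[OF b(1)]]
  let ?E = "stack_edges ?P d"
  have step: "(spread x, shift x) \<in> conn ?E" if "x \<in> outer_rows n" "\<And>i. x = (0, i) \<Longrightarrow> i \<notin> \<Union>b" for x
    using that(1)
  proof (cases rule: outer_rowsE)
    case (1 j)
    then have "{(0, j), (1, j)} \<in> ?P" using that(2) by (intro projection_line)
    then show ?thesis using upper_edge 1 by (simp add: spread_def shift_def)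
  qed (simp add: spread_def shift_def numeral_2_eq_2)
  have "e \<in> compose_diagrams n ?P d" if e: "e \<in> d" for e
  proof -
    obtain x y where xy: "e = {x, y}" "x \<noteq> y" using brauer_diagramD(2)[OF B e] by (auto simp: card_2_iff)
    have o: "x \<in> outer_rows n" "y \<in> outer_rows n" using brauer_union_subset[OF B] e xy by auto
    show ?thesis
    proof (cases "\<exists>a\<in>b. e = Pair 0 ` a")
      case True
      then obtain a where a: "a \<in> b" "e = Pair 0 ` a" by blast
      then have "a \<in> arcs ?P 0" using arcs_projection[OF b(1)] by simp
      then have "a \<in> arcs (compose_diagrams n ?P d) 0" using arcs_compose_top[OF PB B] by blast
      then show ?thesis using a(2) by (simp add: arcs_def)
    next
      case False
      have free: "i \<notin> \<Union>b" if "(0, i) \<in> e" for i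
      proof
        assume "i \<in> \<Union>b"
        then obtain a where a: "a \<in> b" "i \<in> a" by blast
        then have "Pair 0 ` a \<in> d" using b(2) by (auto simp: arcs_def)
        then have "e = Pair 0 ` a" using brauer_diagramD(3)[OF B e _ that] a(2) by blast
        then show False using False a(1) by blast
      qed
      have "(spread x, shift x) \<in> conn ?E" by (rule step[OF o(1)]) (use free xy(1) in blast)
      moreover have "(shift x, shift y) \<in> conn ?E" using shift_edge e xy(1) by blast
      moreover have "(shift y, spread y) \<in> conn ?E"
        by (rule conn_sym, rule step[OF o(2)]) (use free xy(1) in blast)
      ultimately have "(spread x, spread y) \<in> conn ?E" using conn_trans by metis
      then show ?thesis using compose_edgeI[OF PB B o xy(2)] xy(1) by simp
    qed
  qed
  then show ?thesis using brauer_eqI[OF B compose_brauer[OF PB B]] by blast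
qed

lemma compose_projection:
  assumes d: "d \<in> symmetric_diagrams n" and b: "arc_config n b" "b \<subseteq> arcs d 1"
  shows "compose_diagrams n d (projection n b) = d"
proof -
  let ?P = "projection n b"
  note B = symmetric_diagramD(1)[OF d]
  note PB = symmetric_diagramD(1)[OF projection_symmetric[OF b(1)]]
  let ?E = "stack_edges d ?P"
  have step: "(x, spread x) \<in> conn ?E" if "x \<in> outer_rows n" "\<And>i. x = (1, i) \<Longrightarrow> i \<notin> \<Union>b" for x
    using that(1)
  proof (cases rule: outer_rowsE)
    case (2 j)
    then have "{(0, j), (1, j)} \<in> ?P" using that(2) by (intro projection_line)
    from shift_edge[OF this, of d] show ?thesis using 2 by (simp add: spread_def shift_def numeral_2_eq_2)
  qed (simp add: spread_def)
  have "e \<in> compose_diagrams n d ?P" if e: "e \<in> d" for e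
  proof -
    obtain x y where xy: "e = {x, y}" "x \<noteq> y" using brauer_diagramD(2)[OF B e] by (auto simp: card_2_iff)
    have o: "x \<in> outer_rows n" "y \<in> outer_rows n" using brauer_union_subset[OF B] e xy by auto
    show ?thesis
    proof (cases "\<exists>a\<in>b. e = Pair 1 ` a")
      case True
      then obtain a where a: "a \<in> b" "e = Pair 1 ` a" by blast
      then have "a \<in> arcs ?P 1" using arcs_projection[OF b(1)] by simp
      then have "a \<in> arcs (compose_diagrams n d ?P) 1" using arcs_compose_bottom[OF B PB] by blast
      then show ?thesis using a(2) by (simp add: arcs_def)
    next
      case False
      have free: "i \<notin> \<Union>b" if "(1, i) \<in> e" for i
      proof
        assume "i \<in> \<Union>b"
        then obtain a where a: "a \<in> b" "i \<in> a" by blast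
        then have "Pair 1 ` a \<in> d" using b(2) by (auto simp: arcs_def)
        then have "e = Pair 1 ` a" using brauer_diagramD(3)[OF B e _ that] a(2) by blast
        then show False using False a(1) by blast
      qed
      have "(spread x, x) \<in> conn ?E"
        by (rule conn_sym, rule step[OF o(1)]) (use free xy(1) in blast)
      moreover have "(x, y) \<in> conn ?E" using upper_edge e xy(1) by blast
      moreover have "(y, spread y) \<in> conn ?E" by (rule step[OF o(2)]) (use free xy(1) in blast)
      ultimately have "(spread x, spread y) \<in> conn ?E" using conn_trans by metis
      then show ?thesis using compose_edgeI[OF B PB o xy(2)] xy(1) by simp
    qed
  qed
  then show ?thesis using brauer_eqI[OF B compose_brauer[OF B PB]] by blast
qed

section \<open>Flipping a diagram upside down\<close>

definition flip_node :: "node \<Rightarrow> node" where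
  "flip_node = map_prod (\<lambda>r. if r = 0 then 1 else if r = 1 then 0 else r) id"

definition flip :: "diagram \<Rightarrow> diagram" where
  "flip d = (`) flip_node ` d"

lemma flip_flip_node [simp]: "flip_node (flip_node x) = x"
  by (cases x) (simp add: flip_node_def)

lemma inj_flip_node: "inj flip_node"
  by (metis flip_flip_node injI)

lemma flip_mem_iff: "e \<in> flip d \<longleftrightarrow> flip_node ` e \<in> d"
proof -
  have ff: "flip_node ` flip_node ` e = e" for e by (simp add: image_image)
  show ?thesis
  proof
    assume "e \<in> flip d"
    then obtain f where "f \<in> d" "e = flip_node ` f" unfolding flip_def by (elim imageE) simp
    then show "flip_node ` e \<in> d" using ff by simp
  next
    assume "flip_node ` e \<in> d"
    then have "flip_node ` flip_node ` e \<in> flip d" unfolding flip_def by (rule imageI)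
    then show "e \<in> flip d" unfolding ff .
  qed
qed

lemma flip_outer: "flip_node x \<in> outer_rows n \<longleftrightarrow> x \<in> outer_rows n"
  by (cases x) (auto simp: flip_node_def row_mem_iff)

lemma flip_symmetric:
  assumes d: "d \<in> symmetric_diagrams n"
  shows "flip d \<in> symmetric_diagrams n"
proof (rule symmetric_diagramI)
  note B = symmetric_diagramD(1)[OF d]
  show "flip d \<in> brauer_diagrams n"
    unfolding brauer_diagram_iff
  proof (intro conjI ballI allI impI)
    show "\<Union>(flip d) = outer_rows n"
    proof (intro equalityI subsetI)
      fix x assume "x \<in> \<Union>(flip d)"
      then obtain e where "x \<in> flip_node ` e" "e \<in> d" unfolding flip_def by blast
      then show "x \<in> outer_rows n" using brauer_union_subset[OF B] flip_outer by blast
    next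
      fix x assume "x \<in> outer_rows n"
      then have "flip_node x \<in> \<Union>d" using brauer_diagramD(1)[OF B] flip_outer by blast
      then obtain e where e: "e \<in> d" "flip_node x \<in> e" by blast
      have "flip_node (flip_node x) \<in> flip_node ` e" using e(2) by (rule imageI)
      then show "x \<in> \<Union>(flip d)" using e(1) unfolding flip_def by auto
    qed
    fix e assume e: "e \<in> flip d"
    have "card (flip_node ` e) = card e" by (rule card_image[OF inj_on_subset[OF inj_flip_node subset_UNIV]])
    then show "card e = 2" using brauer_diagramD(2)[OF B] e by (simp add: flip_mem_iff)
    fix f x assume f: "f \<in> flip d" "x \<in> e" "x \<in> f"
    have "flip_node ` e = flip_node ` f"
      by (rule brauer_diagramD(3)[OF B, of _ _ "flip_node x"])
        (use e f in \<open>simp_all add: flip_mem_iff\<close>)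
    then show "e = f" by (simp add: inj_image_eq_iff[OF inj_flip_node])
  qed
  fix e assume "e \<in> flip d"
  then have "reflect_node n ` flip_node ` e \<in> d" using symmetric_diagramD(2)[OF d] by (simp add: flip_mem_iff)
  moreover have "reflect_node n ` flip_node ` e = flip_node ` reflect_node n ` e"
    unfolding image_image by (intro image_cong) (auto simp: flip_node_def)
  ultimately show "reflect_node n ` e \<in> flip d" by (simp add: flip_mem_iff)
qed

lemma arcs_flip: "arcs (flip d) 0 = arcs d 1" "arcs (flip d) 1 = arcs d 0"
  by (simp_all add: arcs_def flip_mem_iff image_image flip_node_def)

lemma flip_flip: "flip (flip d) = d"
proof -
  have "flip_node ` flip_node ` e = e" for e by (simp add: image_image)
  then show ?thesis by (simp add: flip_def image_image)
qed

text \<open>Each through strand of \<open>d\<close> is followed by its mirror image and returns to the position where it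
  started.\<close>

lemma compose_flip:
  assumes d: "d \<in> symmetric_diagrams n"
  shows "compose_diagrams n d (flip d) = projection n (arcs d 0)"
proof -
  note B = symmetric_diagramD(1)[OF d]
  note FB = symmetric_diagramD(1)[OF flip_symmetric[OF d]]
  note PB = symmetric_diagramD(1)[OF projection_symmetric[OF arc_config_arcs[OF d, of 0]]]
  let ?E = "stack_edges d (flip d)"
  have "e \<in> compose_diagrams n d (flip d)" if "e \<in> through_diagram n (arcs d 0) (\<lambda>j. j)" for e
    using that
  proof (cases rule: through_diagram_edgeE)
    case (1 r a)
    have "a \<in> arcs (compose_diagrams n d (flip d)) r"
      using arcs_compose_top[OF B FB] arcs_compose_bottom[OF B FB] 1(1,2) arcs_flip by blast
    then show ?thesis using 1(3) by (simp add: arcs_def)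
  next
    case (2 i)
    have iN: "i \<in> {1..2 * n}" "i \<notin> \<Union>(arcs d 0)" using 2(1) by (simp_all add: free_positions_def)
    obtain j where j: "{(0, i), (1, j)} \<in> d" using through_edge_top[OF B iN] by blast
    then have "{(1, i), (0, j)} \<in> flip d" by (simp add: flip_mem_iff flip_node_def)
    then have "((2, i), (1, j)) \<in> conn ?E"
      using shift_edge[of "(1, i)" "(0, j)" "flip d" d] by (simp add: shift_def numeral_2_eq_2)
    then have "((0, i), (2, i)) \<in> conn ?E" using conn_trans[OF upper_edge[OF j] conn_sym] by blast
    then have "{(0, i), (1, i)} \<in> compose_diagrams n d (flip d)"
      using compose_edgeI[OF B FB, of "(0, i)" "(1, i)"] iN(1) by (simp add: row_mem_iff spread_def)
    then show ?thesis using 2(2) by simp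
  qed
  then have "projection n (arcs d 0) \<subseteq> compose_diagrams n d (flip d)" unfolding projection_def by blast
  then show ?thesis using brauer_eqI[OF PB compose_brauer[OF B FB]] by blast
qed

section \<open>Groups of diagrams with prescribed arcs\<close>

definition arc_group :: "nat \<Rightarrow> nat set set \<Rightarrow> diagram monoid" where
  "arc_group n b = \<lparr> carrier = {d \<in> symmetric_diagrams n. arcs d 0 = b \<and> arcs d 1 = b},
     monoid.mult = compose_diagrams n, one = projection n b \<rparr>"

lemma compose_assoc:
  assumes "d1 \<in> symmetric_diagrams n" "d2 \<in> symmetric_diagrams n" "d3 \<in> symmetric_diagrams n"
  shows "compose_diagrams n (compose_diagrams n d1 d2) d3 = compose_diagrams n d1 (compose_diagrams n d2 d3)"
  by (intro compose_assoc_loops(1) brauer_union_subset symmetric_diagramD(1) assms)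

text \<open>Matching arcs keep all through strands (\<open>arcs_compose_matching\<close>), so the diagrams are closed under
  composition; turning a diagram upside down inverts its through strands.\<close>

lemma group_arc_group:
  assumes b: "arc_config n b"
  shows "group (arc_group n b)"
proof (rule groupI)
  fix x y z
  assume x: "x \<in> carrier (arc_group n b)" and y: "y \<in> carrier (arc_group n b)"
  have X: "x \<in> symmetric_diagrams n" "arcs x 0 = b" "arcs x 1 = b"
    and Y: "y \<in> symmetric_diagrams n" "arcs y 0 = b" "arcs y 1 = b"
    using x y by (auto simp: arc_group_def)
  show "x \<otimes>\<^bsub>arc_group n b\<^esub> y \<in> carrier (arc_group n b)"
    using arcs_compose_matching[OF symmetric_diagramD(1)[OF X(1)] symmetric_diagramD(1)[OF Y(1)]]
      compose_symmetric[OF X(1) Y(1)] X Y by (simp add: arc_group_def)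
  show "x \<otimes>\<^bsub>arc_group n b\<^esub> y \<otimes>\<^bsub>arc_group n b\<^esub> z = x \<otimes>\<^bsub>arc_group n b\<^esub> (y \<otimes>\<^bsub>arc_group n b\<^esub> z)"
    if "z \<in> carrier (arc_group n b)"
    using compose_assoc[OF X(1) Y(1)] that by (simp add: arc_group_def)
  show "\<one>\<^bsub>arc_group n b\<^esub> \<otimes>\<^bsub>arc_group n b\<^esub> x = x"
    using projection_compose[OF X(1) b] X by (simp add: arc_group_def)
  show "\<exists>y\<in>carrier (arc_group n b). y \<otimes>\<^bsub>arc_group n b\<^esub> x = \<one>\<^bsub>arc_group n b\<^esub>"
  proof
    show "flip x \<in> carrier (arc_group n b)"
      using flip_symmetric[OF X(1)] X arcs_flip[of x] by (simp add: arc_group_def)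
    show "flip x \<otimes>\<^bsub>arc_group n b\<^esub> x = \<one>\<^bsub>arc_group n b\<^esub>"
      using compose_flip[OF flip_symmetric[OF X(1)]] X arcs_flip[of x] by (simp add: arc_group_def flip_flip)
  qed
next
  show "\<one>\<^bsub>arc_group n b\<^esub> \<in> carrier (arc_group n b)"
    using projection_symmetric[OF b] arcs_projection[OF b] by (simp add: arc_group_def)
qed

lemma finite_arc_group: "finite (carrier (arc_group n b))"
  using finite_symmetric_diagrams[of n] by (simp add: arc_group_def)

section \<open>The order of the group\<close>

text \<open>Functions are extensional, that is, \<open>undefined\<close> outside \<open>X\<close>, so that counting them makes sense.\<close>

definition equivariant_bijections :: "('a \<Rightarrow> 'a) \<Rightarrow> 'a set \<Rightarrow> 'a set \<Rightarrow> ('a \<Rightarrow> 'a) set" where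
  "equivariant_bijections s X Y = {f \<in> X \<rightarrow>\<^sub>E Y. bij_betw f X Y \<and> (\<forall>x\<in>X. f (s x) = s (f x))}"

text \<open>There are \<open>2 (k + 1)\<close> choices for the image of one point \<open>x\<close>. The image of \<open>s x\<close> is then determined,
  and an equivariant bijection of the remaining \<open>2 k\<close> points is left to choose.\<close>

lemma card_equivariant_bijections:
  assumes "finite X" "finite Y" "card X = 2 * k" "card Y = 2 * k"
    and "\<And>x. x \<in> X \<Longrightarrow> s x \<in> X \<and> s (s x) = x \<and> s x \<noteq> x"
    and "\<And>y. y \<in> Y \<Longrightarrow> s y \<in> Y \<and> s (s y) = y \<and> s y \<noteq> y"
  shows "card (equivariant_bijections s X Y) = 2 ^ k * fact k"
  using assms
proof (induction k arbitrary: X Y)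
  case 0
  have "X = {}" "Y = {}" using 0(1-4) by simp_all
  then have "equivariant_bijections s X Y = {\<lambda>_. undefined}"
    by (auto simp: equivariant_bijections_def bij_betw_def)
  then show ?case by simp
next
  case (Suc k)
  note X = Suc.prems(5) and Y = Suc.prems(6)
  obtain x where x: "x \<in> X" using Suc.prems(3) by fastforce
  let ?X = "X - {x, s x}" and ?Y = "\<lambda>y. Y - {y, s y}"
  have card_diff: "card (A - {a, s a}) = 2 * k"
    if "finite A" "card A = 2 * Suc k" "a \<in> A" "s a \<in> A" "s a \<noteq> a" for A a
  proof -
    have "card {a, s a} = 2" using that(5)[symmetric] by simp
    then show ?thesis using that by (simp add: card_Diff_subset)
  qed
  have cX: "card ?X = 2 * k" using card_diff[OF Suc.prems(1,3) x] X[OF x] by simp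
  have cY: "card (?Y y) = 2 * k" if "y \<in> Y" for y
    using card_diff[OF Suc.prems(2,4) that] Y[OF that] by simp
  have X': "s z \<in> ?X \<and> s (s z) = z \<and> s z \<noteq> z" if "z \<in> ?X" for z
    using X[of z] X[OF x] that by (metis Diff_iff empty_iff insert_iff)
  have Y': "s z \<in> ?Y y \<and> s (s z) = z \<and> s z \<noteq> z" if "z \<in> ?Y y" "y \<in> Y" for z y
    using Y[of z] Y[OF that(2)] that(1) by (metis Diff_iff empty_iff insert_iff)
  let ?S = "SIGMA y:Y. equivariant_bijections s ?X (?Y y)"
  let ?to = "\<lambda>f. (f x, restrict f ?X)"
  let ?from = "\<lambda>(y, g). \<lambda>z. if z = x then y else if z = s x then s y else g z"
  have "bij_betw ?to (equivariant_bijections s X Y) ?S"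
  proof (rule bij_betw_byWitness[of _ ?from])
    show "\<forall>f\<in>equivariant_bijections s X Y. ?from (?to f) = f"
    proof
      fix f assume f: "f \<in> equivariant_bijections s X Y"
      then have "f (s x) = s (f x)" "\<And>z. z \<notin> X \<Longrightarrow> f z = undefined"
        using x by (auto simp: equivariant_bijections_def PiE_def extensional_def)
      then show "?from (?to f) = f" using x by (intro ext) auto
    qed
    show "\<forall>p\<in>?S. ?to (?from p) = p"
    proof
      fix p assume "p \<in> ?S"
      then obtain y g where p: "p = (y, g)" "y \<in> Y" "g \<in> equivariant_bijections s ?X (?Y y)" by blast
      have "g z = undefined" if "z \<notin> ?X" for z
        using p(3) that by (auto simp: equivariant_bijections_def PiE_def extensional_def)
      then have "restrict (?from (y, g)) ?X = g" by (intro ext) (auto simp: restrict_def)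
      then show "?to (?from p) = p" using p(1) by simp
    qed
    show "?to ` equivariant_bijections s X Y \<subseteq> ?S"
    proof
      fix p assume "p \<in> ?to ` equivariant_bijections s X Y"
      then obtain f where f: "f \<in> equivariant_bijections s X Y" "p = ?to f" by blast
      have fb: "bij_betw f X Y" and eq: "\<And>z. z \<in> X \<Longrightarrow> f (s z) = s (f z)"
        using f(1) by (auto simp: equivariant_bijections_def)
      have fx: "f x \<in> Y" using bij_betwE[OF fb] x by blast
      have img: "f ` ?X = ?Y (f x)"
      proof -
        have "{x, s x} \<subseteq> X" using x X[OF x] by blast
        then have "f ` ?X = f ` X - f ` {x, s x}"
          by (intro inj_on_image_set_diff[OF bij_betw_imp_inj_on[OF fb] Diff_subset])
        moreover have "f ` {x, s x} = {f x, s (f x)}" by (simp add: eq[OF x])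
        ultimately show ?thesis using bij_betw_imp_surj_on[OF fb] by (simp only:)
      qed
      have "bij_betw f ?X (?Y (f x))"
        unfolding bij_betw_def
        by (intro conjI inj_on_subset[OF bij_betw_imp_inj_on[OF fb] Diff_subset] img)
      then have b: "bij_betw (restrict f ?X) ?X (?Y (f x))"
        by (rule iffD1[OF bij_betw_cong, rotated]) (simp only: restrict_apply if_True)
      have "restrict f ?X \<in> equivariant_bijections s ?X (?Y (f x))"
        unfolding equivariant_bijections_def
      proof (intro CollectI conjI ballI)
        show "restrict f ?X \<in> ?X \<rightarrow>\<^sub>E ?Y (f x)" using img by auto
        show "bij_betw (restrict f ?X) ?X (?Y (f x))" by (rule b)
        fix z assume z: "z \<in> ?X"
        then show "restrict f ?X (s z) = s (restrict f ?X z)" using X'[OF z] eq[of z] by simp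
      qed
      then show "p \<in> ?S" using f(2) fx by blast
    qed
    show "?from ` ?S \<subseteq> equivariant_bijections s X Y"
    proof
      fix f assume "f \<in> ?from ` ?S"
      then obtain y g where f: "f = ?from (y, g)" and y: "y \<in> Y"
        and g: "g \<in> equivariant_bijections s ?X (?Y y)" by blast
      have gb: "bij_betw g ?X (?Y y)" and geq: "\<And>z. z \<in> ?X \<Longrightarrow> g (s z) = s (g z)"
        and gext: "\<And>z. z \<notin> ?X \<Longrightarrow> g z = undefined"
        using g by (auto simp: equivariant_bijections_def PiE_def extensional_def)
      have sx: "s x \<in> X" "s x \<noteq> x" "s (s x) = x" using X[OF x] by auto
      have sy: "s y \<in> Y" "s y \<noteq> y" "s (s y) = y" using Y[OF y] by auto
      have fv: "f x = y" "f (s x) = s y" "\<And>z. z \<in> ?X \<Longrightarrow> f z = g z" using f sx by auto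
      have "bij_betw f ?X (?Y y)" by (rule iffD2[OF bij_betw_cong[OF fv(3)] gb])
      moreover have "bij_betw f {x, s x} {y, s y}"
        using fv(1,2) sx sy by (auto simp: bij_betw_def inj_on_def)
      ultimately have "bij_betw f (?X \<union> {x, s x}) (?Y y \<union> {y, s y})"
        by (rule bij_betw_combine) auto
      moreover have "?X \<union> {x, s x} = X" "?Y y \<union> {y, s y} = Y" using x sx y sy by auto
      ultimately have fb: "bij_betw f X Y" by simp
      have "f z = undefined" if "z \<notin> X" for z using f gext[of z] that x sx by auto
      then have "f \<in> X \<rightarrow>\<^sub>E Y" using bij_betwE[OF fb] by (auto simp: PiE_def extensional_def)
      moreover have "f (s z) = s (f z)" if z: "z \<in> X" for z
      proof (cases "z = x \<or> z = s x")
        case True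
        then show ?thesis using fv(1,2) sx sy by auto
      next
        case False
        then have "z \<in> ?X" using z by simp
        then show ?thesis using fv(3) X' geq by metis
      qed
      ultimately show "f \<in> equivariant_bijections s X Y" using fb by (simp add: equivariant_bijections_def)
    qed
  qed
  then have "card (equivariant_bijections s X Y) = card ?S" by (rule bij_betw_same_card)
  also have "\<dots> = (\<Sum>y\<in>Y. card (equivariant_bijections s ?X (?Y y)))"
  proof (rule card_SigmaI)
    show "finite Y" by (rule Suc.prems(2))
    show "\<forall>y\<in>Y. finite (equivariant_bijections s ?X (?Y y))"
    proof
      fix y
      have "equivariant_bijections s ?X (?Y y) \<subseteq> ?X \<rightarrow>\<^sub>E ?Y y" by (auto simp: equivariant_bijections_def)
      then show "finite (equivariant_bijections s ?X (?Y y))"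
        by (rule finite_subset) (use Suc.prems(1,2) in \<open>simp add: finite_PiE\<close>)
    qed
  qed
  also have "\<dots> = (\<Sum>y\<in>Y. 2 ^ k * fact k)"
  proof (rule sum.cong[OF refl])
    fix y assume y: "y \<in> Y"
    show "card (equivariant_bijections s ?X (?Y y)) = 2 ^ k * fact k"
      using Suc.IH[of ?X "?Y y"] cX cY[OF y] Suc.prems(1,2) X' Y'[OF _ y] by simp
  qed
  also have "\<dots> = 2 ^ Suc k * fact (Suc k)" using Suc.prems(4) by (simp add: algebra_simps)
  finally show ?case .
qed

lemma card_Union_arcs:
  assumes b: "arc_config n b"
  shows "\<Union>b \<subseteq> {1..2 * n}" "card (\<Union>b) = 2 * card b" "finite b"
proof -
  show sub: "\<Union>b \<subseteq> {1..2 * n}" using arc_configD(1)[OF b] by blast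
  have fin: "finite (\<Union>b)" by (rule finite_subset[OF sub]) simp
  then show finb: "finite b" by (rule finite_UnionD)
  have "2 * card b = card (\<Union>b)"
  proof (rule card_partition[OF finb fin])
    show "c \<inter> c' = {}" if "c \<in> b" "c' \<in> b" "c \<noteq> c'" for c c'
      using arc_config_unique[OF b that(1,2)] that(3) by blast
  qed (use arc_configD(2)[OF b] in simp_all)
  then show "card (\<Union>b) = 2 * card b" by simp
qed

lemma card_arc_config_le:
  assumes b: "arc_config n b"
  shows "card b \<le> n"
  using card_mono[OF _ card_Union_arcs(1)[OF b]] card_Union_arcs(2)[OF b] by simp

lemma card_free_positions:
  assumes b: "arc_config n b"
  shows "card (free_positions n b) = 2 * (n - card b)"
  unfolding free_positions_def
    card_Diff_subset[OF finite_subset[OF card_Union_arcs(1)[OF b] finite_atLeastAtMost] card_Union_arcs(1)[OF b]]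
    card_Union_arcs(2)[OF b] by (simp add: diff_mult_distrib2)

text \<open>The through strands of a diagram in the group are the graph of a bijection of the free positions that
  commutes with the reflection. The reflection has no fixed point, as \<open>2 n + 1\<close> is odd.\<close>

lemma card_arc_group:
  assumes b: "arc_config n b"
  shows "card (carrier (arc_group n b)) = 2 ^ (n - card b) * fact (n - card b)"
proof -
  let ?F = "free_positions n b" and ?m = "\<lambda>j. 2 * n + 1 - j"
  let ?E = "equivariant_bijections ?m ?F ?F"
  have E: "mirror_permutation n b f" if "f \<in> ?E" for f
    using that by (simp add: equivariant_bijections_def mirror_permutation_def)
  have m: "?m x \<in> ?F \<and> ?m (?m x) = x \<and> ?m x \<noteq> x" if "x \<in> ?F" for x
  proof -
    have "x \<in> {1..2 * n}" using free_positionsD(1)[OF that] .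
    moreover have "2 * n + 1 - x \<noteq> x" by presburger
    ultimately show ?thesis using free_positions_mirror[OF b that] by simp
  qed
  have fin: "finite ?F" by (simp add: free_positions_def)
  have "bij_betw (through_diagram n b) ?E (carrier (arc_group n b))"
    unfolding bij_betw_def
  proof
    show "inj_on (through_diagram n b) ?E"
    proof (rule inj_onI)
      fix f g assume f: "f \<in> ?E" and g: "g \<in> ?E" and eq: "through_diagram n b f = through_diagram n b g"
      note B = symmetric_diagramD(1)[OF through_diagram_symmetric[OF b E[OF f]]]
      show "f = g"
      proof
        fix j
        show "f j = g j"
        proof (cases "j \<in> ?F")
          case True
          have e: "{(0, j), (1, f j)} \<in> through_diagram n b f" "{(0, j), (1, g j)} \<in> through_diagram n b f"
            using through_diagram_line[OF True, of f] through_diagram_line[OF True, of g] eq by simp_all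
          have "{(0 :: nat, j), (1, f j)} = {(0, j), (1, g j)}"
            by (rule brauer_diagramD(3)[OF B e, of "(0, j)"]) simp_all
          then show ?thesis by (simp add: doubleton_eq_iff)
        next
          case False
          then show ?thesis using f g by (auto simp: equivariant_bijections_def PiE_def extensional_def)
        qed
      qed
    qed
    show "through_diagram n b ` ?E = carrier (arc_group n b)"
    proof (intro equalityI subsetI)
      fix d assume "d \<in> through_diagram n b ` ?E"
      then obtain f where f: "f \<in> ?E" "d = through_diagram n b f" by blast
      then show "d \<in> carrier (arc_group n b)"
        using through_diagram_symmetric[OF b E[OF f(1)]] arcs_through_diagram[OF b E[OF f(1)]]
        by (simp add: arc_group_def)
    next
      fix d assume "d \<in> carrier (arc_group n b)"
      then have d: "d \<in> symmetric_diagrams n" "arcs d 0 = b" "arcs d 1 = b" by (auto simp: arc_group_def)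
      note B = symmetric_diagramD(1)[OF d(1)]
      have "\<exists>k. {(0, j), (1, k)} \<in> d \<and> k \<in> ?F" if j: "j \<in> ?F" for j
      proof -
        have "j \<in> {1..2 * n}" "j \<notin> \<Union>(arcs d 0)" using j d(2) by (simp_all add: free_positions_def)
        then obtain k where "{(0, j), (1, k)} \<in> d" "k \<in> {1..2 * n}" "k \<notin> \<Union>(arcs d 1)"
          by (rule through_edge_top[OF B])
        then show ?thesis using d(3) by (auto simp: free_positions_def)
      qed
      then obtain h where h: "\<And>j. j \<in> ?F \<Longrightarrow> {(0, j), (1, h j)} \<in> d" "\<And>j. j \<in> ?F \<Longrightarrow> h j \<in> ?F" by metis
      define f where "f = restrict h ?F"
      have f: "{(0, j), (1, f j)} \<in> d" "f j \<in> ?F" if "j \<in> ?F" for j using h that by (simp_all add: f_def)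
      have "inj_on f ?F"
      proof (rule inj_onI)
        fix j k assume j: "j \<in> ?F" and k: "k \<in> ?F" and eq: "f j = f k"
        have "{(0 :: nat, j), (1, f j)} = {(0, k), (1, f k)}"
          by (rule brauer_diagramD(3)[OF B f(1)[OF j] f(1)[OF k], of "(1, f j)"]) (simp_all add: eq)
        then show "j = k" by (simp add: doubleton_eq_iff)
      qed
      moreover have "f ` ?F = ?F"
        using \<open>inj_on f ?F\<close> f(2) fin by (intro card_subset_eq) (auto simp: card_image)
      ultimately have bij: "bij_betw f ?F ?F" by (simp add: bij_betw_def)
      have eqv: "f (?m j) = ?m (f j)" if j: "j \<in> ?F" for j
      proof -
        have "reflect_node n ` {(0, j), (1, f j)} \<in> d" using symmetric_diagramD(2)[OF d(1) f(1)[OF j]] .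
        then have e: "{(0, ?m j), (1, ?m (f j))} \<in> d" by simp
        have "{(0 :: nat, ?m j), (1, f (?m j))} = {(0, ?m j), (1, ?m (f j))}"
          by (rule brauer_diagramD(3)[OF B f(1)[OF free_positions_mirror[OF b j]] e, of "(0, ?m j)"]) simp_all
        then show ?thesis by (simp add: doubleton_eq_iff)
      qed
      have fE: "f \<in> ?E"
        unfolding equivariant_bijections_def using bij eqv f(2) by (auto simp: f_def)
      have "through_diagram n b f \<subseteq> d"
      proof
        fix e assume "e \<in> through_diagram n b f"
        then show "e \<in> d"
        proof (cases rule: through_diagram_edgeE)
          case (1 r a)
          have "a \<in> arcs d r" using 1(1,2) d(2,3) by auto
          then show ?thesis using 1(3) by (simp add: arcs_def)
        next
          case (2 j)
          then show ?thesis using f(1) by simp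
        qed
      qed
      then have "through_diagram n b f = d"
        using brauer_eqI[OF symmetric_diagramD(1)[OF through_diagram_symmetric[OF b E[OF fE]]] B] by simp
      then show "d \<in> through_diagram n b ` ?E" using fE by blast
    qed
  qed
  then have "card (carrier (arc_group n b)) = card ?E" by (simp add: bij_betw_same_card)
  also have "\<dots> = 2 ^ (n - card b) * fact (n - card b)"
    by (rule card_equivariant_bijections[OF fin fin card_free_positions[OF b] card_free_positions[OF b] m m])
  finally show ?thesis .
qed

section \<open>The algebra as a ring\<close>

definition basis :: "diagram \<Rightarrow> diagram \<Rightarrow> 'r::field" where
  "basis d = (\<lambda>x. if x = d then 1 else 0)"

locale type_C_brauer =
  fixes n :: nat and \<delta> :: "'r::field"
begin

abbreviation A :: "('r, diagram \<Rightarrow> 'r) module" where "A \<equiv> brauer_algebra_C n \<delta>"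

abbreviation S :: "diagram set" where "S \<equiv> symmetric_diagrams n"

lemma algebra_simps_A:
  "carrier A = {f. \<forall>d. d \<notin> S \<longrightarrow> f d = 0}"
  "\<zero>\<^bsub>A\<^esub> = (\<lambda>d. 0)"
  "f \<oplus>\<^bsub>A\<^esub> g = (\<lambda>d. f d + g d)"
  "\<one>\<^bsub>A\<^esub> = basis (identity_diagram n)"
  by (simp_all add: brauer_algebra_C_def basis_def)

lemma finite_S: "finite S" by (rule finite_symmetric_diagrams)

lemma carrier_outside: "f \<in> carrier A \<Longrightarrow> d \<notin> S \<Longrightarrow> f d = 0"
  by (simp add: algebra_simps_A)

lemma mult_apply:
  "(f \<otimes>\<^bsub>A\<^esub> g) d = (\<Sum>d1\<in>S. \<Sum>d2\<in>S. if compose_diagrams n d1 d2 = d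
     then f d1 * g d2 * \<delta> ^ closed_loops n d1 d2 else 0)"
proof -
  let ?t = "\<lambda>d1 d2. f d1 * g d2 * \<delta> ^ closed_loops n d1 d2"
  have "{(d1, d2). d1 \<in> S \<and> d2 \<in> S \<and> compose_diagrams n d1 d2 = d} =
      {p \<in> S \<times> S. compose_diagrams n (fst p) (snd p) = d}" by auto
  then have "(f \<otimes>\<^bsub>A\<^esub> g) d = (\<Sum>p\<in>{p \<in> S \<times> S. compose_diagrams n (fst p) (snd p) = d}. ?t (fst p) (snd p))"
    by (simp add: brauer_algebra_C_def case_prod_unfold)
  also have "\<dots> = (\<Sum>p\<in>S \<times> S. if compose_diagrams n (fst p) (snd p) = d then ?t (fst p) (snd p) else 0)"
    by (rule sum.inter_filter) (simp add: finite_S)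
  also have "\<dots> = (\<Sum>d1\<in>S. \<Sum>d2\<in>S. if compose_diagrams n d1 d2 = d then ?t d1 d2 else 0)"
    by (simp add: sum.cartesian_product case_prod_unfold)
  finally show ?thesis .
qed

text \<open>A linear functional, given by its values \<open>F\<close> on diagrams, applied to a product.\<close>

lemma sum_mult:
  "(\<Sum>d\<in>S. (f \<otimes>\<^bsub>A\<^esub> g) d * F d) =
    (\<Sum>d1\<in>S. \<Sum>d2\<in>S. f d1 * g d2 * \<delta> ^ closed_loops n d1 d2 * F (compose_diagrams n d1 d2))"
proof -
  let ?t = "\<lambda>d1 d2. f d1 * g d2 * \<delta> ^ closed_loops n d1 d2"
  have "(\<Sum>d\<in>S. (f \<otimes>\<^bsub>A\<^esub> g) d * F d) =
      (\<Sum>d\<in>S. \<Sum>d1\<in>S. \<Sum>d2\<in>S. if compose_diagrams n d1 d2 = d then ?t d1 d2 * F d else 0)"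
    unfolding mult_apply sum_distrib_right by (intro sum.cong refl) simp
  also have "\<dots> = (\<Sum>d1\<in>S. \<Sum>d\<in>S. \<Sum>d2\<in>S. if compose_diagrams n d1 d2 = d then ?t d1 d2 * F d else 0)"
    by (rule sum.swap)
  also have "\<dots> = (\<Sum>d1\<in>S. \<Sum>d2\<in>S. \<Sum>d\<in>S. if compose_diagrams n d1 d2 = d then ?t d1 d2 * F d else 0)"
    by (intro sum.cong refl sum.swap)
  also have "\<dots> = (\<Sum>d1\<in>S. \<Sum>d2\<in>S. ?t d1 d2 * F (compose_diagrams n d1 d2))"
  proof (intro sum.cong refl)
    fix d1 d2 assume "d1 \<in> S" "d2 \<in> S"
    then have "compose_diagrams n d1 d2 \<in> S" by (rule compose_symmetric)
    then show "(\<Sum>d\<in>S. if compose_diagrams n d1 d2 = d then ?t d1 d2 * F d else 0) =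
        ?t d1 d2 * F (compose_diagrams n d1 d2)"
      using finite_S by simp
  qed
  finally show ?thesis .
qed

lemma mult_assoc_A: "f \<otimes>\<^bsub>A\<^esub> g \<otimes>\<^bsub>A\<^esub> h = f \<otimes>\<^bsub>A\<^esub> (g \<otimes>\<^bsub>A\<^esub> h)"
proof
  fix d
  let ?c = "compose_diagrams n" and ?l = "closed_loops n"
  have "(f \<otimes>\<^bsub>A\<^esub> g \<otimes>\<^bsub>A\<^esub> h) d =
      (\<Sum>c\<in>S. (f \<otimes>\<^bsub>A\<^esub> g) c * (\<Sum>d3\<in>S. if ?c c d3 = d then h d3 * \<delta> ^ ?l c d3 else 0))"
    unfolding mult_apply[of "f \<otimes>\<^bsub>A\<^esub> g"] sum_distrib_left
    by (intro sum.cong refl) (simp add: mult.assoc)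
  also have "\<dots> = (\<Sum>d1\<in>S. \<Sum>d2\<in>S. \<Sum>d3\<in>S. if ?c (?c d1 d2) d3 = d
      then f d1 * g d2 * h d3 * \<delta> ^ (?l d1 d2 + ?l (?c d1 d2) d3) else 0)"
    unfolding sum_mult unfolding sum_distrib_left
    by (intro sum.cong refl) (simp add: power_add mult_ac)
  also have "\<dots> = (\<Sum>d1\<in>S. \<Sum>d2\<in>S. \<Sum>d3\<in>S. if ?c d1 (?c d2 d3) = d
      then f d1 * g d2 * h d3 * \<delta> ^ (?l d2 d3 + ?l d1 (?c d2 d3)) else 0)"
  proof (intro sum.cong refl)
    fix d1 d2 d3 assume d: "d1 \<in> S" "d2 \<in> S" "d3 \<in> S"
    note sub = brauer_union_subset[OF symmetric_diagramD(1)[OF d(1)]]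
      brauer_union_subset[OF symmetric_diagramD(1)[OF d(2)]]
      brauer_union_subset[OF symmetric_diagramD(1)[OF d(3)]]
    show "(if ?c (?c d1 d2) d3 = d then f d1 * g d2 * h d3 * \<delta> ^ (?l d1 d2 + ?l (?c d1 d2) d3) else 0) =
        (if ?c d1 (?c d2 d3) = d then f d1 * g d2 * h d3 * \<delta> ^ (?l d2 d3 + ?l d1 (?c d2 d3)) else 0)"
      unfolding compose_assoc_loops[OF sub] ..
  qed
  also have "\<dots> = (\<Sum>d1\<in>S. f d1 * (\<Sum>d2\<in>S. \<Sum>d3\<in>S. g d2 * h d3 * \<delta> ^ ?l d2 d3 *
      (if ?c d1 (?c d2 d3) = d then \<delta> ^ ?l d1 (?c d2 d3) else 0)))"
    unfolding sum_distrib_left by (intro sum.cong refl) (simp add: power_add mult_ac)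
  also have "\<dots> = (\<Sum>d1\<in>S. f d1 * (\<Sum>c\<in>S. (g \<otimes>\<^bsub>A\<^esub> h) c * (if ?c d1 c = d then \<delta> ^ ?l d1 c else 0)))"
    unfolding sum_mult[of g h] ..
  also have "\<dots> = (f \<otimes>\<^bsub>A\<^esub> (g \<otimes>\<^bsub>A\<^esub> h)) d"
    unfolding mult_apply[of f "g \<otimes>\<^bsub>A\<^esub> h"] sum_distrib_left
    by (intro sum.cong refl) (simp add: mult.assoc)
  finally show "(f \<otimes>\<^bsub>A\<^esub> g \<otimes>\<^bsub>A\<^esub> h) d = (f \<otimes>\<^bsub>A\<^esub> (g \<otimes>\<^bsub>A\<^esub> h)) d" .
qed

lemma mult_carrier: "f \<otimes>\<^bsub>A\<^esub> g \<in> carrier A"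
proof -
  have "(f \<otimes>\<^bsub>A\<^esub> g) d = 0" if "d \<notin> S" for d
    unfolding mult_apply
  proof (intro sum.neutral ballI)
    fix d1 d2 assume "d1 \<in> S" "d2 \<in> S"
    then have "compose_diagrams n d1 d2 \<noteq> d" using compose_symmetric that by blast
    then show "(if compose_diagrams n d1 d2 = d then f d1 * g d2 * \<delta> ^ closed_loops n d1 d2 else 0) = 0"
      by simp
  qed
  then show ?thesis by (simp add: algebra_simps_A)
qed

lemma mult_add_left: "(\<lambda>d. f d + g d) \<otimes>\<^bsub>A\<^esub> h = (\<lambda>d. (f \<otimes>\<^bsub>A\<^esub> h) d + (g \<otimes>\<^bsub>A\<^esub> h) d)"
  by (intro ext) (auto simp: mult_apply sum.distrib[symmetric] distrib_right intro!: sum.cong)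

lemma mult_add_right: "h \<otimes>\<^bsub>A\<^esub> (\<lambda>d. f d + g d) = (\<lambda>d. (h \<otimes>\<^bsub>A\<^esub> f) d + (h \<otimes>\<^bsub>A\<^esub> g) d)"
  by (intro ext) (auto simp: mult_apply sum.distrib[symmetric] distrib_left distrib_right intro!: sum.cong)

lemma mult_scale_left: "scale_fun c f \<otimes>\<^bsub>A\<^esub> g = scale_fun c (f \<otimes>\<^bsub>A\<^esub> g)"
  by (intro ext) (auto simp: mult_apply sum_distrib_left mult_ac intro!: sum.cong)

lemma mult_scale_right: "f \<otimes>\<^bsub>A\<^esub> scale_fun c g = scale_fun c (f \<otimes>\<^bsub>A\<^esub> g)"
  by (intro ext) (auto simp: mult_apply sum_distrib_left mult_ac intro!: sum.cong)

lemma mult_basis_right: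
  assumes e: "e \<in> S"
  shows "(f \<otimes>\<^bsub>A\<^esub> basis e) d = (\<Sum>d1\<in>S. if compose_diagrams n d1 e = d then f d1 * \<delta> ^ closed_loops n d1 e else 0)"
  unfolding mult_apply
proof (rule sum.cong[OF refl])
  fix d1
  have "(\<Sum>d2\<in>S. if compose_diagrams n d1 d2 = d then f d1 * basis e d2 * \<delta> ^ closed_loops n d1 d2 else 0) =
      (\<Sum>d2\<in>S. if d2 = e then (if compose_diagrams n d1 e = d then f d1 * \<delta> ^ closed_loops n d1 e else 0) else 0)"
    by (rule sum.cong[OF refl]) (simp add: basis_def)
  also have "\<dots> = (if compose_diagrams n d1 e = d then f d1 * \<delta> ^ closed_loops n d1 e else 0)"
    using e finite_S by simp
  finally show "(\<Sum>d2\<in>S. if compose_diagrams n d1 d2 = d then f d1 * basis e d2 * \<delta> ^ closed_loops n d1 d2 else 0) =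
      (if compose_diagrams n d1 e = d then f d1 * \<delta> ^ closed_loops n d1 e else 0)" .
qed

lemma mult_basis_left:
  assumes e: "e \<in> S"
  shows "(basis e \<otimes>\<^bsub>A\<^esub> f) d = (\<Sum>d2\<in>S. if compose_diagrams n e d2 = d then f d2 * \<delta> ^ closed_loops n e d2 else 0)"
proof -
  have "(basis e \<otimes>\<^bsub>A\<^esub> f) d = (\<Sum>d1\<in>S. if d1 = e then
      (\<Sum>d2\<in>S. if compose_diagrams n e d2 = d then f d2 * \<delta> ^ closed_loops n e d2 else 0) else 0)"
    unfolding mult_apply
  proof (rule sum.cong[OF refl])
    fix d1
    show "(\<Sum>d2\<in>S. if compose_diagrams n d1 d2 = d then basis e d1 * f d2 * \<delta> ^ closed_loops n d1 d2 else 0) =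
        (if d1 = e then (\<Sum>d2\<in>S. if compose_diagrams n e d2 = d then f d2 * \<delta> ^ closed_loops n e d2 else 0) else 0)"
      by (cases "d1 = e") (simp_all add: basis_def cong: if_cong)
  qed
  then show ?thesis using e finite_S by simp
qed

lemma basis_mult:
  assumes d: "d1 \<in> S" "d2 \<in> S"
  shows "basis d1 \<otimes>\<^bsub>A\<^esub> basis d2 = scale_fun (\<delta> ^ closed_loops n d1 d2) (basis (compose_diagrams n d1 d2))"
proof
  fix d
  have "(basis d1 \<otimes>\<^bsub>A\<^esub> basis d2) d =
      (\<Sum>c\<in>S. if c = d1 then (if compose_diagrams n d1 d2 = d then \<delta> ^ closed_loops n d1 d2 else 0) else 0)"
    unfolding mult_basis_right[OF d(2)] by (rule sum.cong[OF refl]) (simp add: basis_def)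
  then show "(basis d1 \<otimes>\<^bsub>A\<^esub> basis d2) d = scale_fun (\<delta> ^ closed_loops n d1 d2) (basis (compose_diagrams n d1 d2)) d"
    using d(1) finite_S by (simp add: basis_def)
qed

lemma arc_config_empty: "arc_config n {}"
  by (simp add: arc_config_def)

lemma identity_S: "identity_diagram n \<in> S"
  unfolding identity_eq_projection by (rule projection_symmetric[OF arc_config_empty])

lemma arcs_identity: "r = 0 \<or> r = 1 \<Longrightarrow> arcs (identity_diagram n) r = {}"
  unfolding identity_eq_projection by (rule arcs_projection[OF arc_config_empty])

lemma identity_compose: "d \<in> S \<Longrightarrow> compose_diagrams n (identity_diagram n) d = d"
  and compose_identity: "d \<in> S \<Longrightarrow> compose_diagrams n d (identity_diagram n) = d"
  unfolding identity_eq_projection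
  using projection_compose[OF _ arc_config_empty] compose_projection[OF _ arc_config_empty] by simp_all

lemma identity_loops:
  assumes "d \<in> S"
  shows "closed_loops n (identity_diagram n) d = 0" "closed_loops n d (identity_diagram n) = 0"
proof -
  note I = symmetric_diagramD(1)[OF identity_S] and D = symmetric_diagramD(1)[OF assms]
  show "closed_loops n (identity_diagram n) d = 0"
    by (rule closed_loops_eq_zero[OF I D disjI1[OF arcs_identity]]) simp
  show "closed_loops n d (identity_diagram n) = 0"
    by (rule closed_loops_eq_zero[OF D I disjI2[OF arcs_identity]]) simp
qed

lemma one_mult:
  assumes "f \<in> carrier A"
  shows "basis (identity_diagram n) \<otimes>\<^bsub>A\<^esub> f = f"
proof
  fix d
  have "(basis (identity_diagram n) \<otimes>\<^bsub>A\<^esub> f) d = (\<Sum>d2\<in>S. if d2 = d then f d2 else 0)"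
    unfolding mult_basis_left[OF identity_S]
    by (rule sum.cong[OF refl]) (auto simp: identity_compose identity_loops)
  then show "(basis (identity_diagram n) \<otimes>\<^bsub>A\<^esub> f) d = f d"
    using finite_S carrier_outside[OF assms, of d] by (cases "d \<in> S") simp_all
qed

lemma mult_one:
  assumes "f \<in> carrier A"
  shows "f \<otimes>\<^bsub>A\<^esub> basis (identity_diagram n) = f"
proof
  fix d
  have "(f \<otimes>\<^bsub>A\<^esub> basis (identity_diagram n)) d = (\<Sum>d2\<in>S. if d2 = d then f d2 else 0)"
    unfolding mult_basis_right[OF identity_S]
    by (rule sum.cong[OF refl]) (auto simp: compose_identity identity_loops)
  then show "(f \<otimes>\<^bsub>A\<^esub> basis (identity_diagram n)) d = f d"
    using finite_S carrier_outside[OF assms, of d] by (cases "d \<in> S") simp_all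
qed

lemma basis_carrier: "d \<in> S \<Longrightarrow> basis d \<in> carrier A"
  by (auto simp: algebra_simps_A basis_def)

lemma scale_carrier: "f \<in> carrier A \<Longrightarrow> scale_fun c f \<in> carrier A"
  by (simp add: algebra_simps_A)

lemma ring_A: "ring A"
proof (rule ringI)
  show "abelian_group A"
  proof (rule abelian_groupI)
    show "\<exists>y\<in>carrier A. y \<oplus>\<^bsub>A\<^esub> x = \<zero>\<^bsub>A\<^esub>" if "x \<in> carrier A" for x
      using that by (intro bexI[of _ "\<lambda>d. - x d"]) (simp_all add: algebra_simps_A)
  qed (auto simp: algebra_simps_A add_ac)
  show "Group.monoid A"
    by (rule Group.monoidI)
      (simp_all add: mult_carrier mult_assoc_A one_mult mult_one basis_carrier[OF identity_S] algebra_simps_A(4))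
  show "(x \<oplus>\<^bsub>A\<^esub> y) \<otimes>\<^bsub>A\<^esub> z = x \<otimes>\<^bsub>A\<^esub> z \<oplus>\<^bsub>A\<^esub> y \<otimes>\<^bsub>A\<^esub> z" for x y z
    unfolding algebra_simps_A(3) by (rule mult_add_left)
  show "z \<otimes>\<^bsub>A\<^esub> (x \<oplus>\<^bsub>A\<^esub> y) = z \<otimes>\<^bsub>A\<^esub> x \<oplus>\<^bsub>A\<^esub> z \<otimes>\<^bsub>A\<^esub> y" for x y z
    unfolding algebra_simps_A(3) by (rule mult_add_right)
qed

sublocale ring A by (rule ring_A)

lemma minus_apply:
  assumes "f \<in> carrier A" "g \<in> carrier A"
  shows "f \<ominus>\<^bsub>A\<^esub> g = (\<lambda>d. f d - g d)"
proof -
  have "(\<lambda>d. f d - g d) \<in> carrier A" using assms by (simp add: algebra_simps_A)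
  then show ?thesis
    using minus_eq_if_eq_plus[of f "\<lambda>d. f d - g d" g] assms(2) by (simp add: algebra_simps_A(3))
qed

lemma finsum_apply:
  assumes "finite B" "F \<in> B \<rightarrow> carrier A"
  shows "(\<Oplus>\<^bsub>A\<^esub>b\<in>B. F b) d = (\<Sum>b\<in>B. F b d)"
  using assms
proof (induction B)
  case empty
  then show ?case by (simp add: algebra_simps_A(2))
next
  case (insert b B)
  then have "(\<Oplus>\<^bsub>A\<^esub>b\<in>insert b B. F b) = F b \<oplus>\<^bsub>A\<^esub> (\<Oplus>\<^bsub>A\<^esub>b\<in>B. F b)"
    by (intro finsum_insert) auto
  then show ?case using insert by (simp add: algebra_simps_A(3))
qed

text \<open>Left ideals are subspaces, because scalars act through multiples of the unit, and the dimension bounds chains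
  of subspaces.\<close>

lemma finite_left_length_A: "finite_left_length A"
proof -
  have sub: "fun_space.subspace I" if I: "left_ideal A I" for I
  proof -
    note Im = left_ideal_mem[OF I]
    have "scale_fun c f \<in> I" if f: "f \<in> I" for c f
    proof -
      have "scale_fun c \<one>\<^bsub>A\<^esub> \<otimes>\<^bsub>A\<^esub> f \<in> I" using Im(4)[OF scale_carrier[OF one_closed] f] .
      moreover have "scale_fun c \<one>\<^bsub>A\<^esub> \<otimes>\<^bsub>A\<^esub> f = scale_fun c f"
        using mult_scale_left Im(1) f by auto
      ultimately show ?thesis by simp
    qed
    moreover have "f + g \<in> I" if "f \<in> I" "g \<in> I" for f g
      using Im(3)[OF that] by (simp add: algebra_simps_A(3) plus_fun_def)
    moreover have "0 \<in> I" using Im(2) by (simp add: algebra_simps_A(2) zero_fun_def)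
    ultimately show ?thesis unfolding fun_space.subspace_def by blast
  qed
  have span: "carrier A \<subseteq> fun_space.span (basis ` S)"
  proof
    fix f assume f: "f \<in> carrier A"
    have "f = (\<Sum>d\<in>S. scale_fun (f d) (basis d))"
    proof
      fix x
      have "(\<Sum>d\<in>S. scale_fun (f d) (basis d)) x = (\<Sum>d\<in>S. if d = x then f d else 0)"
        unfolding sum_fun_apply by (rule sum.cong[OF refl]) (simp add: basis_def)
      then show "f x = (\<Sum>d\<in>S. scale_fun (f d) (basis d)) x"
        using finite_S carrier_outside[OF f, of x] by (cases "x \<in> S") simp_all
    qed
    also have "\<dots> \<in> fun_space.span (basis ` S)"
      by (intro fun_space.span_sum fun_space.span_scale fun_space.span_base imageI)
    finally show "f \<in> fun_space.span (basis ` S)" .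
  qed
  show ?thesis
    unfolding finite_left_length_def
  proof (intro exI allI impI)
    fix I K assume IK: "left_ideal A I" "left_ideal A K" "I \<subset> K"
    show "fun_space.dim I < fun_space.dim K"
      by (rule subspace_dim_strict_mono[OF sub[OF IK(1)] IK(3), of "basis ` S"])
        (use left_ideal_mem(1)[OF IK(2)] span finite_S in auto)
  qed
qed

section \<open>Small characteristic\<close>

text \<open>Arcs survive composition, so both factors of the identity consist of through strands only. They belong to
  a group, where one-sided inverses are inverses.\<close>

lemma compose_eq_identity_commute:
  assumes d: "d1 \<in> S" "d2 \<in> S" and eq: "compose_diagrams n d1 d2 = identity_diagram n"
  shows "compose_diagrams n d2 d1 = identity_diagram n \<and> closed_loops n d1 d2 = 0 \<and> closed_loops n d2 d1 = 0"
proof -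
  note B = symmetric_diagramD(1)[OF d(1)] symmetric_diagramD(1)[OF d(2)]
  have "arcs d1 0 = {}" "arcs d2 1 = {}"
    using arcs_compose_top[OF B] arcs_compose_bottom[OF B] arcs_identity unfolding eq by blast+
  then have a: "arcs d1 1 = {}" "arcs d2 1 = {}"
    using card_arcs_eq[OF B(1)] finite_arcs[OF B(1), of 1] by simp_all
  have inv: "compose_diagrams n (flip d1) d1 = identity_diagram n"
    using compose_flip[OF flip_symmetric[OF d(1)]]
    unfolding flip_flip arcs_flip a identity_eq_projection .
  have "d2 = compose_diagrams n (compose_diagrams n (flip d1) d1) d2"
    unfolding inv using identity_compose[OF d(2)] by simp
  also have "\<dots> = compose_diagrams n (flip d1) (identity_diagram n)"
    using compose_assoc[OF flip_symmetric[OF d(1)] d] eq by simp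
  also have "\<dots> = flip d1" using compose_identity[OF flip_symmetric[OF d(1)]] .
  finally have "compose_diagrams n d2 d1 = identity_diagram n" using inv by simp
  then show ?thesis
    using closed_loops_eq_zero[OF B] closed_loops_eq_zero[OF B(2,1)] a by simp
qed

lemma trace_identity_coefficient: "trace_functional A (\<lambda>f. f (identity_diagram n))"
  unfolding trace_functional_def
proof (intro ballI conjI)
  fix f g
  let ?i = "identity_diagram n" and ?c = "compose_diagrams n" and ?l = "closed_loops n"
  show "(f \<oplus>\<^bsub>A\<^esub> g) ?i = f ?i + g ?i" by (simp add: algebra_simps_A(3))
  have "(f \<otimes>\<^bsub>A\<^esub> g) ?i = (\<Sum>d1\<in>S. \<Sum>d2\<in>S. if ?c d2 d1 = ?i then g d2 * f d1 * \<delta> ^ ?l d2 d1 else 0)"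
    unfolding mult_apply
  proof (intro sum.cong refl)
    fix d1 d2 assume d: "d1 \<in> S" "d2 \<in> S"
    show "(if ?c d1 d2 = ?i then f d1 * g d2 * \<delta> ^ ?l d1 d2 else 0) =
        (if ?c d2 d1 = ?i then g d2 * f d1 * \<delta> ^ ?l d2 d1 else 0)"
      using compose_eq_identity_commute[OF d] compose_eq_identity_commute[OF d(2,1)]
      by (auto simp: mult.commute)
  qed
  also have "\<dots> = (g \<otimes>\<^bsub>A\<^esub> f) ?i" unfolding mult_apply by (rule sum.swap)
  finally show "(f \<otimes>\<^bsub>A\<^esub> g) ?i = (g \<otimes>\<^bsub>A\<^esub> f) ?i" .
qed

text \<open>Otherwise \<open>p\<close> divides the order \<open>2 ^ n * fact n\<close> of the group of permutation diagrams. By Sylow's theorem it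
  has a subgroup \<open>H\<close> of order \<open>p\<close>. The sum \<open>x\<close> of its elements is nilpotent, since \<open>x\<^sup>2 = p x = 0\<close>, but
  the identity diagram has the coefficient 1 in it.\<close>

lemma quasi_hereditary_char_large:
  assumes qh: "quasi_hereditary A"
  shows "CHAR('r) = 0 \<or> CHAR('r) > n"
proof (rule ccontr)
  assume "\<not> (CHAR('r) = 0 \<or> CHAR('r) > n)"
  then have p: "CHAR('r) > 0" "CHAR('r) \<le> n" by auto
  let ?p = "CHAR('r)" and ?G = "arc_group n {}"
  have prime: "prime ?p" using p(1) by (rule prime_CHAR_semidom)
  interpret G: group ?G by (rule group_arc_group[OF arc_config_empty])
  have "?p dvd fact n" using p(2) prime prime_dvd_fact_iff by blast
  then have "?p dvd order ?G"
    unfolding order_def card_arc_group[OF arc_config_empty] by simp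
  then obtain m where "order ?G = ?p ^ 1 * m" by (auto elim: dvdE)
  then obtain H where H: "subgroup H ?G" "card H = ?p"
    using sylow_thm[OF prime group_arc_group[OF arc_config_empty] _ finite_arc_group] by fastforce
  interpret H: subgroup H ?G by (rule H(1))
  have HS: "h \<in> S \<and> arcs h 0 = {} \<and> arcs h 1 = {}" if "h \<in> H" for h
    using H.subset that by (auto simp: arc_group_def)
  define x :: "diagram \<Rightarrow> 'r" where "x = (\<lambda>d. if d \<in> H then 1 else 0)"
  have xA: "x \<in> carrier A" using HS by (auto simp: x_def algebra_simps_A)
  have "x \<otimes>\<^bsub>A\<^esub> x = \<zero>\<^bsub>A\<^esub>"
  proof
    fix d
    have sub: "H \<subseteq> S" using HS by blast
    have "(x \<otimes>\<^bsub>A\<^esub> x) d = (\<Sum>h\<in>H. \<Sum>k\<in>H. if compose_diagrams n h k = d then 1 else 0)"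
    proof -
      have "(x \<otimes>\<^bsub>A\<^esub> x) d = (\<Sum>h\<in>S. if h \<in> H then (\<Sum>k\<in>S. if k \<in> H then
          (if compose_diagrams n h k = d then 1 else 0) else 0) else 0)"
        unfolding mult_apply
      proof (intro sum.cong refl)
        fix h assume "h \<in> S"
        show "(\<Sum>k\<in>S. if compose_diagrams n h k = d then x h * x k * \<delta> ^ closed_loops n h k else 0) =
          (if h \<in> H then (\<Sum>k\<in>S. if k \<in> H then (if compose_diagrams n h k = d then 1 else 0) else 0) else 0)"
        proof (cases "h \<in> H")
          case h: True
          have "closed_loops n h k = 0" if "k \<in> S" for k
            using closed_loops_eq_zero[OF symmetric_diagramD(1) symmetric_diagramD(1)[OF that], of h] HS[OF h] by simp
          then show ?thesis using h by (auto simp: x_def intro!: sum.cong)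
        qed (simp add: x_def cong: if_cong)
      qed
      also have "\<dots> = (\<Sum>h\<in>H. \<Sum>k\<in>H. if compose_diagrams n h k = d then 1 else 0)"
        using sub finite_S by (simp add: sum.inter_restrict[symmetric] Int_absorb1)
      finally show ?thesis .
    qed
    also have "\<dots> = 0"
    proof (cases "d \<in> H")
      case d: True
      \<comment> \<open>so each element of \<open>H\<close> is a product of two elements of \<open>H\<close> in \<open>card H\<close> ways\<close>
      have "(\<Sum>k\<in>H. if compose_diagrams n h k = d then 1 else 0 :: 'r) = 1" if h: "h \<in> H" for h
      proof -
        have hG: "h \<in> carrier ?G" using H.subset h by blast
        have "compose_diagrams n h k = d \<longleftrightarrow> k = inv\<^bsub>?G\<^esub> h \<otimes>\<^bsub>?G\<^esub> d" if "k \<in> H" for k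
        proof -
          have kG: "k \<in> carrier ?G" "d \<in> carrier ?G" using H.subset that d by blast+
          have "h \<otimes>\<^bsub>?G\<^esub> k = d \<longleftrightarrow> k = inv\<^bsub>?G\<^esub> h \<otimes>\<^bsub>?G\<^esub> d"
            using G.inv_solve_left'[OF kG(1) hG kG(2)] by metis
          then show ?thesis by (simp add: arc_group_def)
        qed
        then have "(\<Sum>k\<in>H. if compose_diagrams n h k = d then 1 else 0 :: 'r) =
            (\<Sum>k\<in>H. if k = inv\<^bsub>?G\<^esub> h \<otimes>\<^bsub>?G\<^esub> d then 1 else 0)"
          by (intro sum.cong refl) simp
        also have "\<dots> = 1"
          using H.m_closed[OF H.m_inv_closed[OF h] d] finite_subset[OF sub finite_S] by simp
        finally show ?thesis .
      qed
      then have "(\<Sum>h\<in>H. \<Sum>k\<in>H. if compose_diagrams n h k = d then 1 else 0 :: 'r) = of_nat (card H)"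
        by simp
      then show ?thesis using H(2) of_nat_CHAR by simp
    next
      case False
      have "compose_diagrams n h k \<noteq> d" if "h \<in> H" "k \<in> H" for h k
        using H.m_closed[OF that] False by (auto simp: arc_group_def)
      then show ?thesis by (intro sum.neutral ballI) simp
    qed
    finally show "(x \<otimes>\<^bsub>A\<^esub> x) d = \<zero>\<^bsub>A\<^esub> d" by (simp add: algebra_simps_A(2))
  qed
  then have "x [^]\<^bsub>A\<^esub> (2::nat) = \<zero>\<^bsub>A\<^esub>" using xA by (simp add: numeral_2_eq_2)
  then have "x (identity_diagram n) = 0"
    using quasi_hereditary_trace_nilpotent[OF qh finite_left_length_A xA _ trace_identity_coefficient] by blast
  moreover have "identity_diagram n \<in> H"
    using H.one_closed by (simp add: arc_group_def identity_eq_projection)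
  ultimately show False by (simp add: x_def)
qed

end

section \<open>Parameter zero\<close>

lemma conn_map:
  assumes "(x, y) \<in> conn E" and "\<And>e x y. e \<in> E \<Longrightarrow> x \<in> e \<Longrightarrow> y \<in> e \<Longrightarrow> (h x, h y) \<in> conn F"
  shows "(h x, h y) \<in> conn F"
  using assms(1)
proof (induction rule: conn_induct)
  case (step y z e)
  then show ?case using conn_trans[OF step.IH assms(2)[of e y z]] by blast
qed simp

text \<open>Join the top and bottom nodes in equal positions: drawn on an annulus, this is the usual closure of a diagram.\<close>

definition closure_connected :: "nat \<Rightarrow> diagram \<Rightarrow> bool" where
  "closure_connected n d \<longleftrightarrow>
     (\<forall>x\<in>outer_rows n. \<forall>y\<in>outer_rows n. (x, y) \<in> conn (d \<union> identity_diagram n))"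

text \<open>Two stacked diagrams on an annulus. Rows 0 and 2 stand for the same circle of nodes; they are kept apart and joined by
  edges, so that the stack itself is a subgraph.\<close>

definition annulus :: "nat \<Rightarrow> diagram \<Rightarrow> diagram \<Rightarrow> node set set" where
  "annulus n d1 d2 = stack_edges d1 d2 \<union> (`) spread ` identity_diagram n"

definition annulus_connected :: "nat \<Rightarrow> diagram \<Rightarrow> diagram \<Rightarrow> bool" where
  "annulus_connected n d1 d2 \<longleftrightarrow>
     (\<forall>x\<in>node_row n 0 \<union> node_row n 1 \<union> node_row n 2. \<forall>y\<in>node_row n 0 \<union> node_row n 1 \<union> node_row n 2.
        (x, y) \<in> conn (annulus n d1 d2))"

lemma annulus_link:
  assumes "j \<in> {1..2 * n}"
  shows "((0, j), (2, j)) \<in> conn (annulus n d1 d2)"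
proof (rule conn_edge)
  have "{(0, j), (1, j)} \<in> identity_diagram n" using assms unfolding identity_diagram_def by blast
  then have "spread ` {(0, j), (1, j)} \<in> (`) spread ` identity_diagram n" by (rule imageI)
  then show "spread ` {(0, j), (1, j)} \<in> annulus n d1 d2" by (simp add: annulus_def)
qed (simp_all add: spread_def)

lemma annulus_linkE:
  assumes "e \<in> (`) spread ` identity_diagram n"
  obtains j where "j \<in> {1..2 * n}" "e = {(0, j), (2, j)}"
  using assms unfolding identity_diagram_def by (auto simp: spread_def)

text \<open>Turning the annulus exchanges the two diagrams. The map \<open>h\<close> performs the turn on nodes: rows 0
  and 2, which are joined, both become the middle row, and the middle row becomes row 2.\<close>

lemma annulus_connected_commute:
  assumes d: "\<Union>d1 \<subseteq> outer_rows n" "\<Union>d2 \<subseteq> outer_rows n" and c: "annulus_connected n d1 d2"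
  shows "annulus_connected n d2 d1"
proof -
  let ?F = "annulus n d2 d1"
  define h :: "node \<Rightarrow> node" where "h = map_prod (\<lambda>r. if r = 1 then 2 else 1) id"
  have upper: "(x, y) \<in> conn ?F" if "f \<in> d2" "x \<in> f" "y \<in> f" for f x y
    by (rule conn_edge[of f]) (use that in \<open>simp_all add: annulus_def stack_edges_eq\<close>)
  have edge: "(h x, h y) \<in> conn ?F" if e: "e \<in> annulus n d1 d2" "x \<in> e" "y \<in> e" for e x y
  proof -
    consider "e \<in> d1" | f where "f \<in> d2" "e = shift ` f" | "e \<in> (`) spread ` identity_diagram n"
      using e(1) unfolding annulus_def stack_edges_eq by blast
    then show ?thesis
    proof cases
      case 1
      have h: "h z = shift z" if "z \<in> e" for z
      proof -
        have "z \<in> outer_rows n" using d(1) 1 that by blast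
        then show ?thesis by (elim outer_rowsE) (simp_all add: h_def shift_def)
      qed
      have "(shift x, shift y) \<in> conn ?F"
        by (rule conn_edge[of "shift ` e"]) (use 1 e in \<open>simp_all add: annulus_def stack_edges_eq\<close>)
      then show ?thesis using h e(2,3) by simp
    next
      case 2
      have h: "(h (shift u), u) \<in> conn ?F" if "u \<in> f" for u
      proof -
        have "u \<in> outer_rows n" using d(2) 2(1) that by blast
        then show ?thesis
        proof (cases rule: outer_rowsE)
          case (1 j)
          then have "h (shift u) = (2, j)" by (simp add: h_def shift_def)
          then show ?thesis using conn_sym[OF annulus_link[OF 1(2)]] 1(1) by simp
        next
          case (2 j)
          then have "h (shift u) = u" by (simp add: h_def shift_def)
          then show ?thesis by simp
        qed
      qed
      obtain u v where uv: "x = shift u" "y = shift v" "u \<in> f" "v \<in> f" using e(2,3) unfolding 2(2) by blast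
      have "(h x, u) \<in> conn ?F" "(u, v) \<in> conn ?F" "(v, h y) \<in> conn ?F"
        using h[OF uv(3)] upper[OF 2(1) uv(3,4)] conn_sym[OF h[OF uv(4)]] unfolding uv(1,2) by simp_all
      then show ?thesis by (blast intro: conn_trans)
    next
      case 3
      then obtain j where "e = {(0, j), (2, j)}" by (rule annulus_linkE)
      then have "h x = h y" using e(2,3) by (auto simp: h_def)
      then show ?thesis by simp
    qed
  qed
  have cover: "\<exists>x\<in>node_row n 0 \<union> node_row n 1 \<union> node_row n 2. (h x, u) \<in> conn ?F"
    if u: "u \<in> node_row n 0 \<union> node_row n 1 \<union> node_row n 2" for u
  proof -
    obtain r j where rj: "u = (r, j)" "j \<in> {1..2 * n}" "r = 0 \<or> r = 1 \<or> r = 2"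
      using u by (auto simp: node_row_def)
    have N: "(0, j) \<in> node_row n 0" "(1, j) \<in> node_row n 1" using rj(2) by (simp_all add: row_mem_iff)
    have h: "h (0, j) = (1, j)" "h (1, j) = (2, j)" by (simp_all add: h_def)
    from rj(3) consider "r = 0" | "r = 1" | "r = 2" by blast
    then show ?thesis
    proof cases
      case 1
      have "(h (1, j), u) \<in> conn ?F"
        using conn_sym[OF annulus_link[OF rj(2)]] unfolding h rj(1) 1 .
      then show ?thesis using N by blast
    next
      case 2
      have "(h (0, j), u) \<in> conn ?F" unfolding h rj(1) 2 by simp
      then show ?thesis using N by blast
    next
      case 3
      have "(h (1, j), u) \<in> conn ?F" unfolding h rj(1) 3 by simp
      then show ?thesis using N by blast
    qed
  qed
  show ?thesis
    unfolding annulus_connected_def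
  proof (intro ballI)
    let ?N = "node_row n 0 \<union> node_row n 1 \<union> node_row n 2"
    fix u v assume "u \<in> ?N" "v \<in> ?N"
    then obtain x y where xy: "x \<in> ?N" "(h x, u) \<in> conn ?F" "y \<in> ?N" "(h y, v) \<in> conn ?F"
      using cover by meson
    have "(x, y) \<in> conn (annulus n d1 d2)" using c xy(1,3) unfolding annulus_connected_def by blast
    then have "(h x, h y) \<in> conn ?F" using edge by (rule conn_map)
    then show "(u, v) \<in> conn ?F" using conn_trans[OF conn_trans[OF conn_sym[OF xy(2)]] xy(4)] by blast
  qed
qed

text \<open>A closed loop in the middle row would be a separate component of the annulus. Without such loops every node is
  connected to an outer one, and contracting the middle row turns the stack into the composite.\<close>

lemma annulus_connected_iff:
  assumes n: "n \<ge> 1" and d1: "d1 \<in> symmetric_diagrams n" and d2: "d2 \<in> symmetric_diagrams n"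
  shows "annulus_connected n d1 d2 \<longleftrightarrow>
    closed_loops n d1 d2 = 0 \<and> closure_connected n (compose_diagrams n d1 d2)"
proof -
  let ?N = "node_row n 0 \<union> node_row n 1 \<union> node_row n 2"
  let ?E = "stack_edges d1 d2" and ?L = "(`) spread ` identity_diagram n" and ?c = "compose_diagrams n d1 d2"
  note sub = brauer_union_subset[OF symmetric_diagramD(1)[OF d1]] brauer_union_subset[OF symmetric_diagramD(1)[OF d2]]
  have L: "e \<inter> node_row n 1 = {}" if "e \<in> ?L" for e
    using that spread_not_middle by blast
  have contract: "(spread x, spread y) \<in> conn (annulus n d1 d2) \<longleftrightarrow> (x, y) \<in> conn (?c \<union> identity_diagram n)" for x y
  proof -
    have "(spread x, spread y) \<in> conn (annulus n d1 d2) \<longleftrightarrow>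
        (spread x, spread y) \<in> conn ((`) spread ` ?c \<union> ?L)"
      unfolding annulus_def
      by (rule contracts_conn[OF contracts_stack[OF sub] L spread_not_middle spread_not_middle])
    also have "\<dots> \<longleftrightarrow> (x, y) \<in> conn (?c \<union> identity_diagram n)"
      unfolding image_Un[symmetric] by (rule conn_image_inj_iff[OF inj_spread])
    finally show ?thesis .
  qed
  have E_sub: "(x, y) \<in> conn (annulus n d1 d2)" if "(x, y) \<in> conn ?E" for x y
    by (rule conn_mono[OF _ that]) (simp add: annulus_def)
  have fin: "finite (closed_classes ?E (node_row n 1))" by (rule finite_closed_classes) simp
  have loops: "closed_loops n d1 d2 = 0 \<longleftrightarrow> closed_classes ?E (node_row n 1) = {}"
    unfolding closed_loops_eq using fin by (rule card_0_eq)
  show ?thesis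
  proof
    assume W: "annulus_connected n d1 d2"
    have "closure_connected n ?c"
      unfolding closure_connected_def
    proof (intro ballI)
      fix x y assume "x \<in> outer_rows n" "y \<in> outer_rows n"
      then have "spread x \<in> ?N" "spread y \<in> ?N" using spread_outer_iff by blast+
      then have "(spread x, spread y) \<in> conn (annulus n d1 d2)" using W unfolding annulus_connected_def by blast
      then show "(x, y) \<in> conn (?c \<union> identity_diagram n)" by (simp only: contract)
    qed
    moreover have "closed_classes ?E (node_row n 1) = {}"
    proof (rule ccontr)
      assume "closed_classes ?E (node_row n 1) \<noteq> {}"
      then obtain z where z: "z \<in> node_row n 1" "conn ?E `` {z} \<subseteq> node_row n 1"
        unfolding closed_classes_def by blast
      have "(0, 1) \<in> node_row n 0" using n by (simp add: row_mem_iff)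
      then have "(z, (0, 1)) \<in> conn (annulus n d1 d2)" using W z(1) unfolding annulus_connected_def by blast
      then have "(0, 1) \<in> conn ?E `` {z}"
      proof (rule conn_closed)
        show "z \<in> conn ?E `` {z}" by simp
        fix e assume e: "e \<in> annulus n d1 d2" "e \<inter> conn ?E `` {z} \<noteq> {}"
        then have "e \<in> ?E" using L z(2) unfolding annulus_def by blast
        show "e \<subseteq> conn ?E `` {z}"
        proof
          fix y assume y: "y \<in> e"
          obtain w where w: "w \<in> e" "(z, w) \<in> conn ?E" using e(2) by blast
          have "(w, y) \<in> conn ?E" by (rule conn_edge[OF \<open>e \<in> ?E\<close> w(1) y])
          then show "y \<in> conn ?E `` {z}" using conn_trans[OF w(2)] by simp
        qed
      qed
      then show False using z(2) by (auto simp: row_mem_iff)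
    qed
    ultimately show "closed_loops n d1 d2 = 0 \<and> closure_connected n ?c" using loops by simp
  next
    assume R: "closed_loops n d1 d2 = 0 \<and> closure_connected n ?c"
    have out: "\<exists>a\<in>outer_rows n. (x, spread a) \<in> conn (annulus n d1 d2)" if x: "x \<in> ?N" for x
    proof -
      have "\<exists>w. w \<notin> node_row n 1 \<and> (x, w) \<in> conn ?E"
      proof (cases "x \<in> node_row n 1")
        case True
        then have "\<not> conn ?E `` {x} \<subseteq> node_row n 1" using R loops unfolding closed_classes_def by blast
        then show ?thesis by blast
      qed (blast intro: conn_refl)
      then obtain w where w: "w \<notin> node_row n 1" "(x, w) \<in> conn ?E" by blast
      have "w \<in> ?N" by (rule stack_class_subset[OF sub w(2) x])
      then have "w \<in> spread ` outer_rows n" using w(1) unfolding spread_outer by blast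
      then show ?thesis using E_sub[OF w(2)] by blast
    qed
    show "annulus_connected n d1 d2"
      unfolding annulus_connected_def
    proof (intro ballI)
      fix x y assume "x \<in> ?N" "y \<in> ?N"
      then obtain a b where ab: "a \<in> outer_rows n" "(x, spread a) \<in> conn (annulus n d1 d2)"
        "b \<in> outer_rows n" "(y, spread b) \<in> conn (annulus n d1 d2)" using out by meson
      have "(a, b) \<in> conn (?c \<union> identity_diagram n)" using R ab(1,3) unfolding closure_connected_def by blast
      then have "(spread a, spread b) \<in> conn (annulus n d1 d2)" by (simp only: contract)
      then show "(x, y) \<in> conn (annulus n d1 d2)"
        by (rule conn_trans[OF conn_trans[OF ab(2)] conn_sym[OF ab(4)]])
    qed
  qed
qed

lemma involution_diagram_symmetric:
  assumes p: "\<And>x. x \<in> outer_rows n \<Longrightarrow> p x \<in> outer_rows n \<and> p (p x) = x \<and> p x \<noteq> x"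
    and r: "\<And>x. x \<in> outer_rows n \<Longrightarrow> p (reflect_node n x) = reflect_node n (p x)"
  shows "(\<lambda>x. {x, p x}) ` outer_rows n \<in> symmetric_diagrams n"
proof (rule symmetric_diagramI)
  let ?d = "(\<lambda>x. {x, p x}) ` outer_rows n"
  have eq: "{x, p x} = {z, p z}" if "x \<in> outer_rows n" "z \<in> {x, p x}" for x z
    using that p[OF that(1)] by (cases "z = x") auto
  show "?d \<in> brauer_diagrams n"
    unfolding brauer_diagram_iff
  proof (intro conjI ballI allI impI)
    show "\<Union>?d = outer_rows n" using p by blast
    show "card e = 2" if "e \<in> ?d" for e
    proof -
      obtain x where x: "x \<in> outer_rows n" "e = {x, p x}" using \<open>e \<in> ?d\<close> by blast
      then show ?thesis using p[OF x(1)] by (metis card_2_iff)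
    qed
    show "e = f" if "e \<in> ?d" "f \<in> ?d" "z \<in> e" "z \<in> f" for e f z
    proof -
      obtain x where x: "e = {x, p x}" "x \<in> outer_rows n" using \<open>e \<in> ?d\<close> by (rule imageE)
      obtain y where y: "f = {y, p y}" "y \<in> outer_rows n" using \<open>f \<in> ?d\<close> by (rule imageE)
      show ?thesis using eq[OF x(2), of z] eq[OF y(2), of z] that x(1) y(1) by simp
    qed
  qed
  fix e assume "e \<in> ?d"
  then obtain x where x: "x \<in> outer_rows n" "e = {x, p x}" by (rule imageE) simp
  then have "reflect_node n ` e = {reflect_node n x, p (reflect_node n x)}" using r by simp
  then show "reflect_node n ` e \<in> ?d" using reflect_outer[OF x(1)] by blast
qed

text \<open>In the top row the zigzag diagram joins 1 with 2, 3 with 4 and so on; in the bottom row it joins 2 with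
  3, 4 with 5, ..., and \<open>2 n\<close> with 1. Placed on the annulus these arcs form a single closed curve.\<close>

definition zigzag_partner :: "nat \<Rightarrow> node \<Rightarrow> node" where
  "zigzag_partner n = (\<lambda>(r, j).
     if r = 0 then (0, if odd j then j + 1 else j - 1)
     else (1, if j = 1 then 2 * n else if j = 2 * n then 1 else if even j then j + 1 else j - 1))"

definition zigzag :: "nat \<Rightarrow> diagram" where
  "zigzag n = (\<lambda>x. {x, zigzag_partner n x}) ` outer_rows n"

lemma zigzag_symmetric: "zigzag n \<in> symmetric_diagrams n"
  unfolding zigzag_def
proof (rule involution_diagram_symmetric)
  fix x assume "x \<in> outer_rows n"
  then show "zigzag_partner n x \<in> outer_rows n \<and> zigzag_partner n (zigzag_partner n x) = x \<and> zigzag_partner n x \<noteq> x"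
  proof (cases rule: outer_rowsE)
    case (1 j)
    have "j - 1 + 1 = j" "j \<ge> 1" "j \<le> 2 * n" using 1 by auto
    moreover have "odd j \<Longrightarrow> j + 1 \<le> 2 * n" using 1(2) by (metis atLeastAtMost_iff add.commute dvd_triv_left le_neq_implies_less plus_1_eq_Suc Suc_leI)
    moreover have "even j \<Longrightarrow> j \<ge> 2" using 1(2) by (auto elim!: evenE)
    ultimately show ?thesis using 1(1) by (auto simp: zigzag_partner_def row_mem_iff)
  next
    case (2 j)
    have j: "j \<ge> 1" "j \<le> 2 * n" using 2 by auto
    have o: "odd j \<Longrightarrow> j \<noteq> 1 \<Longrightarrow> j \<ge> 3" using j(1) by presburger
    have e: "even j \<Longrightarrow> j \<noteq> 2 * n \<Longrightarrow> j + 2 \<le> 2 * n" using j(2) by presburger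
    have o': "odd j \<Longrightarrow> j - Suc 0 \<noteq> Suc 0" by presburger
    show ?thesis using 2(1) j o o' e by (auto simp: zigzag_partner_def row_mem_iff)
  qed
next
  fix x assume "x \<in> outer_rows n"
  then show "zigzag_partner n (reflect_node n x) = reflect_node n (zigzag_partner n x)"
  proof (cases rule: outer_rowsE)
    case (1 j)
    have j: "j \<ge> 1" "j \<le> 2 * n" using 1 by auto
    have "odd (2 * n + 1 - j) \<longleftrightarrow> even j" using j by presburger
    moreover have "even j \<Longrightarrow> j \<ge> 2" "odd j \<Longrightarrow> j + 1 \<le> 2 * n" using j by presburger+
    ultimately show ?thesis using 1(1) j by (auto simp: zigzag_partner_def)
  next
    case (2 j)
    have j: "j \<ge> 1" "j \<le> 2 * n" using 2 by auto
    have "odd (2 * n + 1 - j) \<longleftrightarrow> even j" using j by presburger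
    moreover have "2 * n + 1 - j = 1 \<longleftrightarrow> j = 2 * n" "2 * n + 1 - j = 2 * n \<longleftrightarrow> j = 1" using j by presburger+
    ultimately show ?thesis using 2(1) j by (auto simp: zigzag_partner_def)
  qed
qed

lemma zigzag_closure_connected: "closure_connected n (zigzag n)"
proof -
  let ?E = "zigzag n \<union> identity_diagram n"
  have link: "((0, j), (1, j)) \<in> conn ?E" if "j \<in> {1..2 * n}" for j
    by (rule conn_edge[of "{(0, j), (1, j)}"]) (use that in \<open>auto simp: identity_diagram_def\<close>)
  have part: "(x, zigzag_partner n x) \<in> conn ?E" if "x \<in> outer_rows n" for x
    by (rule conn_edge[of "{x, zigzag_partner n x}"]) (use that in \<open>auto simp: zigzag_def\<close>)
  have top: "((0, 1), (0, j)) \<in> conn ?E" if "j \<ge> 1" "j \<le> 2 * n" for j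
    using that
  proof (induction j rule: dec_induct)
    case (step j)
    have j: "j \<in> {1..2 * n}" "Suc j \<in> {1..2 * n}" using step by auto
    have "((0, j), (0, Suc j)) \<in> conn ?E"
    proof (cases "odd j")
      case True
      then show ?thesis using part[of "(0, j)"] j(1) by (simp add: zigzag_partner_def row_mem_iff)
    next
      case False
      then have "j \<noteq> 1" "j \<noteq> 2 * n" using j(2) by auto
      then have "((1, j), (1, Suc j)) \<in> conn ?E"
        using part[of "(1, j)"] j(1) False by (simp add: zigzag_partner_def row_mem_iff)
      then show ?thesis using conn_trans[OF conn_trans[OF link[OF j(1)]] conn_sym[OF link[OF j(2)]]] by blast
    qed
    then show ?case using step j(1) conn_trans by (metis atLeastAtMost_iff)
  qed simp
  have all: "((0, 1), x) \<in> conn ?E" if "x \<in> outer_rows n" for x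
    using that
  proof (cases rule: outer_rowsE)
    case (1 j)
    then show ?thesis using top by simp
  next
    case (2 j)
    then show ?thesis using conn_trans[OF top[of j] link[OF 2(2)]] by simp
  qed
  show ?thesis
    unfolding closure_connected_def using conn_trans[OF conn_sym[OF all] all] by blast
qed

text \<open>The diagram has no through strands, so in the square no component of a middle node can leave the middle row.\<close>

lemma zigzag_loops:
  assumes "n \<ge> 1"
  shows "closed_loops n (zigzag n) (zigzag n) > 0"
proof -
  let ?E = "stack_edges (zigzag n) (zigzag n)"
  have same: "fst (zigzag_partner n x) = fst x" if "x \<in> outer_rows n" for x
    using that by (cases rule: outer_rowsE) (simp_all add: zigzag_partner_def)
  have cl: "conn ?E `` {(1, 1)} \<subseteq> node_row n 1"
  proof
    fix y assume "y \<in> conn ?E `` {(1, 1)}"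
    then have "((1, 1), y) \<in> conn ?E" by simp
    then show "y \<in> node_row n 1"
    proof (rule conn_closed)
      show "(1, 1) \<in> node_row n 1" using assms by (simp add: row_mem_iff)
      fix e assume e: "e \<in> ?E" "e \<inter> node_row n 1 \<noteq> {}"
      have zz: "\<exists>r. r \<le> 1 \<and> f \<subseteq> node_row n r" if "f \<in> zigzag n" for f
      proof -
        obtain x where x: "f = {x, zigzag_partner n x}" "x \<in> outer_rows n"
          using \<open>f \<in> zigzag n\<close> unfolding zigzag_def by (rule imageE)
        have p: "zigzag_partner n x \<in> outer_rows n"
          using brauer_union_subset[OF symmetric_diagramD(1)[OF zigzag_symmetric[of n]]] x
          unfolding zigzag_def by blast
        have row: "z \<in> node_row n (fst z) \<and> fst z \<le> 1" if "z \<in> outer_rows n" for z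
          using that by (cases rule: outer_rowsE) (simp_all add: row_mem_iff)
        show ?thesis using row[OF x(2)] row[OF p] same[OF x(2)] x(1) by (intro exI[of _ "fst x"]) auto
      qed
      have "\<exists>r. e \<subseteq> node_row n r"
      proof (cases "e \<in> zigzag n")
        case True
        then show ?thesis using zz by blast
      next
        case False
        then obtain f where f: "f \<in> zigzag n" "e = shift ` f" using e(1) unfolding stack_edges_eq by blast
        obtain r where "f \<subseteq> node_row n r" using zz[OF f(1)] by blast
        then have "e \<subseteq> node_row n (Suc r)" unfolding f(2) shift_row[symmetric] by (rule image_mono)
        then show ?thesis by blast
      qed
      then obtain r where r: "e \<subseteq> node_row n r" by blast
      have "r = 1" using node_row_disjoint[of r 1 n] r e(2) by blast
      then show "e \<subseteq> node_row n 1" using r by simp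
    qed
  qed
  have "(1, 1) \<in> node_row n 1" using assms by (simp add: row_mem_iff)
  then have "conn ?E `` {(1, 1)} \<in> closed_classes ?E (node_row n 1)"
    using cl unfolding closed_classes_def by blast
  then have "closed_classes ?E (node_row n 1) \<noteq> {}" by blast
  moreover have "finite (closed_classes ?E (node_row n 1))" by (rule finite_closed_classes) simp
  ultimately show ?thesis unfolding closed_loops_eq by (simp only: card_gt_0_iff not_False_eq_True simp_thms)
qed

context type_C_brauer
begin

text \<open>For \<open>\<delta> = 0\<close> the factor \<open>\<delta> ^ closed_loops n d1 d2\<close> vanishes precisely if there are loops. So the value at a product
  of two diagrams is 1 or 0 according to \<open>annulus_connected_iff\<close>, and the annulus can be turned.\<close>

lemma trace_closure_connected:
  assumes n: "n \<ge> 1" and \<delta>: "\<delta> = 0"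
  shows "trace_functional A (\<lambda>f. \<Sum>d\<in>S. f d * (if closure_connected n d then 1 else 0))"
    (is "trace_functional A ?\<tau>")
  unfolding trace_functional_def
proof (intro ballI conjI)
  fix f g
  show "?\<tau> (f \<oplus>\<^bsub>A\<^esub> g) = ?\<tau> f + ?\<tau> g"
    by (simp add: algebra_simps_A(3) sum.distrib[symmetric] distrib_right)
  have key: "?\<tau> (f \<otimes>\<^bsub>A\<^esub> g) = (\<Sum>d1\<in>S. \<Sum>d2\<in>S. f d1 * g d2 * (if annulus_connected n d1 d2 then 1 else 0))" for f g
    unfolding sum_mult
  proof (intro sum.cong refl)
    fix d1 d2 assume d: "d1 \<in> S" "d2 \<in> S"
    show "f d1 * g d2 * \<delta> ^ closed_loops n d1 d2 * (if closure_connected n (compose_diagrams n d1 d2) then 1 else 0) =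
        f d1 * g d2 * (if annulus_connected n d1 d2 then 1 else 0)"
      unfolding annulus_connected_iff[OF n d] \<delta> by (simp add: power_0_left)
  qed
  have "?\<tau> (f \<otimes>\<^bsub>A\<^esub> g) = (\<Sum>d1\<in>S. \<Sum>d2\<in>S. g d2 * f d1 * (if annulus_connected n d2 d1 then 1 else 0))"
    unfolding key
  proof (intro sum.cong refl)
    fix d1 d2 assume d: "d1 \<in> S" "d2 \<in> S"
    note sub = brauer_union_subset[OF symmetric_diagramD(1)[OF d(1)]] brauer_union_subset[OF symmetric_diagramD(1)[OF d(2)]]
    have "annulus_connected n d1 d2 \<longleftrightarrow> annulus_connected n d2 d1"
      using annulus_connected_commute[OF sub] annulus_connected_commute[OF sub(2,1)] by blast
    then show "f d1 * g d2 * (if annulus_connected n d1 d2 then 1 else 0) =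
        g d2 * f d1 * (if annulus_connected n d2 d1 then 1 else 0)" by simp
  qed
  also have "\<dots> = ?\<tau> (g \<otimes>\<^bsub>A\<^esub> f)" unfolding key by (rule sum.swap)
  finally show "?\<tau> (f \<otimes>\<^bsub>A\<^esub> g) = ?\<tau> (g \<otimes>\<^bsub>A\<^esub> f)" .
qed

lemma quasi_hereditary_parameter_nonzero:
  assumes n: "n \<ge> 1" and qh: "quasi_hereditary A"
  shows "\<delta> \<noteq> 0"
proof
  assume \<delta>: "\<delta> = 0"
  let ?x = "basis (zigzag n) :: diagram \<Rightarrow> 'r"
  let ?\<tau> = "\<lambda>f. \<Sum>d\<in>S. f d * (if closure_connected n d then 1 else 0)"
  have xA: "?x \<in> carrier A" by (rule basis_carrier[OF zigzag_symmetric])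
  have "?x \<otimes>\<^bsub>A\<^esub> ?x = \<zero>\<^bsub>A\<^esub>"
    unfolding basis_mult[OF zigzag_symmetric zigzag_symmetric] algebra_simps_A(2)
    using zigzag_loops[OF n] by (auto simp: \<delta> power_0_left)
  then have "?x [^]\<^bsub>A\<^esub> (2::nat) = \<zero>\<^bsub>A\<^esub>" using xA by (simp add: numeral_2_eq_2)
  then have "?\<tau> ?x = 0"
    using quasi_hereditary_trace_nilpotent[OF qh finite_left_length_A xA _ trace_closure_connected[OF n \<delta>]] by blast
  moreover have "?\<tau> ?x = (\<Sum>d\<in>S. if d = zigzag n then 1 else 0)"
    using zigzag_closure_connected by (intro sum.cong refl) (simp add: basis_def)
  ultimately show False using zigzag_symmetric[of n] finite_S by simp
qed

end

section \<open>The chain of rank ideals\<close>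

lemma arc_config_exists:
  assumes "k \<le> n"
  obtains b where "arc_config n b" "card b = k"
proof -
  let ?a = "\<lambda>j. {j, 2 * n + 1 - j}"
  have same: "i = j" if "i \<in> {1..k}" "j \<in> {1..k}" "x \<in> ?a i" "x \<in> ?a j" for i j x
    using that assms by auto
  have "arc_config n (?a ` {1..k})"
    unfolding arc_config_def
  proof (intro conjI ballI impI)
    fix a assume "a \<in> ?a ` {1..k}"
    then obtain j where j: "j \<in> {1..k}" "a = ?a j" by (rule imageE)
    have jn: "1 \<le> j" "j \<le> n" using j(1) assms by auto
    show "a \<subseteq> {1..2 * n}" unfolding j(2) using jn by auto
    show "card a = 2" unfolding j(2) using jn by simp
    have "(\<lambda>j. 2 * n + 1 - j) ` a = a" unfolding j(2) using jn by auto
    then show "(\<lambda>j. 2 * n + 1 - j) ` a \<in> ?a ` {1..k}" using j by auto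
    fix a' assume "a' \<in> ?a ` {1..k}" "a \<inter> a' \<noteq> {}"
    obtain i where i: "a' = ?a i" "i \<in> {1..k}" using \<open>a' \<in> ?a ` {1..k}\<close> by (rule imageE)
    obtain x where "x \<in> a" "x \<in> a'" using \<open>a \<inter> a' \<noteq> {}\<close> by blast
    then show "a = a'" using same[OF j(1) i(2), of x] i(1) j(2) by simp
  qed
  moreover have "inj_on ?a {1..k}"
    by (rule inj_onI) (use same in blast)
  then have "card (?a ` {1..k}) = k" by (simp add: card_image)
  ultimately show ?thesis by (rule that)
qed

context type_C_brauer
begin

text \<open>A diagram with \<open>k\<close> arcs in each row has \<open>n - k\<close> pairs of through strands, so this is the span of the
  diagrams with fewer than \<open>i\<close> such pairs. The condition is written without subtraction.\<close>

definition rank_ideal :: "nat \<Rightarrow> (diagram \<Rightarrow> 'r) set" where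
  "rank_ideal i = {f \<in> carrier A. \<forall>d. f d \<noteq> 0 \<longrightarrow> n < card (arcs d 1) + i}"

lemma mult_nonzeroE:
  assumes "(f \<otimes>\<^bsub>A\<^esub> g) d \<noteq> 0"
  obtains d1 d2 where "d1 \<in> S" "d2 \<in> S" "d = compose_diagrams n d1 d2" "f d1 \<noteq> 0" "g d2 \<noteq> 0"
proof -
  obtain d1 where d1: "d1 \<in> S" "(\<Sum>d2\<in>S. if compose_diagrams n d1 d2 = d
      then f d1 * g d2 * \<delta> ^ closed_loops n d1 d2 else 0) \<noteq> 0"
    using assms unfolding mult_apply by (rule sum.not_neutral_contains_not_neutral)
  obtain d2 where d2: "d2 \<in> S" "(if compose_diagrams n d1 d2 = d
      then f d1 * g d2 * \<delta> ^ closed_loops n d1 d2 else 0) \<noteq> 0"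
    using d1(2) by (rule sum.not_neutral_contains_not_neutral)
  show ?thesis using that[OF d1(1) d2(1)] d2(2) by (auto split: if_splits)
qed

lemma arcs_compose_mono:
  assumes "d1 \<in> S" "d2 \<in> S"
  shows "arcs d1 0 \<subseteq> arcs (compose_diagrams n d1 d2) 0" "arcs d2 1 \<subseteq> arcs (compose_diagrams n d1 d2) 1"
    "card (arcs d1 1) \<le> card (arcs (compose_diagrams n d1 d2) 1)"
    "card (arcs d2 1) \<le> card (arcs (compose_diagrams n d1 d2) 1)"
proof -
  note B = symmetric_diagramD(1)[OF assms(1)] symmetric_diagramD(1)[OF assms(2)]
  note C = compose_brauer[OF B]
  show t: "arcs d1 0 \<subseteq> arcs (compose_diagrams n d1 d2) 0" by (rule arcs_compose_top[OF B])
  show b: "arcs d2 1 \<subseteq> arcs (compose_diagrams n d1 d2) 1" by (rule arcs_compose_bottom[OF B])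
  show "card (arcs d1 1) \<le> card (arcs (compose_diagrams n d1 d2) 1)"
    using card_mono[OF finite_arcs[OF C] t] unfolding card_arcs_eq[OF B(1)] card_arcs_eq[OF C] .
  show "card (arcs d2 1) \<le> card (arcs (compose_diagrams n d1 d2) 1)"
    by (rule card_mono[OF finite_arcs[OF C] b])
qed

lemma rank_ideal_ideal: "ideal (rank_ideal i) A"
proof (rule idealI[OF ring_A])
  have left: "left_ideal A (rank_ideal i)"
  proof (rule left_idealI)
    show "rank_ideal i \<subseteq> carrier A" by (auto simp: rank_ideal_def)
    show "\<zero>\<^bsub>A\<^esub> \<in> rank_ideal i" by (simp add: rank_ideal_def algebra_simps_A)
    show "f \<oplus>\<^bsub>A\<^esub> g \<in> rank_ideal i" if fg: "f \<in> rank_ideal i" "g \<in> rank_ideal i" for f g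
    proof -
      have "n < card (arcs d 1) + i" if "(f \<oplus>\<^bsub>A\<^esub> g) d \<noteq> 0" for d
      proof -
        have "f d \<noteq> 0 \<or> g d \<noteq> 0" using that unfolding algebra_simps_A(3) by auto
        then show ?thesis using fg unfolding rank_ideal_def by blast
      qed
      moreover have "f \<oplus>\<^bsub>A\<^esub> g \<in> carrier A" using fg unfolding rank_ideal_def by blast
      ultimately show ?thesis unfolding rank_ideal_def by blast
    qed
    show "a \<otimes>\<^bsub>A\<^esub> f \<in> rank_ideal i" if f: "f \<in> rank_ideal i" for a f
    proof -
      have "n < card (arcs d 1) + i" if "(a \<otimes>\<^bsub>A\<^esub> f) d \<noteq> 0" for d
        using that
      proof (rule mult_nonzeroE)
        fix d1 d2 assume d: "d1 \<in> S" "d2 \<in> S" "d = compose_diagrams n d1 d2" "f d2 \<noteq> 0"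
        have "n < card (arcs d2 1) + i" using f d(4) unfolding rank_ideal_def by blast
        then show ?thesis using arcs_compose_mono(4)[OF d(1,2)] d(3) by simp
      qed
      then show ?thesis using mult_carrier unfolding rank_ideal_def by blast
    qed
  qed
  then show "subgroup (rank_ideal i) (add_monoid A)"
    unfolding left_ideal_def by (blast intro: additive_subgroup.a_subgroup)
  show "x \<otimes>\<^bsub>A\<^esub> f \<in> rank_ideal i" if "f \<in> rank_ideal i" "x \<in> carrier A" for f x
    by (rule left_ideal_mem(4)[OF left that(2,1)])
  show "f \<otimes>\<^bsub>A\<^esub> x \<in> rank_ideal i" if f: "f \<in> rank_ideal i" for f x
  proof -
    have "n < card (arcs d 1) + i" if "(f \<otimes>\<^bsub>A\<^esub> x) d \<noteq> 0" for d
      using that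
    proof (rule mult_nonzeroE)
      fix d1 d2 assume d: "d1 \<in> S" "d2 \<in> S" "d = compose_diagrams n d1 d2" "f d1 \<noteq> 0"
      have "n < card (arcs d1 1) + i" using f d(4) unfolding rank_ideal_def by blast
      then show ?thesis using arcs_compose_mono(3)[OF d(1,2)] d(3) by simp
    qed
    then show ?thesis using mult_carrier unfolding rank_ideal_def by blast
  qed
qed

lemma rank_ideal_carrier: "f \<in> rank_ideal i \<Longrightarrow> f \<in> carrier A"
  by (simp add: rank_ideal_def)

lemma card_arcs_le: "d \<in> S \<Longrightarrow> card (arcs d 1) \<le> n"
  by (rule card_arc_config_le[OF arc_config_arcs])

lemma rank_ideal_zero: "rank_ideal 0 = {\<zero>\<^bsub>A\<^esub>}"
proof (intro equalityI subsetI)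
  fix f assume f: "f \<in> rank_ideal 0"
  have "f d = 0" for d
  proof (rule ccontr)
    assume nz: "f d \<noteq> 0"
    then have "d \<in> S" using carrier_outside[OF rank_ideal_carrier[OF f]] by blast
    then show False using card_arcs_le f nz unfolding rank_ideal_def by fastforce
  qed
  then show "f \<in> {\<zero>\<^bsub>A\<^esub>}" by (auto simp: algebra_simps_A(2))
qed (simp add: rank_ideal_def algebra_simps_A)

lemma rank_ideal_top: "rank_ideal (Suc n) = carrier A"
  by (auto simp: rank_ideal_def)

text \<open>Projections with any number of nested arcs \<open>{j, 2 n + 1 - j}\<close> show that no layer is empty.\<close>

lemma rank_ideal_strict:
  assumes "i \<le> n"
  shows "rank_ideal i \<subset> rank_ideal (Suc i)"
proof -
  obtain b where b: "arc_config n b" "card b = n - i" using arc_config_exists[of "n - i" n] by auto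
  let ?p = "basis (projection n b) :: diagram \<Rightarrow> 'r"
  have a: "arcs (projection n b) 1 = b" by (rule arcs_projection[OF b(1)]) simp
  have "?p \<in> rank_ideal (Suc i)"
    using basis_carrier[OF projection_symmetric[OF b(1)]] a b(2) assms
    by (auto simp: rank_ideal_def basis_def)
  moreover have "?p \<notin> rank_ideal i"
  proof
    assume "?p \<in> rank_ideal i"
    then have "n < card (arcs (projection n b) 1) + i" by (simp add: rank_ideal_def basis_def)
    then show False using a b(2) assms by simp
  qed
  moreover have "rank_ideal i \<subseteq> rank_ideal (Suc i)" by (auto simp: rank_ideal_def)
  ultimately show ?thesis by blast
qed

end

section \<open>The heredity ideal in one layer\<close>

locale brauer_layer = type_C_brauer n \<delta> for n and \<delta> :: "'r::field" +
  fixes i :: nat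
  assumes parameter: "\<delta> \<noteq> 0" and i_le: "i \<le> n"
    and order_invertible: "of_nat (2 ^ i * fact i) \<noteq> (0 :: 'r)"
begin

abbreviation k where "k \<equiv> n - i"

definition configs :: "nat set set set" where
  "configs = {b. arc_config n b \<and> card b = k}"

text \<open>Since \<open>projection n b\<close> composed with itself gives itself and \<open>k\<close> closed loops, this multiple is idempotent.\<close>

definition e :: "nat set set \<Rightarrow> diagram \<Rightarrow> 'r" where
  "e b = scale_fun (inverse (\<delta> ^ k)) (basis (projection n b))"

lemma configsD: "b \<in> configs \<Longrightarrow> arc_config n b" "b \<in> configs \<Longrightarrow> card b = k"
  by (simp_all add: configs_def)

lemma finite_configs: "finite configs"
proof (rule finite_subset)
  show "configs \<subseteq> Pow (Pow {1..2 * n})" using arc_configD(1) unfolding configs_def by blast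
qed simp

lemma e_carrier: "b \<in> configs \<Longrightarrow> e b \<in> carrier A"
  unfolding e_def by (intro scale_carrier basis_carrier projection_symmetric configsD)

lemma e_nonzeroD: "e b d \<noteq> 0 \<Longrightarrow> d = projection n b"
  by (simp add: e_def basis_def split: if_splits)

lemma e_rank: "b \<in> configs \<Longrightarrow> e b \<in> rank_ideal (Suc i)"
  using e_carrier e_nonzeroD arcs_projection configsD i_le by (fastforce simp: rank_ideal_def)

text \<open>Each composition produces exactly \<open>k\<close> loops, one for each arc of \<open>b\<close>, and the factor \<open>\<delta> ^ k\<close> is cancelled by the
  normalisation of \<open>e b\<close>.\<close>

lemma mult_e:
  assumes b: "b \<in> configs" and y: "y \<in> carrier A" and s: "\<And>d. y d \<noteq> 0 \<Longrightarrow> arcs d 1 = b"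
  shows "y \<otimes>\<^bsub>A\<^esub> e b = y"
proof
  fix d
  let ?P = "projection n b"
  note P = projection_symmetric[OF configsD(1)[OF b]]
  have "(y \<otimes>\<^bsub>A\<^esub> basis ?P) d = (\<Sum>d1\<in>S. if d1 = d then y d1 * \<delta> ^ k else 0)"
    unfolding mult_basis_right[OF P]
  proof (rule sum.cong[OF refl])
    fix d1 assume d1: "d1 \<in> S"
    show "(if compose_diagrams n d1 ?P = d then y d1 * \<delta> ^ closed_loops n d1 ?P else 0) =
        (if d1 = d then y d1 * \<delta> ^ k else 0)"
    proof (cases "y d1 = 0")
      case False
      then have a: "arcs d1 1 = b" by (rule s)
      have "compose_diagrams n d1 ?P = d1" by (rule compose_projection[OF d1 configsD(1)[OF b] equalityD2[OF a]])
      moreover have "closed_loops n d1 ?P = k"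
        using closed_loops_matching[OF symmetric_diagramD(1)[OF d1] symmetric_diagramD(1)[OF P]]
          arcs_projection[OF configsD(1)[OF b], of 0] configsD(2)[OF b] a by simp
      ultimately show ?thesis by auto
    qed auto
  qed
  also have "\<dots> = y d * \<delta> ^ k" using finite_S carrier_outside[OF y, of d] by (cases "d \<in> S") simp_all
  finally show "(y \<otimes>\<^bsub>A\<^esub> e b) d = y d" using parameter by (simp add: e_def mult_scale_right)
qed

lemma e_mult:
  assumes b: "b \<in> configs" and y: "y \<in> carrier A" and s: "\<And>d. y d \<noteq> 0 \<Longrightarrow> arcs d 0 = b"
  shows "e b \<otimes>\<^bsub>A\<^esub> y = y"
proof
  fix d
  let ?P = "projection n b"
  note P = projection_symmetric[OF configsD(1)[OF b]]
  have "(basis ?P \<otimes>\<^bsub>A\<^esub> y) d = (\<Sum>d2\<in>S. if d2 = d then y d2 * \<delta> ^ k else 0)"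
    unfolding mult_basis_left[OF P]
  proof (rule sum.cong[OF refl])
    fix d2 assume d2: "d2 \<in> S"
    show "(if compose_diagrams n ?P d2 = d then y d2 * \<delta> ^ closed_loops n ?P d2 else 0) =
        (if d2 = d then y d2 * \<delta> ^ k else 0)"
    proof (cases "y d2 = 0")
      case False
      then have a: "arcs d2 0 = b" by (rule s)
      have "compose_diagrams n ?P d2 = d2" by (rule projection_compose[OF d2 configsD(1)[OF b] equalityD2[OF a]])
      moreover have "closed_loops n ?P d2 = k"
        using closed_loops_matching[OF symmetric_diagramD(1)[OF P] symmetric_diagramD(1)[OF d2]]
          arcs_projection[OF configsD(1)[OF b], of 1] configsD(2)[OF b] a by simp
      ultimately show ?thesis by auto
    qed auto
  qed
  also have "\<dots> = y d * \<delta> ^ k" using finite_S carrier_outside[OF y, of d] by (cases "d \<in> S") simp_all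
  finally show "(e b \<otimes>\<^bsub>A\<^esub> y) d = y d" using parameter by (simp add: e_def mult_scale_left)
qed

text \<open>Composing two diagrams of \<open>arc_group n b\<close> produces \<open>k\<close> closed loops. Division by \<open>\<delta> ^ k\<close> makes up for them, so that the
  group algebra is embedded multiplicatively.\<close>

definition embed :: "nat set set \<Rightarrow> (diagram \<Rightarrow> 'r) \<Rightarrow> diagram \<Rightarrow> 'r" where
  "embed b \<rho> = (\<lambda>d. if d \<in> carrier (arc_group n b) then inverse (\<delta> ^ k) * \<rho> d else 0)"

lemma embed_carrier: "embed b \<rho> \<in> carrier A"
  by (simp add: embed_def algebra_simps_A arc_group_def)

lemma embed_mult:
  assumes b: "b \<in> configs"
  shows "embed b f \<otimes>\<^bsub>A\<^esub> embed b h = embed b (convolution (arc_group n b) f h)"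
proof
  fix d
  let ?G = "arc_group n b" and ?c = "inverse (\<delta> ^ k)"
  interpret G: group ?G by (rule group_arc_group[OF configsD(1)[OF b]])
  have sub: "carrier ?G \<subseteq> S" by (auto simp: arc_group_def)
  have "(embed b f \<otimes>\<^bsub>A\<^esub> embed b h) d =
      (\<Sum>x\<in>S. if x \<in> carrier ?G then (\<Sum>y\<in>S. if y \<in> carrier ?G then
        (if compose_diagrams n x y = d then ?c * f x * h y else 0) else 0) else 0)"
    unfolding mult_apply
  proof (rule sum.cong[OF refl])
    fix x assume "x \<in> S"
    show "(\<Sum>y\<in>S. if compose_diagrams n x y = d
        then embed b f x * embed b h y * \<delta> ^ closed_loops n x y else 0) =
      (if x \<in> carrier ?G then (\<Sum>y\<in>S. if y \<in> carrier ?G then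
        (if compose_diagrams n x y = d then ?c * f x * h y else 0) else 0) else 0)"
    proof (cases "x \<in> carrier ?G")
      case x: True
      have "(\<Sum>y\<in>S. if compose_diagrams n x y = d
          then embed b f x * embed b h y * \<delta> ^ closed_loops n x y else 0) =
        (\<Sum>y\<in>S. if y \<in> carrier ?G then (if compose_diagrams n x y = d then ?c * f x * h y else 0) else 0)"
      proof (rule sum.cong[OF refl])
        fix y assume "y \<in> S"
        show "(if compose_diagrams n x y = d then embed b f x * embed b h y * \<delta> ^ closed_loops n x y else 0) =
          (if y \<in> carrier ?G then (if compose_diagrams n x y = d then ?c * f x * h y else 0) else 0)"
        proof (cases "y \<in> carrier ?G")
          case y: True
          have X: "x \<in> S" "arcs x 1 = b" and Y: "y \<in> S" "arcs y 0 = b"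
            using x y by (auto simp: arc_group_def)
          have "closed_loops n x y = k"
            using closed_loops_matching[OF symmetric_diagramD(1)[OF X(1)] symmetric_diagramD(1)[OF Y(1)]]
              X(2) Y(2) configsD(2)[OF b] by simp
          then show ?thesis using x y parameter by (simp add: embed_def)
        qed (simp add: embed_def)
      qed
      then show ?thesis using x by simp
    qed (simp add: embed_def cong: if_cong)
  qed
  also have "\<dots> = (\<Sum>x\<in>carrier ?G. \<Sum>y\<in>carrier ?G. if compose_diagrams n x y = d then ?c * f x * h y else 0)"
    using sub finite_S by (simp add: sum.inter_restrict[symmetric] Int_absorb1)
  also have "\<dots> = embed b (convolution ?G f h) d"
  proof (cases "d \<in> carrier ?G")
    case d: True
    have "(\<Sum>y\<in>carrier ?G. if compose_diagrams n x y = d then ?c * f x * h y else 0) =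
        ?c * (f x * h (inv\<^bsub>?G\<^esub> x \<otimes>\<^bsub>?G\<^esub> d))" if x: "x \<in> carrier ?G" for x
    proof -
      have "(\<Sum>y\<in>carrier ?G. if compose_diagrams n x y = d then ?c * f x * h y else 0) =
        (\<Sum>y\<in>carrier ?G. if y = inv\<^bsub>?G\<^esub> x \<otimes>\<^bsub>?G\<^esub> d then ?c * f x * h y else 0)"
      proof (rule sum.cong[OF refl])
        fix y assume y: "y \<in> carrier ?G"
        have "x \<otimes>\<^bsub>?G\<^esub> y = d \<longleftrightarrow> y = inv\<^bsub>?G\<^esub> x \<otimes>\<^bsub>?G\<^esub> d"
          using G.inv_solve_left'[OF y x d] by metis
        moreover have "x \<otimes>\<^bsub>?G\<^esub> y = compose_diagrams n x y" by (simp add: arc_group_def)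
        ultimately show "(if compose_diagrams n x y = d then ?c * f x * h y else 0) =
            (if y = inv\<^bsub>?G\<^esub> x \<otimes>\<^bsub>?G\<^esub> d then ?c * f x * h y else 0)" by simp
      qed
      also have "\<dots> = ?c * (f x * h (inv\<^bsub>?G\<^esub> x \<otimes>\<^bsub>?G\<^esub> d))"
        using finite_arc_group G.m_closed[OF G.inv_closed[OF x] d] by simp
      finally show ?thesis .
    qed
    then show ?thesis using d by (simp add: embed_def convolution_def sum_distrib_left)
  next
    case False
    have "compose_diagrams n x y \<noteq> d" if "x \<in> carrier ?G" "y \<in> carrier ?G" for x y
      using G.m_closed[OF that] False by (auto simp: arc_group_def)
    then show ?thesis using False by (simp add: embed_def)
  qed
  finally show "(embed b f \<otimes>\<^bsub>A\<^esub> embed b h) d = embed b (convolution ?G f h) d" .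
qed

lemma embed_regular:
  assumes b: "b \<in> configs" and \<rho>: "\<And>d. d \<notin> carrier (arc_group n b) \<Longrightarrow> \<rho> d = 0"
  obtains s where "embed b \<rho> \<otimes>\<^bsub>A\<^esub> (embed b s \<otimes>\<^bsub>A\<^esub> embed b \<rho>) = embed b \<rho>"
proof -
  interpret G: group "arc_group n b" by (rule group_arc_group[OF configsD(1)[OF b]])
  have order: "card (carrier (arc_group n b)) = 2 ^ i * fact i"
    using card_arc_group[OF configsD(1)[OF b]] configsD(2)[OF b] i_le by simp
  have nz: "of_nat (card (carrier (arc_group n b))) \<noteq> (0 :: 'r)"
    unfolding order by (rule order_invertible)
  obtain s where "convolution (arc_group n b) \<rho> (convolution (arc_group n b) s \<rho>) = \<rho>"
    by (rule G.group_algebra_regular[where r = \<rho>, OF finite_arc_group nz \<rho>])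
  then show ?thesis using that[of s] by (simp add: embed_mult[OF b])
qed

text \<open>Modulo \<open>rank_ideal i\<close>, the element \<open>x = e b r e c\<close> is supported on diagrams with top arcs \<open>b\<close> and
  bottom arcs \<open>c\<close>. If there is such a diagram \<open>h\<close>, then \<open>y = x u\<close>, with \<open>u\<close> the flip of \<open>h\<close>, lies in
  the embedded group algebra of \<open>arc_group n b\<close>, up to \<open>rank_ideal i\<close>. Regularity gives \<open>s\<close> with
  \<open>y s y = y\<close>; then \<open>f = s y\<close> is an idempotent of the form \<open>a r w\<close>. Multiplying \<open>y = y f\<close> by a multiple of \<open>h\<close>
  returns to \<open>x\<close>, because \<open>u\<close> followed by \<open>h\<close> is the projection with arcs \<open>c\<close>.\<close>

lemma sandwich:
  assumes b: "b \<in> configs" and c: "c \<in> configs" and r: "r \<in> carrier A"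
  shows "\<exists>a\<in>carrier A. \<exists>w\<in>carrier A. \<exists>z\<in>carrier A. \<exists>z'\<in>carrier A.
    a \<otimes>\<^bsub>A\<^esub> r \<otimes>\<^bsub>A\<^esub> w \<otimes>\<^bsub>A\<^esub> (a \<otimes>\<^bsub>A\<^esub> r \<otimes>\<^bsub>A\<^esub> w) \<ominus>\<^bsub>A\<^esub> a \<otimes>\<^bsub>A\<^esub> r \<otimes>\<^bsub>A\<^esub> w \<in> rank_ideal i \<and>
    e b \<otimes>\<^bsub>A\<^esub> r \<otimes>\<^bsub>A\<^esub> e c \<ominus>\<^bsub>A\<^esub> z \<otimes>\<^bsub>A\<^esub> (a \<otimes>\<^bsub>A\<^esub> r \<otimes>\<^bsub>A\<^esub> w) \<otimes>\<^bsub>A\<^esub> z' \<in> rank_ideal i"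
proof -
  interpret I: ideal "rank_ideal i" A by (rule rank_ideal_ideal)
  define x where "x = e b \<otimes>\<^bsub>A\<^esub> r \<otimes>\<^bsub>A\<^esub> e c"
  have xA: "x \<in> carrier A" unfolding x_def by (rule mult_carrier)
  have x_supp: "d \<in> S \<and> b \<subseteq> arcs d 0 \<and> c \<subseteq> arcs d 1" if "x d \<noteq> 0" for d
    using that unfolding x_def
  proof (rule mult_nonzeroE)
    fix d1 d2 assume d: "d1 \<in> S" "d2 \<in> S" "d = compose_diagrams n d1 d2"
      "(e b \<otimes>\<^bsub>A\<^esub> r) d1 \<noteq> 0" "e c d2 \<noteq> 0"
    have "c \<subseteq> arcs d 1"
      using arcs_compose_mono(2)[OF d(1,2)] arcs_projection[OF configsD(1)[OF c], of 1] e_nonzeroD[OF d(5)] d(3)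
      by simp
    moreover have "b \<subseteq> arcs d1 0"
      using d(4)
    proof (rule mult_nonzeroE)
      fix d3 d4 assume d': "d3 \<in> S" "d4 \<in> S" "d1 = compose_diagrams n d3 d4" "e b d3 \<noteq> 0"
      then show ?thesis
        using arcs_compose_mono(1)[OF d'(1,2)] arcs_projection[OF configsD(1)[OF b], of 0] e_nonzeroD[OF d'(4)]
        by simp
    qed
    ultimately show ?thesis using arcs_compose_mono(1)[OF d(1,2)] d(3) compose_symmetric[OF d(1,2)] by blast
  qed
  \<comment> \<open>a diagram that has more arcs than prescribed has too few through strands\<close>
  have low: "n < card (arcs d 1) + i"
    if "d \<in> S" "b' \<subseteq> arcs d 0" "c' \<subseteq> arcs d 1" "\<not> (arcs d 0 = b' \<and> arcs d 1 = c')"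
      "card b' = k" "card c' = k" for d b' c'
  proof -
    note B = symmetric_diagramD(1)[OF that(1)]
    have le: "k \<le> card (arcs d 1)" using card_mono[OF finite_arcs[OF B] that(3)] that(6) by simp
    have "card (arcs d 1) \<noteq> k"
    proof
      assume eq: "card (arcs d 1) = k"
      have "c' = arcs d 1" by (rule card_subset_eq[OF finite_arcs[OF B] that(3)]) (use eq that(6) in simp)
      moreover have "b' = arcs d 0"
        by (rule card_subset_eq[OF finite_arcs[OF B] that(2)]) (use eq that(5) card_arcs_eq[OF B] in simp)
      ultimately show False using that(4) by simp
    qed
    then show ?thesis using le i_le by simp
  qed
  show ?thesis
  proof (cases "\<exists>h\<in>S. arcs h 0 = b \<and> arcs h 1 = c")
    case False
    have "x \<in> rank_ideal i"
    proof -
      have "n < card (arcs d 1) + i" if "x d \<noteq> 0" for d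
        using low[of d b c] x_supp[OF that] False configsD(2)[OF b] configsD(2)[OF c] by blast
      then show ?thesis using xA unfolding rank_ideal_def by blast
    qed
    then show ?thesis
      using r by (intro bexI[of _ "\<zero>\<^bsub>A\<^esub>"]) (simp_all add: x_def[symmetric] a_minus_def xA)
  next
    case True
    then obtain h where h: "h \<in> S" "arcs h 0 = b" "arcs h 1 = c" by blast
    let ?u = "flip h" and ?G = "arc_group n b"
    have u: "?u \<in> S" "arcs ?u 0 = c" "arcs ?u 1 = b"
      using flip_symmetric[OF h(1)] arcs_flip[of h] h by simp_all
    define y where "y = x \<otimes>\<^bsub>A\<^esub> basis ?u"
    have yA: "y \<in> carrier A" unfolding y_def by (rule mult_carrier)
    have y_supp: "d \<in> S \<and> b \<subseteq> arcs d 0 \<and> b \<subseteq> arcs d 1" if "y d \<noteq> 0" for d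
      using that unfolding y_def
    proof (rule mult_nonzeroE)
      fix d1 d2 assume d: "d1 \<in> S" "d2 \<in> S" "d = compose_diagrams n d1 d2" "x d1 \<noteq> 0"
        "(basis ?u :: diagram \<Rightarrow> 'r) d2 \<noteq> 0"
      have "d2 = ?u" using d(5) by (simp add: basis_def split: if_splits)
      then have "b \<subseteq> arcs d 1" using arcs_compose_mono(2)[OF d(1,2)] u(3) d(3) by simp
      moreover have "b \<subseteq> arcs d 0" using arcs_compose_mono(1)[OF d(1,2)] x_supp[OF d(4)] d(3) by blast
      ultimately show ?thesis using compose_symmetric[OF d(1,2)] d(3) by simp
    qed
    \<comment> \<open>the element of the group algebra whose embedding is \<open>y\<close> up to \<open>rank_ideal i\<close>\<close>
    define \<rho> where "\<rho> = (\<lambda>d. if d \<in> carrier ?G then \<delta> ^ k * y d else 0)"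
    obtain s where s: "embed b \<rho> \<otimes>\<^bsub>A\<^esub> (embed b s \<otimes>\<^bsub>A\<^esub> embed b \<rho>) = embed b \<rho>"
      using embed_regular[OF b, of \<rho>] by (auto simp: \<rho>_def)
    have "y \<ominus>\<^bsub>A\<^esub> embed b \<rho> \<in> rank_ideal i"
    proof -
      have "n < card (arcs d 1) + i" if "(y \<ominus>\<^bsub>A\<^esub> embed b \<rho>) d \<noteq> 0" for d
      proof -
        have nz: "y d - embed b \<rho> d \<noteq> 0" using that unfolding minus_apply[OF yA embed_carrier] .
        have dG: "d \<notin> carrier ?G"
          using nz parameter by (auto simp: embed_def \<rho>_def)
        then have "y d \<noteq> 0" using nz by (simp add: embed_def)
        then show ?thesis
          using low[of d b b] y_supp dG configsD(2)[OF b] by (auto simp: arc_group_def)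
      qed
      then show ?thesis using yA embed_carrier unfolding rank_ideal_def by blast
    qed
    let ?\<pi> = "\<lambda>a. rank_ideal i +>\<^bsub>A\<^esub> a"
    let ?Es = "embed b s" and ?E\<rho> = "embed b \<rho>"
    note E = embed_carrier[of b s] embed_carrier[of b \<rho>]
    have py: "?\<pi> y = ?\<pi> ?E\<rho>"
      using I.quot_eq_iff[OF yA E(2)] \<open>y \<ominus>\<^bsub>A\<^esub> ?E\<rho> \<in> rank_ideal i\<close> by blast
    let ?a = "?Es \<otimes>\<^bsub>A\<^esub> e b" and ?w = "e c \<otimes>\<^bsub>A\<^esub> basis ?u"
    define f where "f = ?Es \<otimes>\<^bsub>A\<^esub> y"
    have fA: "f \<in> carrier A" unfolding f_def by (rule mult_carrier)
    have arw: "?a \<otimes>\<^bsub>A\<^esub> r \<otimes>\<^bsub>A\<^esub> ?w = f"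
      unfolding f_def y_def x_def by (simp only: mult_assoc_A)
    have pf: "?\<pi> f = ?\<pi> (?Es \<otimes>\<^bsub>A\<^esub> ?E\<rho>)"
      unfolding f_def using I.quot_mult[OF E(1) yA] I.quot_mult[OF E] py by simp
    have "?\<pi> (f \<otimes>\<^bsub>A\<^esub> f) = ?\<pi> (?Es \<otimes>\<^bsub>A\<^esub> ?E\<rho> \<otimes>\<^bsub>A\<^esub> (?Es \<otimes>\<^bsub>A\<^esub> ?E\<rho>))"
      using I.quot_mult[OF fA fA] I.quot_mult[OF mult_carrier[of ?Es ?E\<rho>] mult_carrier[of ?Es ?E\<rho>]] pf by simp
    also have "?Es \<otimes>\<^bsub>A\<^esub> ?E\<rho> \<otimes>\<^bsub>A\<^esub> (?Es \<otimes>\<^bsub>A\<^esub> ?E\<rho>) = ?Es \<otimes>\<^bsub>A\<^esub> ?E\<rho>"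
      unfolding mult_assoc_A s ..
    finally have ff: "f \<otimes>\<^bsub>A\<^esub> f \<ominus>\<^bsub>A\<^esub> f \<in> rank_ideal i"
      using I.quot_eq_iff[OF mult_carrier[of f f] fA] pf by simp
    have yf: "?\<pi> (y \<otimes>\<^bsub>A\<^esub> f) = ?\<pi> y"
    proof -
      have "?\<pi> (y \<otimes>\<^bsub>A\<^esub> f) = ?\<pi> (?E\<rho> \<otimes>\<^bsub>A\<^esub> (?Es \<otimes>\<^bsub>A\<^esub> ?E\<rho>))"
        using I.quot_mult[OF yA fA] I.quot_mult[OF E(2) mult_carrier[of ?Es ?E\<rho>]] py pf by simp
      then show ?thesis using s py by simp
    qed
    let ?z = "scale_fun (inverse (\<delta> ^ k * \<delta> ^ k)) (basis h) :: diagram \<Rightarrow> 'r"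
    have zA: "?z \<in> carrier A" by (intro scale_carrier basis_carrier h(1))
    have yz: "y \<otimes>\<^bsub>A\<^esub> ?z = x"
    proof -
      have "compose_diagrams n ?u h = projection n c"
        using compose_flip[OF u(1)] unfolding flip_flip u(2) .
      moreover have "closed_loops n ?u h = k"
        using closed_loops_matching[OF symmetric_diagramD(1)[OF u(1)] symmetric_diagramD(1)[OF h(1)]]
          u(3) h(2) configsD(2)[OF b] by simp
      ultimately have uh: "basis ?u \<otimes>\<^bsub>A\<^esub> basis h = scale_fun (\<delta> ^ k) (basis (projection n c))"
        using basis_mult[OF u(1) h(1)] by simp
      have "basis ?u \<otimes>\<^bsub>A\<^esub> ?z = e c"
        unfolding mult_scale_right uh e_def using parameter by (auto simp: fun_eq_iff field_simps)
      then have "y \<otimes>\<^bsub>A\<^esub> ?z = x \<otimes>\<^bsub>A\<^esub> e c" unfolding y_def mult_assoc_A by simp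
      also have "\<dots> = e b \<otimes>\<^bsub>A\<^esub> r \<otimes>\<^bsub>A\<^esub> (e c \<otimes>\<^bsub>A\<^esub> e c)" unfolding x_def mult_assoc_A ..
      also have "e c \<otimes>\<^bsub>A\<^esub> e c = e c"
        using mult_e[OF c e_carrier[OF c]] e_nonzeroD arcs_projection[OF configsD(1)[OF c], of 1] by auto
      finally show ?thesis unfolding x_def .
    qed
    have "?\<pi> x = ?\<pi> (y \<otimes>\<^bsub>A\<^esub> f \<otimes>\<^bsub>A\<^esub> ?z)"
      using I.quot_mult[OF yA zA] I.quot_mult[OF mult_carrier[of y f] zA] yf yz by simp
    then have "x \<ominus>\<^bsub>A\<^esub> y \<otimes>\<^bsub>A\<^esub> f \<otimes>\<^bsub>A\<^esub> ?z \<in> rank_ideal i"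
      using I.quot_eq_iff[OF xA mult_carrier[of "y \<otimes>\<^bsub>A\<^esub> f" ?z]] by blast
    then show ?thesis
      using ff arw yA zA mult_carrier unfolding x_def
      by (intro bexI[of _ ?a] bexI[of _ ?w] bexI[of _ y] bexI[of _ ?z]) simp_all
  qed
qed

text \<open>The coordinate of \<open>y\<close> at \<open>b\<close> is its part with bottom arcs \<open>b\<close>. It is a left module homomorphism modulo
  \<open>rank_ideal i\<close>: multiplication on the left can only add bottom arcs, and then a through strand is lost. The part
  with top arcs \<open>b\<close> plays the same role on the other side.\<close>

lemma heredity_layer:
  "heredity_ideal (A Quot rank_ideal i) ((\<lambda>a. rank_ideal i +>\<^bsub>A\<^esub> a) ` rank_ideal (Suc i))"
proof -
  interpret I: ideal "rank_ideal i" A by (rule rank_ideal_ideal)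
  let ?J = "rank_ideal (Suc i)"
  \<comment> \<open>\<open>\<phi> r b\<close> extracts the part whose arcs in row \<open>r\<close> are \<open>b\<close>\<close>
  define \<phi> where "\<phi> = (\<lambda>r b (y :: diagram \<Rightarrow> 'r) d. if arcs d r = b then y d else 0)"
  have J: "y \<in> carrier A" "y d \<noteq> 0 \<Longrightarrow> k \<le> card (arcs d 1)" "y d \<noteq> 0 \<Longrightarrow> d \<in> S" if "y \<in> ?J" for y d
  proof -
    show yA: "y \<in> carrier A" by (rule rank_ideal_carrier[OF that])
    show "d \<in> S" if "y d \<noteq> 0" using carrier_outside[OF yA] that by blast
    show "k \<le> card (arcs d 1)" if "y d \<noteq> 0"
      using \<open>y \<in> ?J\<close> that unfolding rank_ideal_def by fastforce
  qed
  have phi_J: "\<phi> r b y \<in> ?J" if "y \<in> ?J" for r b y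
    using that by (auto simp: \<phi>_def rank_ideal_def algebra_simps_A(1))
  have I_mem: "x \<ominus>\<^bsub>A\<^esub> y \<in> rank_ideal i"
    if "x \<in> carrier A" "y \<in> carrier A" "\<And>d. card (arcs d 1) \<le> k \<Longrightarrow> x d = y d" for x y
  proof -
    have "n < card (arcs d 1) + i" if "(x \<ominus>\<^bsub>A\<^esub> y) d \<noteq> 0" for d
    proof (rule ccontr)
      assume "\<not> n < card (arcs d 1) + i"
      then have "x d = y d" using \<open>\<And>d. card (arcs d 1) \<le> k \<Longrightarrow> x d = y d\<close> by simp
      then show False using \<open>(x \<ominus>\<^bsub>A\<^esub> y) d \<noteq> 0\<close> minus_apply[OF \<open>x \<in> carrier A\<close> \<open>y \<in> carrier A\<close>] by simp
    qed
    then show ?thesis using that(1,2) unfolding rank_ideal_def by blast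
  qed
  have sum_phi: "(\<Sum>b\<in>configs. \<phi> r b y d) = y d"
    if y: "y \<in> ?J" and d: "card (arcs d 1) \<le> k" and r: "r = 0 \<or> r = 1" for y d r
  proof (cases "y d = 0")
    case True
    then show ?thesis by (simp add: \<phi>_def cong: if_cong)
  next
    case False
    note dS = J(3)[OF y False]
    have c1: "card (arcs d 1) = k" using J(2)[OF y False] d by simp
    have "card (arcs d r) = k" using r c1 card_arcs_eq[OF symmetric_diagramD(1)[OF dS]] by auto
    then have "arcs d r \<in> configs" using arc_config_arcs[OF dS] by (simp add: configs_def)
    then show ?thesis using finite_configs by (simp add: \<phi>_def)
  qed
  show ?thesis
  proof (rule I.heredity_ideal_quotient[where B = configs and e = e and \<phi> = "\<phi> 1"])
    show "finite_left_length A" by (rule finite_left_length_A)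
    show "ideal ?J A" by (rule rank_ideal_ideal)
    show "finite configs" by (rule finite_configs)
    show "e b \<in> ?J" if "b \<in> configs" for b by (rule e_rank[OF that])
    show "inj_on (\<lambda>b. rank_ideal i +>\<^bsub>A\<^esub> e b) configs"
    proof (rule inj_onI)
      fix b c assume b: "b \<in> configs" and c: "c \<in> configs"
        and eq: "rank_ideal i +>\<^bsub>A\<^esub> e b = rank_ideal i +>\<^bsub>A\<^esub> e c"
      have m: "e b \<ominus>\<^bsub>A\<^esub> e c \<in> rank_ideal i" using I.quot_eq_iff[OF e_carrier[OF b] e_carrier[OF c]] eq by blast
      let ?P = "projection n b"
      have "card (arcs ?P 1) = k" using arcs_projection[OF configsD(1)[OF b], of 1] configsD(2)[OF b] by simp
      then have "\<not> n < card (arcs ?P 1) + i" using i_le by simp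
      then have "(e b \<ominus>\<^bsub>A\<^esub> e c) ?P = 0" using m unfolding rank_ideal_def by blast
      then have "e b ?P = e c ?P" using minus_apply[OF e_carrier[OF b] e_carrier[OF c]] by simp
      moreover have "e b ?P \<noteq> 0" using parameter by (simp add: e_def basis_def)
      ultimately have "?P = projection n c" using e_nonzeroD by metis
      then show "b = c" using arcs_projection[OF configsD(1)[OF b], of 1] arcs_projection[OF configsD(1)[OF c], of 1] by simp
    qed
    show "\<phi> 1 b y \<in> ?J" if "y \<in> ?J" for b y by (rule phi_J[OF that])
    show "\<phi> 1 b x \<ominus>\<^bsub>A\<^esub> \<phi> 1 b y \<in> rank_ideal i" if "b \<in> configs" "x \<in> ?J" "y \<in> ?J" "x \<ominus>\<^bsub>A\<^esub> y \<in> rank_ideal i" for b x y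
    proof (rule I_mem[OF J(1)[OF phi_J[OF that(2)]] J(1)[OF phi_J[OF that(3)]]])
      fix d assume d: "card (arcs d 1) \<le> k"
      have "\<not> n < card (arcs d 1) + i" using d i_le by simp
      then have "(x \<ominus>\<^bsub>A\<^esub> y) d = 0" using that(4) unfolding rank_ideal_def by blast
      then show "\<phi> 1 b x d = \<phi> 1 b y d"
        using minus_apply[OF J(1)[OF that(2)] J(1)[OF that(3)]] by (simp add: \<phi>_def)
    qed
    show "\<phi> 1 b (x \<oplus>\<^bsub>A\<^esub> y) = \<phi> 1 b x \<oplus>\<^bsub>A\<^esub> \<phi> 1 b y" for b x y
      by (auto simp: \<phi>_def algebra_simps_A(3))
    show "\<phi> 1 b (a \<otimes>\<^bsub>A\<^esub> y) \<ominus>\<^bsub>A\<^esub> a \<otimes>\<^bsub>A\<^esub> \<phi> 1 b y \<in> rank_ideal i"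
      if b: "b \<in> configs" and y: "y \<in> ?J" for b a y
    proof (rule I_mem)
      show "a \<otimes>\<^bsub>A\<^esub> \<phi> 1 b y \<in> carrier A" by (rule mult_carrier)
      show "\<phi> 1 b (a \<otimes>\<^bsub>A\<^esub> y) \<in> carrier A" using mult_carrier[of a y] by (simp add: \<phi>_def algebra_simps_A(1))
      fix d assume d: "card (arcs d 1) \<le> k"
      have "(a \<otimes>\<^bsub>A\<^esub> \<phi> 1 b y) d = (\<Sum>d1\<in>S. \<Sum>d2\<in>S. if compose_diagrams n d1 d2 = d
          then (if arcs d 1 = b then a d1 * y d2 * \<delta> ^ closed_loops n d1 d2 else 0) else 0)"
        unfolding mult_apply
      proof (intro sum.cong refl)
        fix d1 d2 assume S: "d1 \<in> S" "d2 \<in> S"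
        show "(if compose_diagrams n d1 d2 = d then a d1 * \<phi> 1 b y d2 * \<delta> ^ closed_loops n d1 d2 else 0) =
          (if compose_diagrams n d1 d2 = d
           then (if arcs d 1 = b then a d1 * y d2 * \<delta> ^ closed_loops n d1 d2 else 0) else 0)"
        proof (cases "compose_diagrams n d1 d2 = d \<and> y d2 \<noteq> 0")
          case True
          note C = compose_brauer[OF symmetric_diagramD(1)[OF S(1)] symmetric_diagramD(1)[OF S(2)]]
          have "card (arcs d2 1) = card (arcs d 1)"
            using J(2)[OF y] True d arcs_compose_mono(4)[OF S] by fastforce
          then have "arcs d2 1 = arcs d 1"
            using card_subset_eq[OF finite_arcs[OF C] arcs_compose_mono(2)[OF S]] True by simp
          then show ?thesis by (simp add: \<phi>_def)
        qed (auto simp: \<phi>_def)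
      qed
      also have "\<dots> = \<phi> 1 b (a \<otimes>\<^bsub>A\<^esub> y) d"
        by (cases "arcs d 1 = b") (simp_all add: \<phi>_def mult_apply cong: if_cong)
      finally show "\<phi> 1 b (a \<otimes>\<^bsub>A\<^esub> y) d = (a \<otimes>\<^bsub>A\<^esub> \<phi> 1 b y) d" by simp
    qed
    show "y \<ominus>\<^bsub>A\<^esub> (\<Oplus>\<^bsub>A\<^esub>b\<in>configs. \<phi> 1 b y \<otimes>\<^bsub>A\<^esub> e b) \<in> rank_ideal i" if y: "y \<in> ?J" for y
    proof (rule I_mem[OF J(1)[OF y]])
      have F: "(\<lambda>b. \<phi> 1 b y \<otimes>\<^bsub>A\<^esub> e b) \<in> configs \<rightarrow> carrier A" using mult_carrier by blast
      then show "(\<Oplus>\<^bsub>A\<^esub>b\<in>configs. \<phi> 1 b y \<otimes>\<^bsub>A\<^esub> e b) \<in> carrier A" by (rule finsum_closed)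
      fix d assume d: "card (arcs d 1) \<le> k"
      have "\<phi> 1 b y \<otimes>\<^bsub>A\<^esub> e b = \<phi> 1 b y" if "b \<in> configs" for b
        by (rule mult_e[OF that J(1)[OF phi_J[OF y]]]) (simp add: \<phi>_def split: if_splits)
      then have "(\<Oplus>\<^bsub>A\<^esub>b\<in>configs. \<phi> 1 b y \<otimes>\<^bsub>A\<^esub> e b) d = (\<Sum>b\<in>configs. \<phi> 1 b y d)"
        unfolding finsum_apply[OF finite_configs F] by (intro sum.cong refl) simp
      then show "y d = (\<Oplus>\<^bsub>A\<^esub>b\<in>configs. \<phi> 1 b y \<otimes>\<^bsub>A\<^esub> e b) d" using sum_phi[OF y d, of 1] by simp
    qed
    show "\<exists>\<psi>. \<psi> \<in> configs \<rightarrow> carrier A \<and> y \<ominus>\<^bsub>A\<^esub> (\<Oplus>\<^bsub>A\<^esub>b\<in>configs. e b \<otimes>\<^bsub>A\<^esub> \<psi> b) \<in> rank_ideal i"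
      if y: "y \<in> ?J" for y
    proof (intro exI[of _ "\<lambda>b. \<phi> 0 b y"] conjI)
      show "(\<lambda>b. \<phi> 0 b y) \<in> configs \<rightarrow> carrier A" using J(1)[OF phi_J[OF y]] by blast
      show "y \<ominus>\<^bsub>A\<^esub> (\<Oplus>\<^bsub>A\<^esub>b\<in>configs. e b \<otimes>\<^bsub>A\<^esub> \<phi> 0 b y) \<in> rank_ideal i"
      proof (rule I_mem[OF J(1)[OF y]])
        have F: "(\<lambda>b. e b \<otimes>\<^bsub>A\<^esub> \<phi> 0 b y) \<in> configs \<rightarrow> carrier A" using mult_carrier by blast
        then show "(\<Oplus>\<^bsub>A\<^esub>b\<in>configs. e b \<otimes>\<^bsub>A\<^esub> \<phi> 0 b y) \<in> carrier A" by (rule finsum_closed)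
        fix d assume d: "card (arcs d 1) \<le> k"
        have "e b \<otimes>\<^bsub>A\<^esub> \<phi> 0 b y = \<phi> 0 b y" if "b \<in> configs" for b
          by (rule e_mult[OF that J(1)[OF phi_J[OF y]]]) (simp add: \<phi>_def split: if_splits)
        then have "(\<Oplus>\<^bsub>A\<^esub>b\<in>configs. e b \<otimes>\<^bsub>A\<^esub> \<phi> 0 b y) d = (\<Sum>b\<in>configs. \<phi> 0 b y d)"
          unfolding finsum_apply[OF finite_configs F] by (intro sum.cong refl) simp
        then show "y d = (\<Oplus>\<^bsub>A\<^esub>b\<in>configs. e b \<otimes>\<^bsub>A\<^esub> \<phi> 0 b y) d" using sum_phi[OF y d, of 0] by simp
      qed
    qed
    show "\<exists>a\<in>carrier A. \<exists>w\<in>carrier A. \<exists>z\<in>carrier A. \<exists>z'\<in>carrier A.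
        a \<otimes>\<^bsub>A\<^esub> r \<otimes>\<^bsub>A\<^esub> w \<otimes>\<^bsub>A\<^esub> (a \<otimes>\<^bsub>A\<^esub> r \<otimes>\<^bsub>A\<^esub> w) \<ominus>\<^bsub>A\<^esub> a \<otimes>\<^bsub>A\<^esub> r \<otimes>\<^bsub>A\<^esub> w \<in> rank_ideal i \<and>
        e b \<otimes>\<^bsub>A\<^esub> r \<otimes>\<^bsub>A\<^esub> e c \<ominus>\<^bsub>A\<^esub> z \<otimes>\<^bsub>A\<^esub> (a \<otimes>\<^bsub>A\<^esub> r \<otimes>\<^bsub>A\<^esub> w) \<otimes>\<^bsub>A\<^esub> z' \<in> rank_ideal i"
      if "b \<in> configs" "c \<in> configs" "r \<in> carrier A" for b c r
      by (rule sandwich[OF that])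
  qed
qed

end

text \<open>A prime dividing \<open>2 ^ i * fact i\<close> is 2 or at most \<open>i\<close>. If it exceeds \<open>n\<close>, only 2 remains, and then
  \<open>n = 1\<close>, the excluded case.\<close>

lemma of_nat_hyperoctahedral_order:
  assumes "n \<ge> 1" "\<not> (n = 1 \<and> CHAR('r::field) = 2)" "CHAR('r) = 0 \<or> CHAR('r) > n" "i \<le> n"
  shows "of_nat (2 ^ i * fact i) \<noteq> (0 :: 'r)"
proof
  assume "of_nat (2 ^ i * fact i) = (0 :: 'r)"
  then have dvd: "CHAR('r) dvd 2 ^ i * fact i" by (simp only: of_nat_eq_0_iff_char_dvd)
  then have pos: "CHAR('r) > 0" by (intro gr0I) simp
  then have prime: "prime CHAR('r)" by (rule prime_CHAR_semidom)
  from dvd have "CHAR('r) dvd 2 ^ i \<or> CHAR('r) dvd fact i"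
    using prime_dvd_mult_iff[OF prime] by blast
  then show False
  proof
    assume "CHAR('r) dvd 2 ^ i"
    then have "CHAR('r) dvd 2" using prime prime_dvd_power by blast
    then have "CHAR('r) = 2" using prime primes_dvd_imp_eq two_is_prime_nat by blast
    then show False using assms(1-3) by auto
  next
    assume "CHAR('r) dvd fact i"
    then have "CHAR('r) \<le> i" using prime prime_dvd_fact_iff by blast
    then show False using assms(3,4) pos by simp
  qed
qed

theorem corollary6:
  fixes n :: nat and \<delta> :: "'r::field"
  assumes "n \<ge> 1"
    and "\<not> (n = 1 \<and> CHAR('r) = 2)"
  shows "quasi_hereditary (brauer_algebra_C n \<delta>) \<longleftrightarrow>
           \<delta> \<noteq> 0 \<and> (CHAR('r) = 0 \<or> CHAR('r) > n)"
proof
  interpret type_C_brauer n \<delta> .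
  assume "quasi_hereditary (brauer_algebra_C n \<delta>)"
  then show "\<delta> \<noteq> 0 \<and> (CHAR('r) = 0 \<or> CHAR('r) > n)"
    using quasi_hereditary_parameter_nonzero[OF assms(1)] quasi_hereditary_char_large by blast
next
  interpret type_C_brauer n \<delta> .
  assume R: "\<delta> \<noteq> 0 \<and> (CHAR('r) = 0 \<or> CHAR('r) > n)"
  have "heredity_ideal (A Quot rank_ideal i) ((\<lambda>a. rank_ideal i +>\<^bsub>A\<^esub> a) ` rank_ideal (Suc i))"
    if "i < Suc n" for i
  proof -
    interpret brauer_layer n \<delta> i
      by unfold_locales (use R that of_nat_hyperoctahedral_order[OF assms, of i] in auto)
    show ?thesis by (rule heredity_layer)
  qed
  then show "quasi_hereditary (brauer_algebra_C n \<delta>)"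
    unfolding quasi_hereditary_def
    using rank_ideal_zero rank_ideal_top rank_ideal_ideal rank_ideal_strict
    by (intro exI[of _ "Suc n"] exI[of _ rank_ideal]) auto
qed

end
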